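(* The decision version of computing the uniform value for the class of Markov blind MDPs is undecidable. That is, there is no algorithm which, given as input a Markov blind MDP $\Gamma=(\mathcal{K},\mathcal{I},p,g)$ with uniform value $v$, an initial belief $b_1\in\Delta(\mathcal{K})$ and a number $x\in[0,1]$, always halts and correctly decides whether $v(b_1)>x$ or $v(b_1)\le x$. In particular, the decision version of computing the uniform value for ergodic blind stochastic games is undecidable: there is no algorithm which, given an ergodic blind stochastic game $\Gamma=(\mathcal{K},\mathcal{I},\mathcal{J},p,g)$ with uniform value $v$, an initial belief $b_1\in\Delta(\mathcal{K})$ and $x\in[0,1]$, always halts and correctly decides whether $v(b_1)>x$ or $v(b_1)\le x$.
   Context: For a finite set $\mathcal{C}$, $\Delta(\mathcal{C})$ is the set of probability distributions on $\mathcal{C}$. Blind stochastic game. A (two-player zero-sum) blind stochastic game is a tuple $\Gamma=(\mathcal{K},\mathcal{I},\mathcal{J},p,g)$, where $\mathcal{K}$ (states), $\mathcal{I}$ (actions of Player 1) and $\mathcal{J}$ (actions of Player 2) are finite nonempty sets, $p\colon\mathcal{K}\times\mathcal{I}\times\mathcal{J}\to\Delta(\mathcal{K})$ is the transition function, written $p(k'|k,i,j)=p(k,i,j)(k')$, and $g\colon\mathcal{K}\times\mathcal{I}\times\mathcal{J}\to[0,1]$ is the stage reward. For $(i,j)\in\mathcal{I}\times\mathcal{J}$, $P(i,j)=(p(k'|k,i,j))_{k,k'\in\mathcal{K}}$ is the transition matrix. Given an initial belief $b_1\in\Delta(\mathcal{K})$, the initial state $K_1$ is drawn from $b_1$. At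 each stage $m\ge1$ the players simultaneously choose actions $I_m\in\mathcal{I}$, $J_m\in\mathcal{J}$; the stage reward is $G_m=g(K_m,I_m,J_m)$ and $K_{m+1}$ is drawn from $p(K_m,I_m,J_m)$. The players know $b_1$ and observe past actions of both players, but observe neither states nor rewards. Let $\mathcal{H}_m=(\mathcal{I}\times\mathcal{J})^{m-1}$. A strategy of Player 1 is a map $\sigma\colon\bigcup_{m\ge1}\mathcal{H}_m\to\Delta(\mathcal{I})$ and a strategy of Player 2 is a map $\pi\colon\bigcup_{m\ge1}\mathcal{H}_m\to\Delta(\mathcal{J})$ (the two players randomize independently at each stage given the history); the strategy sets are $\Sigma$ and $\Pi$. $\mathbb{E}^{b_1}_{\sigma,\pi}$ denotes expectation under the law on plays induced by $(\sigma,\pi)$ and $b_1$. For $N\ge1$ let $\gamma_N^{b_1}(\sigma,\pi)=\mathbb{E}^{b_1}_{\sigma,\pi}\left(\frac1N\sum_{m=1}^N G_m\right)$. Uniform value. $\Gamma$ has a uniform value $v\colon\Delta(\mathcal{K})\to[0,1]$ if for all $b_1\in\Delta(\mathcal{K})$ and all $\varepsilon>0$ there exist $(\sigma^*,\pi^* )\in\Sigma\times\Pi$ and $\overline{n}\ge1$ such that for all $N\ge\overline{n}$ and all $(\sigma,\pi)\in\Sigma\times\Pi$: $\gamma_N^{b_1}(\sigma^*,\pi)\ge v(b_1)-\varepsilon$ and $\gamma_N^{b_1}(\sigma,\pi^* )\le v(b_1)+\varepsilon$. (Every ergodic blind stochastic game, and every blind MDP, has a uniform value.) Blind MDP. A blind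 MDP $\Gamma=(\mathcal{K},\mathcal{I},p,g)$ is the single-player case, with $p\colon\mathcal{K}\times\mathcal{I}\to\Delta(\mathcal{K})$ and $g\colon\mathcal{K}\times\mathcal{I}\to[0,1]$ (i.e. a blind stochastic game in which $\mathcal{J}$ is a singleton); $P(i)=(p(k'|k,i))_{k,k'\in\mathcal{K}}$ is the transition matrix of action $i$. A stochastic matrix is Markov if at least one of its columns has all entries strictly positive. A blind MDP is Markov if $P(i)$ is a Markov matrix for every $i\in\mathcal{I}$. Ergodicity. For a stochastic matrix $P=(p_{k,k'})$ on $\mathcal{K}\times\mathcal{K}$ let $\tau_1(P)=\frac12\max_{k,\overline{k}\in\mathcal{K}}\sum_{k'\in\mathcal{K}}|p_{k,k'}-p_{\overline{k},k'}|$. For $a^n=(a_1,\dots,a_n)\in(\mathcal{I}\times\mathcal{J})^n$ let $T^n(a^n)=P(a_1)P(a_2)\cdots P(a_n)$. The game $\Gamma$ is ergodic if for all $\varepsilon>0$ there exists an integer $n_0$ such that for all $n\ge n_0$ and all $a^n\in(\mathcal{I}\times\mathcal{J})^n$, $\tau_1(T^n(a^n))\le\varepsilon$. Decidability. A problem is decidable if there is an algorithm solving it on all inputs, and undecidable otherwise. As usual, numerical input data (transition probabilities, rewards, $b_1$, $x$) are finitely encoded, e.g. rational numbers. *)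

theory Defs
  imports "HOL-Probability.Probability" "HOL-Library.Nat_Bijection"
begin

section \<open>Blind stochastic games\<close>

record ('k, 'i, 'j) game =
  states :: "'k set"
  acts1 :: "'i set"
  acts2 :: "'j set"
  trans :: "'k \<Rightarrow> 'i \<Rightarrow> 'j \<Rightarrow> 'k pmf"
  reward :: "'k \<Rightarrow> 'i \<Rightarrow> 'j \<Rightarrow> real"

definition distributions :: "'a set \<Rightarrow> 'a pmf set" where
  "distributions C = {q. set_pmf q \<subseteq> C}"

definition blind_stochastic_game :: "('k, 'i, 'j) game \<Rightarrow> bool" where
  "blind_stochastic_game \<Gamma> \<longleftrightarrow>
     finite (states \<Gamma>) \<and> states \<Gamma> \<noteq> {} \<and>
     finite (acts1 \<Gamma>) \<and> acts1 \<Gamma> \<noteq> {} \<and>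
     finite (acts2 \<Gamma>) \<and> acts2 \<Gamma> \<noteq> {} \<and>
     (\<forall>k\<in>states \<Gamma>. \<forall>i\<in>acts1 \<Gamma>. \<forall>j\<in>acts2 \<Gamma>.
        trans \<Gamma> k i j \<in> distributions (states \<Gamma>) \<and> reward \<Gamma> k i j \<in> {0..1})"

text \<open>Histories list the observed action pairs in chronological order.\<close>

type_synonym ('i, 'j) history = "('i \<times> 'j) list"

definition histories :: "('k, 'i, 'j) game \<Rightarrow> ('i, 'j) history set" where
  "histories \<Gamma> = lists (acts1 \<Gamma> \<times> acts2 \<Gamma>)"

definition strategies1 :: "('k, 'i, 'j) game \<Rightarrow> (('i, 'j) history \<Rightarrow> 'i pmf) set" where
  "strategies1 \<Gamma> = {\<sigma>. \<forall>h\<in>histories \<Gamma>. \<sigma> h \<in> distributions (acts1 \<Gamma>)}"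

definition strategies2 :: "('k, 'i, 'j) game \<Rightarrow> (('i, 'j) history \<Rightarrow> 'j pmf) set" where
  "strategies2 \<Gamma> = {\<pi>. \<forall>h\<in>histories \<Gamma>. \<pi> h \<in> distributions (acts2 \<Gamma>)}"

text \<open>
  The law of the first \<open>N\<close> stages: \<open>play \<Gamma> b \<sigma> \<pi> N\<close> is the joint distribution of
  \<open>[(K\<^sub>1, I\<^sub>1, J\<^sub>1), \<dots>, (K\<^sub>N, I\<^sub>N, J\<^sub>N)]\<close> and of the next state \<open>K\<^sub>N\<^sub>+\<^sub>1\<close>. The strategies
  only see the action pairs \<open>map snd w\<close>. These finite-stage marginals of the law on infinite
  plays suffice, since \<open>\<gamma>\<^sub>N\<close> depends only on the first \<open>N\<close> stages.
\<close>

primrec play :: "('k, 'i, 'j) game \<Rightarrow> 'k pmf \<Rightarrow> (('i, 'j) history \<Rightarrow> 'i pmf) \<Rightarrow>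
    (('i, 'j) history \<Rightarrow> 'j pmf) \<Rightarrow> nat \<Rightarrow> (('k \<times> 'i \<times> 'j) list \<times> 'k) pmf" where
  "play \<Gamma> b \<sigma> \<pi> 0 = map_pmf (\<lambda>k. ([], k)) b"
| "play \<Gamma> b \<sigma> \<pi> (Suc m) =
     bind_pmf (play \<Gamma> b \<sigma> \<pi> m) (\<lambda>(w, k).
     bind_pmf (\<sigma> (map snd w)) (\<lambda>i.
     bind_pmf (\<pi> (map snd w)) (\<lambda>j.
     map_pmf (\<lambda>k'. (w @ [(k, i, j)], k')) (trans \<Gamma> k i j))))"

definition mean_payoff :: "('k, 'i, 'j) game \<Rightarrow> 'k pmf \<Rightarrow> (('i, 'j) history \<Rightarrow> 'i pmf) \<Rightarrow>
    (('i, 'j) history \<Rightarrow> 'j pmf) \<Rightarrow> nat \<Rightarrow> real" where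
  "mean_payoff \<Gamma> b \<sigma> \<pi> N =
     measure_pmf.expectation (play \<Gamma> b \<sigma> \<pi> N)
       (\<lambda>(w, _). 1 / real N * (\<Sum>(k, i, j)\<leftarrow>w. reward \<Gamma> k i j))"

definition has_uniform_value :: "('k, 'i, 'j) game \<Rightarrow> ('k pmf \<Rightarrow> real) \<Rightarrow> bool" where
  "has_uniform_value \<Gamma> v \<longleftrightarrow>
     (\<forall>b\<in>distributions (states \<Gamma>). v b \<in> {0..1} \<and>
       (\<forall>\<epsilon>>0. \<exists>\<sigma>'\<in>strategies1 \<Gamma>. \<exists>\<pi>'\<in>strategies2 \<Gamma>. \<exists>n\<ge>1. \<forall>N\<ge>n.
          \<forall>\<sigma>\<in>strategies1 \<Gamma>. \<forall>\<pi>\<in>strategies2 \<Gamma>.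
            mean_payoff \<Gamma> b \<sigma>' \<pi> N \<ge> v b - \<epsilon> \<and> mean_payoff \<Gamma> b \<sigma> \<pi>' N \<le> v b + \<epsilon>))"


section \<open>Markov blind MDPs and ergodic games\<close>

text \<open>
  A matrix over a finite index set \<open>K\<close> is a function \<open>'k \<Rightarrow> 'k \<Rightarrow> real\<close>, of which only the
  entries with both indices in \<open>K\<close> are meaningful.
\<close>

definition transition_matrix :: "('k, 'i, 'j) game \<Rightarrow> 'i \<times> 'j \<Rightarrow> 'k \<Rightarrow> 'k \<Rightarrow> real" where
  "transition_matrix \<Gamma> = (\<lambda>(i, j) k k'. pmf (trans \<Gamma> k i j) k')"

definition markov_matrix :: "'k set \<Rightarrow> ('k \<Rightarrow> 'k \<Rightarrow> real) \<Rightarrow> bool" where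
  "markov_matrix K P \<longleftrightarrow> (\<exists>k'\<in>K. \<forall>k\<in>K. P k k' > 0)"

definition blind_MDP :: "('k, 'i, 'j) game \<Rightarrow> bool" where
  "blind_MDP \<Gamma> \<longleftrightarrow> blind_stochastic_game \<Gamma> \<and> is_singleton (acts2 \<Gamma>)"

definition markov_blind_MDP :: "('k, 'i, 'j) game \<Rightarrow> bool" where
  "markov_blind_MDP \<Gamma> \<longleftrightarrow> blind_MDP \<Gamma> \<and>
     (\<forall>a\<in>acts1 \<Gamma> \<times> acts2 \<Gamma>. markov_matrix (states \<Gamma>) (transition_matrix \<Gamma> a))"

definition tau1 :: "'k set \<Rightarrow> ('k \<Rightarrow> 'k \<Rightarrow> real) \<Rightarrow> real" where
  "tau1 K P = 1 / 2 * Max ((\<lambda>(k, l). \<Sum>k'\<in>K. \<bar>P k k' - P l k'\<bar>) ` (K \<times> K))"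

primrec transition_product :: "('k, 'i, 'j) game \<Rightarrow> ('i \<times> 'j) list \<Rightarrow> 'k \<Rightarrow> 'k \<Rightarrow> real" where
  "transition_product \<Gamma> [] = (\<lambda>k k'. if k = k' then 1 else 0)"
| "transition_product \<Gamma> (a # as) =
     (\<lambda>k k'. \<Sum>l\<in>states \<Gamma>. transition_matrix \<Gamma> a k l * transition_product \<Gamma> as l k')"

definition ergodic_game :: "('k, 'i, 'j) game \<Rightarrow> bool" where
  "ergodic_game \<Gamma> \<longleftrightarrow> blind_stochastic_game \<Gamma> \<and>
     (\<forall>\<epsilon>>0. \<exists>n\<^sub>0. \<forall>n\<ge>n\<^sub>0. \<forall>as\<in>lists (acts1 \<Gamma> \<times> acts2 \<Gamma>). length as = n \<longrightarrow>
        tau1 (states \<Gamma>) (transition_product \<Gamma> as) \<le> \<epsilon>)"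


section \<open>Algorithms: partial recursive functions\<close>

datatype recf =
    Zero
  | Succ
  | Proj nat
  | Comp recf "recf list"
  | Prec recf recf
  | Mu recf

text \<open>
  \<open>computes f xs y\<close>: the algorithm \<open>f\<close> halts on the arguments \<open>xs\<close> with result \<open>y\<close>. There is
  at most one such \<open>y\<close>, and none if \<open>f\<close> diverges on \<open>xs\<close>. The step function of \<open>Prec\<close>
  receives the counter, the previous value and then the parameters; \<open>Mu\<close> searches over an
  additional first argument.
\<close>

inductive computes :: "recf \<Rightarrow> nat list \<Rightarrow> nat \<Rightarrow> bool" where
  Zero: "computes Zero xs 0"
| Succ: "computes Succ (x # xs) (Suc x)"
| Proj: "i < length xs \<Longrightarrow> computes (Proj i) xs (xs ! i)"
| Comp: "list_all2 (\<lambda>g y. computes g xs y) gs ys \<Longrightarrow> computes f ys z \<Longrightarrow>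
    computes (Comp f gs) xs z"
| Prec_0: "computes f xs y \<Longrightarrow> computes (Prec f g) (0 # xs) y"
| Prec_Suc: "computes (Prec f g) (n # xs) y \<Longrightarrow> computes g (n # y # xs) z \<Longrightarrow>
    computes (Prec f g) (Suc n # xs) z"
| Mu: "computes f (n # xs) 0 \<Longrightarrow> (\<And>m. m < n \<Longrightarrow> \<exists>y. computes f (m # xs) (Suc y)) \<Longrightarrow>
    computes (Mu f) xs n"


section \<open>The decision problem\<close>

text \<open>
  A nonnegative rational is given by any of its representations as a fraction. Real numbers
  that are not of this form have no code.
\<close>

definition frac_code :: "real \<Rightarrow> nat \<Rightarrow> bool" where
  "frac_code r c \<longleftrightarrow> (\<exists>p q. q > 0 \<and> r = real p / real q \<and> c = prod_encode (p, q))"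

text \<open>
  \<open>input_code \<Gamma> b x c\<close>: the number \<open>c\<close> encodes the input \<open>(\<Gamma>, b, x)\<close>. States and actions are
  taken to be initial segments of the natural numbers; \<open>c\<close> encodes their sizes, the tables of
  transition probabilities and rewards, the initial belief and the threshold.
\<close>

definition input_code :: "(nat, nat, nat) game \<Rightarrow> nat pmf \<Rightarrow> real \<Rightarrow> nat \<Rightarrow> bool" where
  "input_code \<Gamma> b x c \<longleftrightarrow> (\<exists>nk ni nj ps gs bs xc.
     states \<Gamma> = {..<nk} \<and> acts1 \<Gamma> = {..<ni} \<and> acts2 \<Gamma> = {..<nj} \<and>
     list_all2 frac_code
       [pmf (trans \<Gamma> k i j) k'. k \<leftarrow> [0..<nk], i \<leftarrow> [0..<ni], j \<leftarrow> [0..<nj], k' \<leftarrow> [0..<nk]] ps \<and>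
     list_all2 frac_code
       [reward \<Gamma> k i j. k \<leftarrow> [0..<nk], i \<leftarrow> [0..<ni], j \<leftarrow> [0..<nj]] gs \<and>
     list_all2 frac_code [pmf b k. k \<leftarrow> [0..<nk]] bs \<and>
     frac_code x xc \<and>
     c = list_encode [nk, ni, nj, list_encode ps, list_encode gs, list_encode bs, xc])"

text \<open>
  \<open>f\<close> is only required to halt, with answer 1 for \<open>v b > x\<close> and 0 for \<open>v b \<le> x\<close>, on codes of
  inputs whose game belongs to the class \<open>C\<close> and has a uniform value. The value function is
  determined on beliefs by the game.
\<close>

definition decides_uniform_value :: "((nat, nat, nat) game \<Rightarrow> bool) \<Rightarrow> recf \<Rightarrow> bool" where
  "decides_uniform_value C f \<longleftrightarrow>
     (\<forall>\<Gamma> v b x c. C \<Gamma> \<longrightarrow> has_uniform_value \<Gamma> v \<longrightarrow> b \<in> distributions (states \<Gamma>) \<longrightarrow>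
        x \<in> {0..1} \<longrightarrow> input_code \<Gamma> b x c \<longrightarrow>
        (v b > x \<longrightarrow> computes f [c] 1) \<and> (v b \<le> x \<longrightarrow> computes f [c] 0))"

definition uniform_value_decidable :: "((nat, nat, nat) game \<Rightarrow> bool) \<Rightarrow> bool" where
  "uniform_value_decidable C \<longleftrightarrow> (\<exists>f. decides_uniform_value C f)"

end

theory Submission
  imports Defs
begin

text \<open>
  Let \<open>f\<close> be an algorithm that decides ``\<open>v(b) > x\<close>'' on a class containing all Markov blind MDPs.
  The idea is to build a Markov blind MDP \<open>\<Gamma>\<close> whose value exceeds \<open>1/2\<close> exactly if \<open>f\<close> answers
  ``no'' on a code of \<open>\<Gamma>\<close> itself.

  Computations as words. A function from words over a finite alphabet to the integers is
  recognizable if it lies in a finitely generated module of such functions that is closed under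
  prepending a letter; equivalently, an integer weighted automaton computes it. Recognizable
  functions are closed under sums, products, and accumulation along the word. Call a relation
  on natural numbers listable if it consists of the tuples \<open>(g\<^sub>1 w, \<dots>, g\<^sub>r w)\<close> with \<open>E w = 0\<close>, for
  recognizable \<open>g\<^sub>i \<ge> 0\<close> and \<open>E \<ge> 0\<close>: the word is a guess, and \<open>E\<close> adds up the squared errors that a
  verifier finds in it. Listable relations contain the polynomial equations and are closed under
  conjunction, existential quantification, and bounded iteration. Hence the graph of every partial
  recursive function is listable (\<open>listable_computes\<close>); no machine model has to be simulated.
  For a listable set \<open>P\<close> of numbers, \<open>n \<in> P\<close> holds iff \<open>1 - E w - (g w - n)\<^sup>2 > 0\<close> for some word \<open>w\<close>,
  and this quantity is \<open>F\<^sub>n w = G\<^sub>0 w + n G\<^sub>1 w - n\<^sup>2 G\<^sub>2 w\<close> with recognizable \<open>G\<^sub>i\<close> independent of \<open>n\<close>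
  (\<open>ex_linear_family\<close>).

  Words as plays. The blind MDP has the letters and a separator \<open>#\<close> as actions. Its states are a
  reset state, a sink, and a positive and a negative copy of every generator \<open>G\<^sub>i\<close>. Whatever the
  state and the action, the next state is the reset state with probability \<open>1/2\<close>, so all
  transition matrices are Markov. The separator sends the reset state to copies of \<open>G\<^sub>0, G\<^sub>1, G\<^sub>2\<close> in
  proportions \<open>1 : n : n\<^sup>2\<close>, with a negative copy for \<open>G\<^sub>2\<close>; letters move between copies as
  prescribed by the weighted automaton, scaled down; at the next separator, a copy collects a
  reward that differs from \<open>1/2\<close> by a multiple of its final weight, and it moves to the sink. Before
  each stage but the first, the state is the reset state with probability exactly \<open>1/2\<close>. Hence a
  block \<open># w #\<close> that starts after the first stage shifts the total expected reward by a positive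
  multiple of \<open>F\<^sub>n w\<close> that depends only on \<open>w\<close> and \<open>n\<close>. Therefore the game has a uniform value, namely
  \<open>1/2\<close> plus a quarter of the best rate per stage that repeating a block, or playing no separator,
  can achieve (\<open>has_uniform_value_family\<close>), and it exceeds \<open>1/2\<close> iff \<open>F\<^sub>n w > 0\<close> for some \<open>w\<close>
  (\<open>game_value_gt_iff\<close>).

  Diagonalization. The number \<open>n\<close> occurs only in one row of the transition table. So a code of the
  game is built by pairing and arithmetic from \<open>n\<close> and the codes of the other parts, and the set \<open>P\<close> of
  those \<open>n\<close> that encode such parts for which \<open>f\<close> answers ``no'' on the game completed with the
  parameter \<open>n\<close> is listable (\<open>listable_diagonal\<close>). Choosing for \<open>n\<close> the code of the parts of the
  game that represents \<open>P\<close> gives the contradiction (\<open>undecidable_class\<close>). The second claim follows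
  because Markov blind MDPs are ergodic (\<open>markov_blind_MDP_imp_ergodic\<close>).
\<close>

section \<open>Recognizable integer series\<close>

text \<open>
  The integer linear combinations of the functions in \<open>S\<close>.
\<close>

inductive_set lspan :: "('a \<Rightarrow> int) set \<Rightarrow> ('a \<Rightarrow> int) set" for S where
  zero: "(\<lambda>_. 0) \<in> lspan S"
| step: "f \<in> lspan S \<Longrightarrow> s \<in> S \<Longrightarrow> (\<lambda>x. f x + c * s x) \<in> lspan S"

lemma lspan_base: "s \<in> S \<Longrightarrow> s \<in> lspan S"
  using lspan.step[OF lspan.zero, of s S 1] by simp

lemma lspan_add:
  assumes "f \<in> lspan S" "g \<in> lspan S"
  shows "(\<lambda>x. f x + g x) \<in> lspan S"
  using assms(2)
proof induction
  case zero
  then show ?case using assms(1) by simp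
next
  case (step g s c)
  then show ?case using lspan.step[OF step.IH step.hyps(2), of c] by (simp add: add.assoc)
qed

lemma lspan_scale:
  assumes "f \<in> lspan S"
  shows "(\<lambda>x. c * f x) \<in> lspan S"
  using assms
proof induction
  case zero
  then show ?case using lspan.zero by simp
next
  case (step g s d)
  then show ?case using lspan.step[OF step.IH step.hyps(2), of "c * d"]
    by (simp add: algebra_simps)
qed

lemma lspan_subst:
  assumes "f \<in> lspan S" and "\<And>s. s \<in> S \<Longrightarrow> (\<lambda>x. s (h x)) \<in> lspan T"
  shows "(\<lambda>x. f (h x)) \<in> lspan T"
  using assms(1)
proof induction
  case zero
  then show ?case by (rule lspan.zero)
next
  case (step g s c)
  then show ?case using assms(2) by (intro lspan_add lspan_scale)
qed

lemma lspan_mono: "f \<in> lspan S \<Longrightarrow> S \<subseteq> T \<Longrightarrow> f \<in> lspan T"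
  using lspan_subst[of f S "\<lambda>x. x" T] by (auto intro: lspan_base)

lemma lspan_mult:
  assumes "f \<in> lspan S" "g \<in> lspan T"
  shows "(\<lambda>x. f x * g x) \<in> lspan {\<lambda>x. s x * t x | s t. s \<in> S \<and> t \<in> T}" (is "_ \<in> lspan ?U")
  using assms(1)
proof induction
  case zero
  then show ?case using lspan.zero by simp
next
  case (step f s c)
  have "(\<lambda>x. s x * g x) \<in> lspan ?U"
    using assms(2)
  proof induction
    case zero
    then show ?case using lspan.zero by simp
  next
    case (step g t d)
    have "(\<lambda>x. s x * t x) \<in> ?U" using \<open>s \<in> S\<close> step.hyps by blast
    from lspan.step[OF step.IH this, of d] show ?case by (simp add: algebra_simps)
  qed
  then have "(\<lambda>x. f x * g x + c * (s x * g x)) \<in> lspan ?U"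
    by (intro lspan_add lspan_scale step.IH)
  then show ?case by (simp add: algebra_simps)
qed

lemma lspan_finite:
  assumes "f \<in> lspan S" "finite S"
  shows "\<exists>c. f = (\<lambda>x. \<Sum>s\<in>S. c s * s x)"
  using assms(1)
proof induction
  case zero
  show ?case by (rule exI[of _ "\<lambda>_. 0"]) simp
next
  case (step f s c)
  then obtain d where d: "f = (\<lambda>x. \<Sum>s\<in>S. d s * s x)" by blast
  have "(\<Sum>t\<in>S. (d t + (if t = s then c else 0)) * t x) = f x + c * s x" for x
    using assms(2) step.hyps d
    by (simp add: distrib_right sum.distrib if_distrib[of "\<lambda>z. z * _"] cong: if_cong)
  then show ?case by (intro exI[of _ "\<lambda>t. d t + (if t = s then c else 0)"]) auto
qed

text \<open>
  A finite set of series on words whose span is closed under prepending a letter. Letters are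
  natural numbers; the alphabet is \<open>{..<A}\<close>, and all further letters are skipped. Skipping instead
  of excluding them lets series over different alphabets be combined freely.
\<close>

definition stable :: "nat \<Rightarrow> (nat list \<Rightarrow> int) set \<Rightarrow> bool" where
  "stable A S \<longleftrightarrow> finite S \<and>
     (\<forall>s\<in>S. \<forall>l. (\<lambda>w. s (l # w)) \<in> lspan S \<and> (A \<le> l \<longrightarrow> (\<forall>w. s (l # w) = s w)))"

text \<open>
  Recognizable series: members of a finitely generated shift-closed module. The coefficients of
  the shifted generators are the transition matrices of a weighted automaton.
\<close>

definition recognizable :: "(nat list \<Rightarrow> int) \<Rightarrow> bool" where
  "recognizable F \<longleftrightarrow> (\<exists>A S. stable A S \<and> F \<in> lspan S)"

lemma stable_shift:
  assumes "stable A S" "f \<in> lspan S"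
  shows "(\<lambda>w. f (l # w)) \<in> lspan S"
  using lspan_subst[OF assms(2)] assms(1) unfolding stable_def by blast

lemma stable_ignore:
  assumes "stable A S" "f \<in> lspan S" "A \<le> l"
  shows "f (l # w) = f w"
  using assms(2)
proof induction
  case (step f s c)
  then show ?case using assms(1,3) unfolding stable_def by auto
qed simp

lemma stable_UN:
  assumes "finite I" "\<And>i. i \<in> I \<Longrightarrow> stable (A i) (S i)"
  shows "stable (Max (insert 0 (A ` I))) (\<Union>i\<in>I. S i)"
  unfolding stable_def
proof (intro conjI ballI allI impI)
  show "finite (\<Union>i\<in>I. S i)" using assms unfolding stable_def by blast
next
  fix s l assume "s \<in> (\<Union>i\<in>I. S i)"
  then obtain i where i: "i \<in> I" "s \<in> S i" by blast
  then have "(\<lambda>w. s (l # w)) \<in> lspan (S i)" using assms(2) unfolding stable_def by blast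
  then show "(\<lambda>w. s (l # w)) \<in> lspan (\<Union>i\<in>I. S i)" by (rule lspan_mono) (use i in blast)
  fix w assume l: "Max (insert 0 (A ` I)) \<le> l"
  have "A i \<le> Max (insert 0 (A ` I))" using i assms(1) by (intro Max_ge) auto
  then show "s (l # w) = s w" using i l assms(2)[of i] unfolding stable_def by auto
qed

lemma stable_Un:
  assumes "stable A S" "stable B T"
  shows "stable (max A B) (S \<union> T)"
proof -
  have "stable (Max (insert 0 ((\<lambda>b. if b then A else B) ` UNIV)))
          (\<Union>b\<in>UNIV. if b then S else T)"
    by (rule stable_UN) (use assms in auto)
  then show ?thesis by (simp add: UNIV_bool max.commute Un_commute)
qed

lemma recognizable_const: "recognizable (\<lambda>_. c)"
proof -
  have "stable 0 {\<lambda>_. 1}" unfolding stable_def by (auto intro: lspan_base)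
  moreover have "(\<lambda>_. c) \<in> lspan {\<lambda>_. 1}"
    using lspan_scale[OF lspan_base[of "\<lambda>_. 1" "{\<lambda>_. 1}"], of c] by simp
  ultimately show ?thesis unfolding recognizable_def by blast
qed

lemma recognizable_common:
  assumes "recognizable F" "recognizable G"
  obtains A S where "stable A S" "F \<in> lspan S" "G \<in> lspan S"
proof -
  obtain A S B T where 1: "stable A S" "F \<in> lspan S" "stable B T" "G \<in> lspan T"
    using assms unfolding recognizable_def by blast
  show ?thesis
    by (rule that[OF stable_Un[OF 1(1,3)]]) (use 1 lspan_mono in blast)+
qed

lemma recognizable_add:
  assumes "recognizable F" "recognizable G"
  shows "recognizable (\<lambda>w. F w + G w)"
  using recognizable_common[OF assms] lspan_add unfolding recognizable_def by metis

lemma recognizable_scale: "recognizable F \<Longrightarrow> recognizable (\<lambda>w. c * F w)"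
  unfolding recognizable_def using lspan_scale by blast

lemma recognizable_diff:
  assumes "recognizable F" "recognizable G"
  shows "recognizable (\<lambda>w. F w - G w)"
  using recognizable_add[OF assms(1) recognizable_scale[OF assms(2), of "-1"]] by simp

lemma recognizable_mult:
  assumes "recognizable F" "recognizable G"
  shows "recognizable (\<lambda>w. F w * G w)"
proof -
  obtain A S where 1: "stable A S" "F \<in> lspan S" "G \<in> lspan S"
    using recognizable_common[OF assms] by blast
  let ?U = "{\<lambda>x. s x * t x | s t. s \<in> S \<and> t \<in> S}"
  have "?U = (\<lambda>(s, t) x. s x * t x) ` (S \<times> S)" by auto
  then have "finite ?U" using 1(1) unfolding stable_def by simp
  moreover have "(\<lambda>w. s (l # w) * t (l # w)) \<in> lspan ?U" if "s \<in> S" "t \<in> S" for s t l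
    using lspan_mult[of "\<lambda>w. s (l # w)" S "\<lambda>w. t (l # w)" S] 1(1) that unfolding stable_def by blast
  moreover have "s (l # w) * t (l # w) = s w * t w" if "s \<in> S" "t \<in> S" "A \<le> l" for s t l w
  proof -
    have "s (l # w) = s w" "t (l # w) = t w" using that 1(1) unfolding stable_def by blast+
    then show ?thesis by simp
  qed
  ultimately have "stable A ?U" unfolding stable_def by auto
  then show ?thesis using lspan_mult[OF 1(2,3)] unfolding recognizable_def by blast
qed

lemma recognizable_power2: "recognizable F \<Longrightarrow> recognizable (\<lambda>w. (F w)\<^sup>2)"
  unfolding power2_eq_square by (rule recognizable_mult)

lemma recognizable_sum:
  assumes "finite I" "\<And>i. i \<in> I \<Longrightarrow> recognizable (F i)"
  shows "recognizable (\<lambda>w. \<Sum>i\<in>I. F i w)"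
  using assms by (induction I) (auto intro: recognizable_const recognizable_add)

text \<open>
  A series is recognizable if it satisfies an affine recursion along the word whose inhomogeneous
  part is recognizable. Counters, accumulators and latches are of this form.
\<close>

lemma recognizable_step:
  assumes step: "\<And>l w. F (l # w) = c l * F w + H l w"
    and H: "\<And>l. recognizable (H l)"
    and ignore: "\<And>l w. A \<le> l \<Longrightarrow> F (l # w) = F w"
  shows "recognizable F"
proof -
  obtain B S where S: "\<And>l. stable (B l) (S l)" "\<And>l. H l \<in> lspan (S l)"
    using H unfolding recognizable_def by metis
  define C where "C = Max (insert 0 (B ` {..<A}))"
  define T where "T = (\<Union>l\<in>{..<A}. S l)"
  have T: "stable C T" unfolding T_def C_def by (rule stable_UN) (use S in auto)
  have F: "F \<in> lspan (insert F T)" by (simp add: lspan_base)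
  have "(\<lambda>w. F (l # w)) \<in> lspan (insert F T)" for l
  proof (cases "l < A")
    case True
    then have "H l \<in> lspan (insert F T)"
      by (intro lspan_mono[OF S(2)]) (auto simp: T_def)
    then show ?thesis unfolding step by (intro lspan_add lspan_scale F)
  next
    case False
    then show ?thesis using F ignore by simp
  qed
  then have "stable (max A C) (insert F T)"
    using T ignore unfolding stable_def by (auto intro: lspan_mono[of _ T])
  then show ?thesis using F unfolding recognizable_def by blast
qed

text \<open>
  Rewrites every letter to a word and stops at the first letter with \<open>h l = None\<close>. Words are
  processed from the right, so the stopping letter forgets everything read before it.
\<close>

primrec translate :: "(nat \<Rightarrow> nat list option) \<Rightarrow> nat list \<Rightarrow> nat list" where
  "translate h [] = []"
| "translate h (l # w) = (case h l of None \<Rightarrow> [] | Some u \<Rightarrow> u @ translate h w)"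

lemma recognizable_translate:
  assumes F: "recognizable F"
    and h: "\<And>A. \<exists>B. \<forall>l\<ge>B. \<exists>u. h l = Some u \<and> (\<forall>x\<in>set u. A \<le> x)"
  shows "recognizable (\<lambda>w. F (translate h w))"
proof -
  obtain A S where S: "stable A S" "F \<in> lspan S"
    using F unfolding recognizable_def by blast
  obtain B where B: "\<And>l. l \<ge> B \<Longrightarrow> \<exists>u. h l = Some u \<and> (\<forall>x\<in>set u. A \<le> x)"
    using h by blast
  define T where "T = insert (\<lambda>_. 1) ((\<lambda>s w. s (translate h w)) ` S)"
  have one: "(\<lambda>_. c) \<in> lspan T" for c
    using lspan_scale[OF lspan_base[of "\<lambda>_. 1" T], of c] by (simp add: T_def)
  have comp: "(\<lambda>w. f (translate h w)) \<in> lspan T" if "f \<in> lspan S" for f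
    by (rule lspan_subst[OF that]) (auto simp: T_def intro: lspan_base)
  have app: "(\<lambda>w. f (u @ w)) \<in> lspan S" if "f \<in> lspan S" for f u
    using that by (induction u arbitrary: f) (auto dest: stable_shift[OF S(1)])
  have ign: "f (u @ w) = f w" if "f \<in> lspan S" "\<forall>x\<in>set u. A \<le> x" for f u w
    using that(2) by (induction u) (auto simp: stable_ignore[OF S(1) that(1)])
  have 1: "(\<lambda>w. s (translate h (l # w))) \<in> lspan T" if "s \<in> S" for s l
  proof (cases "h l")
    case None
    then show ?thesis using one by simp
  next
    case (Some u)
    then show ?thesis using comp[OF app[OF lspan_base[OF that], of u]] by simp
  qed
  have 2: "s (translate h (l # w)) = s (translate h w)" if "s \<in> S" "B \<le> l" for s l w
    using B[OF that(2)] ign[OF lspan_base[OF that(1)]] by fastforce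
  have "stable B T"
    unfolding stable_def
  proof (intro conjI ballI allI impI)
    show "finite T" using S(1) unfolding T_def stable_def by simp
  next
    fix s l assume "s \<in> T"
    then consider "s = (\<lambda>_. 1)" | s' where "s' \<in> S" "s = (\<lambda>w. s' (translate h w))"
      unfolding T_def by blast
    then show "(\<lambda>w. s (l # w)) \<in> lspan T" by cases (use one 1 in auto)
  next
    fix s l w assume "s \<in> T" "B \<le> l"
    then show "s (l # w) = s w" using 2 unfolding T_def by auto
  qed
  then show ?thesis using comp[OF S(2)] unfolding recognizable_def by blast
qed

section \<open>Listable relations\<close>

text \<open>
  Relations are predicates on environments \<open>e\<close>, which assign a value to every variable; \<open>V\<close>
  contains the variables on which \<open>P\<close> depends. A word \<open>w\<close> with \<open>E w = 0\<close> is a valid guess, and it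
  lists the environment with the values \<open>g i w\<close>.
\<close>

definition listable :: "nat set \<Rightarrow> ((nat \<Rightarrow> nat) \<Rightarrow> bool) \<Rightarrow> bool" where
  "listable V P \<longleftrightarrow> finite V \<and> (\<exists>E g. recognizable E \<and> (\<forall>w. 0 \<le> E w) \<and>
     (\<forall>i\<in>V. recognizable (g i) \<and> (\<forall>w. 0 \<le> g i w)) \<and>
     (\<forall>e. P e \<longleftrightarrow> (\<exists>w. E w = 0 \<and> (\<forall>i\<in>V. g i w = int (e i)))))"

lemma listableI:
  assumes "finite V" "recognizable E" "\<And>w. 0 \<le> E w"
    and "\<And>i. i \<in> V \<Longrightarrow> recognizable (g i)" "\<And>i w. i \<in> V \<Longrightarrow> 0 \<le> g i w"
    and "\<And>e. P e \<longleftrightarrow> (\<exists>w. E w = 0 \<and> (\<forall>i\<in>V. g i w = int (e i)))"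
  shows "listable V P"
  unfolding listable_def
  by (intro conjI exI[of _ E] exI[of _ g] ballI allI) (use assms in blast)+

lemma listableE:
  assumes "listable V P"
  obtains E g where "finite V" "recognizable E" "\<forall>w. 0 \<le> E w"
    "\<forall>i\<in>V. recognizable (g i)" "\<forall>i\<in>V. \<forall>w. 0 \<le> g i w"
    "\<forall>e. P e \<longleftrightarrow> (\<exists>w. E w = 0 \<and> (\<forall>i\<in>V. g i w = int (e i)))"
  using assms unfolding listable_def ball_conj_distrib by (elim conjE exE)

lemma listable_cong:
  assumes "listable V P" "\<And>e. Q e \<longleftrightarrow> P e"
  shows "listable V Q"
proof -
  have "Q = P" by (rule ext) (rule assms(2))
  then show ?thesis using assms(1) by simp
qed

lemma recognizable_count: "recognizable (\<lambda>w. int (count_list w a))"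
  by (rule recognizable_step[where c = "\<lambda>_. 1" and H = "\<lambda>l _. if l = a then 1 else 0" and A = "Suc a"])
    (auto intro: recognizable_const)

lemma ex_count_list:
  assumes "finite V"
  shows "\<exists>w. \<forall>i. count_list w i = (if i \<in> V then e i else 0)"
  using assms
proof induction
  case empty
  show ?case by (rule exI[of _ "[]"]) simp
next
  case (insert x V)
  then obtain w where w: "\<forall>i. count_list w i = (if i \<in> V then e i else 0)" by blast
  have r: "count_list (replicate m x) i = (if i = x then m else 0)" for i m
    by (induction m) auto
  show ?case by (rule exI[of _ "replicate (e x) x @ w"]) (use w insert.hyps r in auto)
qed

text \<open>
  Polynomials with integer coefficients in the variables \<open>V\<close>.
\<close>

inductive polynomial_fun :: "nat set \<Rightarrow> ((nat \<Rightarrow> nat) \<Rightarrow> int) \<Rightarrow> bool" for V where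
  const: "polynomial_fun V (\<lambda>_. c)"
| var: "i \<in> V \<Longrightarrow> polynomial_fun V (\<lambda>e. int (e i))"
| add: "polynomial_fun V p \<Longrightarrow> polynomial_fun V q \<Longrightarrow> polynomial_fun V (\<lambda>e. p e + q e)"
| mult: "polynomial_fun V p \<Longrightarrow> polynomial_fun V q \<Longrightarrow> polynomial_fun V (\<lambda>e. p e * q e)"

lemma polynomial_fun_diff:
  assumes "polynomial_fun V p" "polynomial_fun V q"
  shows "polynomial_fun V (\<lambda>e. p e - q e)"
  using polynomial_fun.add[OF assms(1) polynomial_fun.mult[OF polynomial_fun.const[of V "-1"] assms(2)]]
  by simp

lemma listable_polynomial:
  assumes "finite V" "polynomial_fun V p"
  shows "listable V (\<lambda>e. p e = 0)"
proof (rule listableI)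
  have "recognizable (\<lambda>w. p (count_list w))"
    using assms(2)
    by induction (auto intro: recognizable_const recognizable_count recognizable_add recognizable_mult)
  then show "recognizable (\<lambda>w. (p (count_list w))\<^sup>2)" by (rule recognizable_power2)
  have dep: "p e = p e'" if "\<forall>i\<in>V. e i = e' i" for e e'
    using assms(2) that by induction auto
  fix e
  show "p e = 0 \<longleftrightarrow> (\<exists>w. (p (count_list w))\<^sup>2 = 0 \<and> (\<forall>i\<in>V. int (count_list w i) = int (e i)))"
  proof
    assume "p e = 0"
    moreover obtain w where "\<forall>i. count_list w i = (if i \<in> V then e i else 0)"
      using ex_count_list[OF assms(1)] by blast
    ultimately show "\<exists>w. (p (count_list w))\<^sup>2 = 0 \<and> (\<forall>i\<in>V. int (count_list w i) = int (e i))"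
      using dep[of e "count_list w"] by (intro exI[of _ w]) auto
  next
    assume "\<exists>w. (p (count_list w))\<^sup>2 = 0 \<and> (\<forall>i\<in>V. int (count_list w i) = int (e i))"
    then obtain w where "p (count_list w) = 0" "\<forall>i\<in>V. count_list w i = e i" by auto
    then show "p e = 0" using dep[of e "count_list w"] by simp
  qed
qed (use assms recognizable_count in auto)

lemma listable_eq:
  assumes "finite V" "polynomial_fun V p" "polynomial_fun V q"
  shows "listable V (\<lambda>e. p e = q e)"
  by (rule listable_cong[OF listable_polynomial[OF assms(1) polynomial_fun_diff[OF assms(2,3)]]]) simp

lemma listable_True: "finite V \<Longrightarrow> listable V (\<lambda>_. True)"
  using listable_polynomial[OF _ polynomial_fun.const[of V 0]] by simp

lemma listable_False: "finite V \<Longrightarrow> listable V (\<lambda>_. False)"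
  using listable_polynomial[OF _ polynomial_fun.const[of V 1]] by simp

lemma listable_conj:
  assumes "listable V P" "listable W Q"
  shows "listable (V \<union> W) (\<lambda>e. P e \<and> Q e)"
proof -
  obtain E g where 1: "finite V" "recognizable E" "\<forall>w. 0 \<le> E w"
      "\<forall>i\<in>V. recognizable (g i)" "\<forall>i\<in>V. \<forall>w. 0 \<le> g i w"
      "\<forall>e. P e \<longleftrightarrow> (\<exists>w. E w = 0 \<and> (\<forall>i\<in>V. g i w = int (e i)))"
    by (rule listableE[OF assms(1)])
  note 1 = 1[rule_format]
  obtain F k where 2: "finite W" "recognizable F" "\<forall>w. 0 \<le> F w"
      "\<forall>i\<in>W. recognizable (k i)" "\<forall>i\<in>W. \<forall>w. 0 \<le> k i w"
      "\<forall>e. Q e \<longleftrightarrow> (\<exists>w. F w = 0 \<and> (\<forall>i\<in>W. k i w = int (e i)))"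
    by (rule listableE[OF assms(2)])
  note 2 = 2[rule_format]
  \<comment> \<open>The two words are shuffled: even letters belong to the first guess, odd letters to the second.\<close>
  define t where "t = translate (\<lambda>l. Some (if even l then [l div 2] else []))"
  define u where "u = translate (\<lambda>l. Some (if odd l then [l div 2] else []))"
  have t: "recognizable (\<lambda>w. G (t w))" if "recognizable G" for G
    unfolding t_def
  proof (rule recognizable_translate[OF that])
    show "\<exists>B. \<forall>l\<ge>B. \<exists>u. Some (if even l then [l div 2] else []) = Some u \<and> (\<forall>x\<in>set u. A \<le> x)" for A :: nat
      by (rule exI[of _ "2 * A"]) auto
  qed
  have u: "recognizable (\<lambda>w. G (u w))" if "recognizable G" for G
    unfolding u_def
  proof (rule recognizable_translate[OF that])
    show "\<exists>B. \<forall>l\<ge>B. \<exists>u. Some (if odd l then [l div 2] else []) = Some u \<and> (\<forall>x\<in>set u. A \<le> x)" for A :: nat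
      by (rule exI[of _ "2 * A"]) auto
  qed
  have tu: "t (map (\<lambda>l. 2 * l) a @ map (\<lambda>l. 2 * l + 1) b) = a"
           "u (map (\<lambda>l. 2 * l) a @ map (\<lambda>l. 2 * l + 1) b) = b" for a b
    unfolding t_def u_def by (induction a; induction b; simp)+
  define H where "H w = E (t w) + F (u w) + (\<Sum>i\<in>V \<inter> W. (g i (t w) - k i (u w))\<^sup>2)" for w
  have H0: "H w = 0 \<longleftrightarrow> E (t w) = 0 \<and> F (u w) = 0 \<and> (\<forall>i\<in>V \<inter> W. g i (t w) = k i (u w))" for w
  proof -
    have "(\<Sum>i\<in>V \<inter> W. (g i (t w) - k i (u w))\<^sup>2) \<ge> 0" by (simp add: sum_nonneg)
    moreover have "(\<Sum>i\<in>V \<inter> W. (g i (t w) - k i (u w))\<^sup>2) = 0 \<longleftrightarrow>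
        (\<forall>i\<in>V \<inter> W. g i (t w) = k i (u w))"
      using 1(1) by (subst sum_nonneg_eq_0_iff) auto
    ultimately show ?thesis unfolding H_def using 1(3)[of "t w"] 2(3)[of "u w"] by linarith
  qed
  show ?thesis
  proof (rule listableI[where E = H and g = "\<lambda>i w. if i \<in> V then g i (t w) else k i (u w)"])
    show "recognizable H" unfolding H_def
      by (intro recognizable_add recognizable_sum recognizable_power2 recognizable_diff t u)
        (use 1 2 in auto)
    show "0 \<le> H w" for w unfolding H_def using 1(3) 2(3) by (intro add_nonneg_nonneg sum_nonneg) auto
    show "recognizable (\<lambda>w. if i \<in> V then g i (t w) else k i (u w))" if "i \<in> V \<union> W" for i
      using that t[OF 1(4)] u[OF 2(4)] by (cases "i \<in> V") auto
    show "P e \<and> Q e \<longleftrightarrow>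
       (\<exists>w. H w = 0 \<and> (\<forall>i\<in>V \<union> W. (if i \<in> V then g i (t w) else k i (u w)) = int (e i)))" for e
    proof
      assume "P e \<and> Q e"
      then obtain a b where "E a = 0" "\<forall>i\<in>V. g i a = int (e i)" "F b = 0" "\<forall>i\<in>W. k i b = int (e i)"
        using 1(6) 2(6) by metis
      then show "\<exists>w. H w = 0 \<and> (\<forall>i\<in>V \<union> W. (if i \<in> V then g i (t w) else k i (u w)) = int (e i))"
        unfolding H0
        by (intro exI[of _ "map (\<lambda>l. 2 * l) a @ map (\<lambda>l. 2 * l + 1) b"]) (simp only: tu, auto)
    next
      assume "\<exists>w. H w = 0 \<and> (\<forall>i\<in>V \<union> W. (if i \<in> V then g i (t w) else k i (u w)) = int (e i))"
      then obtain w where w: "H w = 0"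
        "\<And>i. i \<in> V \<union> W \<Longrightarrow> (if i \<in> V then g i (t w) else k i (u w)) = int (e i)" by blast
      have "\<forall>i\<in>V. g i (t w) = int (e i)" using w(2) by (metis UnI1)
      moreover have "\<forall>i\<in>W. k i (u w) = int (e i)" using w(2) w(1)[unfolded H0] by (metis IntI UnI2)
      ultimately show "P e \<and> Q e" using w(1)[unfolded H0] 1(6) 2(6) by blast
    qed
  qed (use 1 2 in auto)
qed

lemma listable_mono: "listable V P \<Longrightarrow> V \<subseteq> W \<Longrightarrow> finite W \<Longrightarrow> listable W P"
  using listable_conj[OF _ listable_True, of V P W] by (simp add: Un_absorb1)

lemma listable_ball:
  assumes "finite I" "\<And>i. i \<in> I \<Longrightarrow> listable V (P i)" "finite V"
  shows "listable V (\<lambda>e. \<forall>i\<in>I. P i e)"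
  using assms(1,2)
proof (induction I)
  case empty
  then show ?case using listable_True[OF assms(3)] by simp
next
  case (insert i I)
  then show ?case using listable_conj[of V "P i" V "\<lambda>e. \<forall>i\<in>I. P i e"] by simp
qed

lemma listable_ex:
  assumes "listable V P"
  shows "listable (V - {v}) (\<lambda>e. \<exists>t. P (e(v := t)))"
proof -
  obtain E g where 1: "finite V" "recognizable E" "\<forall>w. 0 \<le> E w"
      "\<forall>i\<in>V. recognizable (g i)" "\<forall>i\<in>V. \<forall>w. 0 \<le> g i w"
      "\<forall>e. P e \<longleftrightarrow> (\<exists>w. E w = 0 \<and> (\<forall>i\<in>V. g i w = int (e i)))"
    by (rule listableE[OF assms])
  note 1 = 1[rule_format]
  show ?thesis
  proof (rule listableI[where E = E and g = g])
    fix e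
    show "(\<exists>t. P (e(v := t))) \<longleftrightarrow> (\<exists>w. E w = 0 \<and> (\<forall>i\<in>V - {v}. g i w = int (e i)))"
    proof
      assume "\<exists>t. P (e(v := t))"
      then obtain t w where "E w = 0" "\<forall>i\<in>V. g i w = int ((e(v := t)) i)" using 1(6) by blast
      then show "\<exists>w. E w = 0 \<and> (\<forall>i\<in>V - {v}. g i w = int (e i))" by (intro exI[of _ w]) auto
    next
      assume "\<exists>w. E w = 0 \<and> (\<forall>i\<in>V - {v}. g i w = int (e i))"
      then obtain w where "E w = 0" "\<forall>i\<in>V - {v}. g i w = int (e i)" by blast
      then have "P (e(v := nat (g v w)))" using 1(5) 1(6) by (auto intro!: exI[of _ w])
      then show "\<exists>t. P (e(v := t))" by blast
    qed
  qed (use 1 in auto)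
qed

lemma listable_exs:
  assumes "listable V P"
  shows "listable (V - set vs) (\<lambda>e. \<exists>e'. (\<forall>x. x \<notin> set vs \<longrightarrow> e' x = e x) \<and> P e')"
proof (induction vs)
  case Nil
  have "(\<exists>e'. (\<forall>x. e' x = e x) \<and> P e') \<longleftrightarrow> P e" for e
    by (metis ext)
  then show ?case using assms by simp
next
  case (Cons v vs)
  have eq: "(\<exists>e'. (\<forall>x. x \<notin> set (v # vs) \<longrightarrow> e' x = e x) \<and> P e') \<longleftrightarrow>
    (\<exists>t e'. (\<forall>x. x \<notin> set vs \<longrightarrow> e' x = (e(v := t)) x) \<and> P e')" for e
  proof
    assume "\<exists>e'. (\<forall>x. x \<notin> set (v # vs) \<longrightarrow> e' x = e x) \<and> P e'"
    then obtain e' where "\<forall>x. x \<notin> set (v # vs) \<longrightarrow> e' x = e x" "P e'" by blast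
    then show "\<exists>t e'. (\<forall>x. x \<notin> set vs \<longrightarrow> e' x = (e(v := t)) x) \<and> P e'"
      by (intro exI[of _ "e' v"] exI[of _ e']) auto
  next
    assume "\<exists>t e'. (\<forall>x. x \<notin> set vs \<longrightarrow> e' x = (e(v := t)) x) \<and> P e'"
    then obtain t e' where "\<forall>x. x \<notin> set vs \<longrightarrow> e' x = (e(v := t)) x" "P e'" by blast
    then show "\<exists>e'. (\<forall>x. x \<notin> set (v # vs) \<longrightarrow> e' x = e x) \<and> P e'"
      by (intro exI[of _ e']) auto
  qed
  have "V - set (v # vs) = V - set vs - {v}" by auto
  then show ?case using listable_cong[OF listable_ex[OF Cons.IH, of v] eq] by simp
qed

section \<open>Bounded iteration and graphs of partial recursive functions\<close>

text \<open>
  The solution of an affine recursion along the word, with initial value \<open>0\<close>.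
\<close>

primrec series :: "(nat \<Rightarrow> int) \<Rightarrow> (nat \<Rightarrow> nat list \<Rightarrow> int) \<Rightarrow> nat list \<Rightarrow> int" where
  "series c H [] = 0"
| "series c H (l # w) = c l * series c H w + H l w"

lemma recognizable_series:
  assumes "\<And>l. recognizable (H l)" "\<And>l. A \<le> l \<Longrightarrow> c l = 1" "\<And>l w. A \<le> l \<Longrightarrow> H l w = 0"
  shows "recognizable (series c H)"
  by (rule recognizable_step[where c = c and H = H and A = A]) (use assms in auto)

lemma recognizable_if:
  "recognizable F \<Longrightarrow> recognizable G \<Longrightarrow> recognizable (\<lambda>w. if c then F w else G w)"
  by (cases c) simp_all

text \<open>
  Words for iterations: the letter \<open>0\<close> commits a step, an odd letter \<open>2 l + 1\<close> is the letter \<open>l\<close> of the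
  guess for the current step, and a positive even letter \<open>2 p + 2\<close> increments the variable \<open>p\<close>.
  \<open>block\<close> extracts the guess for the current step.
\<close>

definition block :: "nat list \<Rightarrow> nat list" where
  "block = translate (\<lambda>l. if l = 0 then None else Some (if odd l then [l div 2] else []))"

lemma block_simps [simp]:
  "block [] = []" "block (0 # w) = []" "block (Suc (2 * l) # w) = l # block w"
  "block (Suc (Suc (2 * l)) # w) = block w"
  by (simp_all add: block_def)

lemma recognizable_block:
  assumes "recognizable F"
  shows "recognizable (\<lambda>w. F (block w))"
  unfolding block_def
proof (rule recognizable_translate[OF assms])
  show "\<exists>B. \<forall>l\<ge>B. \<exists>u. (if l = 0 then None else Some (if odd l then [l div 2] else [])) = Some u \<and>
          (\<forall>x\<in>set u. A \<le> x)" for A :: nat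
    by (rule exI[of _ "Suc (2 * A)"]) auto
qed

lemma block_append:
  assumes "block w = []"
  shows "block (map (\<lambda>l. 2 * l + 1) u @ w) = u"
  using assms by (induction u) auto

text \<open>
  Closure under bounded iteration. For a word, \<open>x p\<close> is the value of the parameter \<open>p\<close> (or of the
  initial state \<open>a\<close>), \<open>cnt\<close> the number of committed steps, and \<open>cur\<close> the state reached so far.
  Committing a step adds to \<open>err\<close> the error of the guess for this step and its disagreement with
  the parameters, the step number and the current state. Parameters must not change once a step has
  been committed: incrementing one adds \<open>cnt\<close> to \<open>err\<close>.
\<close>

lemma listable_iterate:
  assumes P: "listable V P" and fresh: "a \<notin> V" "n \<notin> V" "b \<notin> V" "distinct [a, n, b]"
    and iuv: "i \<in> V" "u \<in> V" "v \<in> V" "distinct [i, u, v]"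
  shows "listable ((V - {i, u, v}) \<union> {a, n, b})
    (\<lambda>e. \<exists>s. s 0 = e a \<and> s (e n) = e b \<and> (\<forall>j<e n. P (e(i := j, u := s j, v := s (Suc j)))))"
proof -
  obtain E g where 1: "finite V" "recognizable E" "\<forall>w. 0 \<le> E w"
      "\<forall>i\<in>V. recognizable (g i)" "\<forall>i\<in>V. \<forall>w. 0 \<le> g i w"
      "\<forall>e. P e \<longleftrightarrow> (\<exists>w. E w = 0 \<and> (\<forall>i\<in>V. g i w = int (e i)))"
    by (rule listableE[OF P])
  note 1 = 1[rule_format]
  define Q where "Q = V - {i, u, v}"
  have Q: "finite Q" "a \<notin> Q" "n \<notin> Q" "b \<notin> Q" "V = Q \<union> {i, u, v}" "Q \<inter> {i, u, v} = {}"
    using 1(1) fresh iuv by (auto simp: Q_def)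
  define X where "X = (\<lambda>p. 2 * p + 2) ` insert a Q"
  have X: "finite X" "0 \<notin> X" "\<And>x. x \<in> X \<Longrightarrow> even x" using Q(1) by (auto simp: X_def)
  define x where "x p w = count_list w (2 * p + 2)" for p and w :: "nat list"
  define cnt where "cnt w = count_list w 0" for w :: "nat list"
  define cur where "cur = series (\<lambda>l. if l = 0 then 0 else 1)
    (\<lambda>l w. if l = 0 then g v (block w) else if l = 2 * a + 2 then 1 else 0)"
  define bad where "bad w = E (block w) + (\<Sum>p\<in>Q. (g p (block w) - int (x p w))\<^sup>2)
    + (g u (block w) - cur w)\<^sup>2 + (g i (block w) - int (cnt w))\<^sup>2" for w
  define err where "err = series (\<lambda>_. 1)
    (\<lambda>l w. if l = 0 then bad w else if l \<in> X then int (cnt w) else 0)"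
  have cur_simps: "cur [] = 0" "cur (l # w) =
     (if l = 0 then g v (block w) else if l = 2 * a + 2 then cur w + 1 else cur w)" for l w
    by (simp_all add: cur_def)
  have err_simps: "err [] = 0" "err (l # w) = err w +
     (if l = 0 then bad w else if l \<in> X then int (cnt w) else 0)" for l w
    by (simp_all add: err_def)
  have x_simps: "x p [] = 0" "x p (l # w) = (if l = 2 * p + 2 then Suc (x p w) else x p w)" for l p w
    by (simp_all add: x_def)
  have cnt_simps: "cnt [] = 0" "cnt (l # w) = (if l = 0 then Suc (cnt w) else cnt w)" for l w
    by (simp_all add: cnt_def)
  have rec_x: "recognizable (\<lambda>w. int (x p w))" for p
    unfolding x_def by (rule recognizable_count)
  have rec_cnt: "recognizable (\<lambda>w. int (cnt w))"
    unfolding cnt_def by (rule recognizable_count)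
  have rec_g: "recognizable (\<lambda>w. g p (block w))" if "p \<in> V" for p
    by (rule recognizable_block) (use 1(4) that in simp)
  have rec_cur: "recognizable cur"
    unfolding cur_def
    by (rule recognizable_series[where A = "2 * a + 3"])
      (auto intro!: recognizable_if recognizable_const rec_g iuv)
  have rec_bad: "recognizable bad"
    unfolding bad_def
    by (intro recognizable_add recognizable_sum recognizable_power2 recognizable_diff rec_x rec_cnt
        rec_cur rec_g recognizable_block[OF 1(2)]) (use Q iuv in auto)
  have rec_err: "recognizable err"
    unfolding err_def
  proof (rule recognizable_series[where A = "Suc (Max (insert 0 X))"])
    show "recognizable (\<lambda>w. if l = 0 then bad w else if l \<in> X then int (cnt w) else 0)" for l
      by (intro recognizable_if recognizable_const rec_bad rec_cnt)
    show "(if l = 0 then bad w else if l \<in> X then int (cnt w) else 0) = 0"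
      if "Suc (Max (insert 0 X)) \<le> l" for l w
    proof -
      have "l \<notin> X" using that X(1) Max_ge[of "insert 0 X" l] by fastforce
      then show ?thesis using that by simp
    qed
  qed simp
  have bad_nonneg: "0 \<le> bad w" for w
    unfolding bad_def using 1(3) by (intro add_nonneg_nonneg sum_nonneg) auto
  have bad_0: "bad w = 0 \<longleftrightarrow> E (block w) = 0 \<and> (\<forall>p\<in>Q. g p (block w) = int (x p w)) \<and>
      g u (block w) = cur w \<and> g i (block w) = int (cnt w)" for w
  proof -
    let ?s = "\<Sum>p\<in>Q. (g p (block w) - int (x p w))\<^sup>2"
    have "?s \<ge> 0" by (simp add: sum_nonneg)
    moreover have "?s = 0 \<longleftrightarrow> (\<forall>p\<in>Q. g p (block w) = int (x p w))"
      using Q(1) by (subst sum_nonneg_eq_0_iff) auto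
    moreover have "(g u (block w) - cur w)\<^sup>2 \<ge> 0" "(g i (block w) - int (cnt w))\<^sup>2 \<ge> 0"
      "(g u (block w) - cur w)\<^sup>2 = 0 \<longleftrightarrow> g u (block w) = cur w"
      "(g i (block w) - int (cnt w))\<^sup>2 = 0 \<longleftrightarrow> g i (block w) = int (cnt w)" by auto
    ultimately show ?thesis unfolding bad_def using 1(3)[of "block w"] by linarith
  qed
  have err_nonneg: "0 \<le> err w" for w
    using bad_nonneg by (induction w) (auto simp: err_simps)
  have cur_nonneg: "0 \<le> cur w" for w
    using 1(5) iuv by (induction w) (auto simp: cur_simps)
  define step where "step e s m \<longleftrightarrow> (\<forall>j<m. P (e(i := j, u := s j, v := s (Suc j))))"
    for e :: "nat \<Rightarrow> nat" and s m
  have P_dep: "P e = P e'" if "\<forall>p\<in>V. e p = e' p" for e e'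
    using that 1(6) by simp
  \<comment> \<open>Words without error describe an iteration.\<close>
  have sound: "\<exists>s. s 0 = x a w \<and> int (s (cnt w)) = cur w \<and> step e s (cnt w)"
    if "err w = 0" "\<forall>p\<in>Q. e p = x p w" for w e
    using that
  proof (induction w arbitrary: e)
    case Nil
    then show ?case by (auto simp: x_simps cnt_simps cur_simps step_def)
  next
    case (Cons l w)
    have err0: "err w = 0" "(if l = 0 then bad w else if l \<in> X then int (cnt w) else 0) = 0"
      using Cons.prems(1) err_nonneg[of w] bad_nonneg[of w] by (auto simp: err_simps split: if_splits)
    consider "l = 0" | "l \<in> X" "l \<noteq> 0" | "l \<notin> X" "l \<noteq> 0" by blast
    then show ?case
    proof cases
      case 1
      then have x: "x p (l # w) = x p w" for p by (simp add: x_simps)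
      then obtain s where s: "s 0 = x a w" "int (s (cnt w)) = cur w" "step e s (cnt w)"
        using Cons.IH[OF err0(1), of e] Cons.prems(2) by auto
      have b: "E (block w) = 0" "\<forall>p\<in>Q. g p (block w) = int (x p w)"
          "g u (block w) = cur w" "g i (block w) = int (cnt w)"
        using err0(2) 1 bad_0 by auto
      define s' where "s' = s(Suc (cnt w) := nat (g v (block w)))"
      have "P (e(i := cnt w, u := s (cnt w), v := nat (g v (block w))))"
        unfolding \<open>\<And>e. P e = _\<close>
        by (rule exI[of _ "block w"])
          (use b s(2) Cons.prems(2) x Q(6) \<open>\<And>i w. i \<in> V \<Longrightarrow> 0 \<le> g i w\<close> iuv in \<open>auto simp: Q(5)\<close>)
      then have "step e s' (Suc (cnt w))"
        using s(3) by (auto simp: step_def s'_def less_Suc_eq)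
      moreover have "int (s' (cnt (l # w))) = cur (l # w)"
        using 1 iuv \<open>\<And>i w. i \<in> V \<Longrightarrow> 0 \<le> g i w\<close> by (simp add: s'_def cnt_simps cur_simps)
      moreover have "s' 0 = s 0" by (simp add: s'_def)
      ultimately show ?thesis using s(1) x 1 by (intro exI[of _ s']) (simp add: cnt_simps)
    next
      case 2
      then have c: "cnt w = 0" "cnt (l # w) = 0" using err0(2) by (simp_all add: cnt_simps)
      obtain s where s: "s 0 = x a w" "int (s (cnt w)) = cur w"
        using Cons.IH[OF err0(1), of "\<lambda>p. x p w"] by blast
      then have "int (x a (l # w)) = cur (l # w)"
        using c 2 by (simp add: x_simps cur_simps)
      then show ?thesis using c by (intro exI[of _ "\<lambda>_. x a (l # w)"]) (simp add: step_def)
    next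
      case 3
      then have x: "x p (l # w) = x p w" if "p \<in> insert a Q" for p
        using that by (auto simp: x_simps X_def)
      moreover have "cur (l # w) = cur w" "cnt (l # w) = cnt w"
        using 3 by (auto simp: cur_simps cnt_simps X_def)
      ultimately show ?thesis using Cons.IH[OF err0(1), of e] Cons.prems(2) by simp
    qed
  qed
  \<comment> \<open>Every iteration is described by a word that sets all parameters before the first step.\<close>
  have complete: "\<exists>w. err w = 0 \<and> block w = [] \<and> (\<forall>p\<in>Q. x p w = e p) \<and> x a w = s 0 \<and>
      cnt w = m \<and> cur w = int (s m)" if "step e s m" for e s m
    using that
  proof (induction m)
    case 0
    obtain w where w: "\<And>l. count_list w l =
        (if l \<in> X then (if l = 2 * a + 2 then s 0 else e (l div 2 - 1)) else 0)"
      using ex_count_list[OF X(1), of "\<lambda>l. if l = 2 * a + 2 then s 0 else e (l div 2 - 1)"] by blast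
    have set: "set w \<subseteq> X"
    proof
      fix l assume "l \<in> set w"
      then have "count_list w l \<noteq> 0" by (simp add: count_list_0_iff)
      then show "l \<in> X" using w[of l] by (auto split: if_splits)
    qed
    then have "err w = 0 \<and> block w = [] \<and> cnt w = 0 \<and> cur w = int (x a w)"
    proof (induction w)
      case (Cons l w)
      then have l: "l \<in> X" by simp
      then obtain p where p: "l = Suc (Suc (2 * p))" unfolding X_def by auto
      show ?case using Cons l p
        by (simp add: err_simps cnt_simps cur_simps x_simps)
    qed (simp add: err_simps cnt_simps cur_simps x_simps)
    moreover have "x a w = s 0" "\<forall>p\<in>Q. x p w = e p"
      using w Q(2) by (auto simp: x_def X_def)
    ultimately show ?case by auto
  next
    case (Suc m)
    then have "step e s m" by (simp add: step_def)
    then obtain w where w: "err w = 0" "block w = []" "\<forall>p\<in>Q. x p w = e p" "x a w = s 0"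
        "cnt w = m" "cur w = int (s m)" using Suc.IH by blast
    have "P (e(i := m, u := s m, v := s (Suc m)))" using Suc.prems by (simp add: step_def)
    then obtain y where y: "E y = 0" "\<forall>p\<in>V. g p y = int ((e(i := m, u := s m, v := s (Suc m))) p)"
      using 1(6) by blast
    define w' where "w' = map (\<lambda>l. 2 * l + 1) y @ w"
    have notX: "2 * l + 1 \<notin> X" for l using X(3)[of "2 * l + 1"] by auto
    have odd: "2 * l + 1 \<noteq> 2 * p + 2" for l p :: nat by presburger
    have body: "err ((2 * l + 1) # z) = err z" "cnt ((2 * l + 1) # z) = cnt z"
        "cur ((2 * l + 1) # z) = cur z" "x p ((2 * l + 1) # z) = x p z" for l z p
      unfolding err_simps cnt_simps cur_simps x_simps using notX odd by simp_all
    have "err w' = err w \<and> cnt w' = cnt w \<and> cur w' = cur w \<and> (\<forall>p. x p w' = x p w)"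
      unfolding w'_def by (induction y) (simp_all only: body list.map append.simps simp_thms)
    then have w': "err w' = 0" "cnt w' = m" "cur w' = int (s m)" "\<And>p. x p w' = x p w" using w by auto
    have b: "block w' = y" unfolding w'_def by (rule block_append) (rule w(2))
    have "bad w' = 0" unfolding bad_0 b w' using w y Q(5,6) iuv(4) by auto
    moreover have "g v y = int (s (Suc m))" using y(2) iuv by auto
    ultimately show ?case
      using w w' b by (intro exI[of _ "0 # w'"]) (simp add: err_simps cnt_simps cur_simps x_simps)
  qed
  show ?thesis
    unfolding Q_def[symmetric]
  proof (rule listableI[where E = err and g = "\<lambda>p w. if p = n then int (cnt w) else if p = b then cur w
        else int (x p w)"])
    fix e
    let ?o = "\<lambda>w p. if p = n then int (cnt w) else if p = b then cur w else int (x p w)"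
    show "(\<exists>s. s 0 = e a \<and> s (e n) = e b \<and> (\<forall>j<e n. P (e(i := j, u := s j, v := s (Suc j))))) \<longleftrightarrow>
      (\<exists>w. err w = 0 \<and> (\<forall>p\<in>Q \<union> {a, n, b}. ?o w p = int (e p)))"
    proof
      assume "\<exists>s. s 0 = e a \<and> s (e n) = e b \<and> (\<forall>j<e n. P (e(i := j, u := s j, v := s (Suc j))))"
      then obtain s where s: "s 0 = e a" "s (e n) = e b" "step e s (e n)" unfolding step_def by blast
      from complete[OF s(3)] obtain w where "err w = 0" "\<forall>p\<in>Q. x p w = e p" "x a w = s 0"
        "cnt w = e n" "cur w = int (s (e n))" by blast
      then show "\<exists>w. err w = 0 \<and> (\<forall>p\<in>Q \<union> {a, n, b}. ?o w p = int (e p))"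
        using s Q fresh(4) by (intro exI[of _ w]) auto
    next
      assume "\<exists>w. err w = 0 \<and> (\<forall>p\<in>Q \<union> {a, n, b}. ?o w p = int (e p))"
      then obtain w where w: "err w = 0" "\<And>p. p \<in> Q \<union> {a, n, b} \<Longrightarrow> ?o w p = int (e p)" by blast
      have "x a w = e a" using w(2)[of a] fresh(4) by simp
      moreover have "cnt w = e n" using w(2)[of n] by simp
      moreover have "cur w = int (e b)" using w(2)[of b] fresh(4) by simp
      moreover have "\<forall>p\<in>Q. e p = x p w"
      proof
        fix p assume "p \<in> Q"
        then show "e p = x p w" using w(2)[of p] Q(3,4) by (auto split: if_splits)
      qed
      ultimately show "\<exists>s. s 0 = e a \<and> s (e n) = e b \<and>
          (\<forall>j<e n. P (e(i := j, u := s j, v := s (Suc j))))"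
        using sound[OF w(1), of e] unfolding step_def by auto
    qed
  qed (use Q(1) rec_err err_nonneg cur_nonneg in \<open>auto intro!: recognizable_if rec_cnt rec_cur rec_x\<close>)
qed

inductive_cases computes_ZeroE: "computes Zero xs y"
inductive_cases computes_SuccE: "computes Succ xs y"
inductive_cases computes_ProjE: "computes (Proj i) xs y"
inductive_cases computes_CompE: "computes (Comp f gs) xs y"
inductive_cases computes_PrecE: "computes (Prec f g) xs y"
inductive_cases computes_MuE: "computes (Mu f) xs y"

lemma computes_Zero_iff: "computes Zero xs y \<longleftrightarrow> y = 0"
  by (auto elim: computes_ZeroE intro: computes.Zero)

lemma computes_Succ_iff: "computes Succ xs y \<longleftrightarrow> (\<exists>x zs. xs = x # zs \<and> y = Suc x)"
  by (auto elim: computes_SuccE intro: computes.Succ)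

lemma computes_Proj_iff: "computes (Proj i) xs y \<longleftrightarrow> i < length xs \<and> y = xs ! i"
  by (auto elim: computes_ProjE intro: computes.Proj)

lemma computes_Comp_iff:
  "computes (Comp f gs) xs y \<longleftrightarrow>
    (\<exists>ys. length ys = length gs \<and> (\<forall>j<length gs. computes (gs ! j) xs (ys ! j)) \<and> computes f ys y)"
  (is "?L \<longleftrightarrow> ?R")
proof
  assume ?L
  then obtain ys where "list_all2 (\<lambda>g y. computes g xs y) gs ys" "computes f ys y"
    by (rule computes_CompE) blast
  then show ?R by (auto simp: list_all2_conv_all_nth)
next
  assume ?R
  then obtain ys where "list_all2 (\<lambda>g y. computes g xs y) gs ys" "computes f ys y"
    unfolding list_all2_conv_all_nth by metis
  then show ?L by (rule computes.Comp)
qed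

lemma computes_Mu_iff:
  "computes (Mu f) xs y \<longleftrightarrow> computes f (y # xs) 0 \<and> (\<forall>m<y. \<exists>z. computes f (m # xs) (Suc z))"
  by (auto elim: computes_MuE intro: computes.Mu)

lemma computes_Prec_Nil: "\<not> computes (Prec f g) [] y"
  by (auto elim: computes_PrecE)

lemma computes_Prec_iff:
  "computes (Prec f g) (m # xs) y \<longleftrightarrow>
    (\<exists>s. computes f xs (s 0) \<and> s m = y \<and> (\<forall>j<m. computes g (j # s j # xs) (s (Suc j))))"
  (is "_ \<longleftrightarrow> ?R m y")
proof (induction m arbitrary: y)
  case 0
  show ?case
    by (auto elim: computes_PrecE intro: computes.Prec_0)
next
  case (Suc m)
  show ?case
  proof
    assume "computes (Prec f g) (Suc m # xs) y"
    then obtain z where "computes (Prec f g) (m # xs) z" "computes g (m # z # xs) y"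
      by (auto elim: computes_PrecE)
    then obtain s where s: "computes f xs (s 0)" "s m = z" "\<forall>j<m. computes g (j # s j # xs) (s (Suc j))"
      using Suc.IH by blast
    then show "?R (Suc m) y"
      using \<open>computes g (m # z # xs) y\<close>
      by (intro exI[of _ "s(Suc m := y)"]) (auto simp: less_Suc_eq)
  next
    assume "?R (Suc m) y"
    then obtain s where s: "computes f xs (s 0)" "s (Suc m) = y"
        "\<forall>j<Suc m. computes g (j # s j # xs) (s (Suc j))" by blast
    then have "computes (Prec f g) (m # xs) (s m)" using Suc.IH by (metis less_Suc_eq)
    then show "computes (Prec f g) (Suc m # xs) y" using s by (auto intro: computes.Prec_Suc)
  qed
qed

lemma computes_unique:
  assumes "computes f xs y" "computes f xs z"
  shows "y = z"
  using assms
proof (induction f arbitrary: xs y z)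
  case (Comp f gs)
  obtain ys where ys: "length ys = length gs" "\<forall>j<length gs. computes (gs ! j) xs (ys ! j)" "computes f ys y"
    using Comp.prems(1) computes_Comp_iff by blast
  obtain zs where zs: "length zs = length gs" "\<forall>j<length gs. computes (gs ! j) xs (zs ! j)" "computes f zs z"
    using Comp.prems(2) computes_Comp_iff by blast
  have "ys ! i = zs ! i" if "i < length gs" for i
    by (rule Comp.IH(2)[of "gs ! i" xs]) (use that ys zs in auto)
  then have "ys = zs" using ys(1) zs(1) by (intro nth_equalityI) auto
  then show ?case using ys zs Comp.IH(1) by blast
next
  case (Prec f g)
  show ?case
  proof (cases xs)
    case Nil
    then show ?thesis using Prec.prems computes_Prec_Nil by blast
  next
    case (Cons m ws)
    obtain s where s: "computes f ws (s 0)" "s m = y" "\<forall>j<m. computes g (j # s j # ws) (s (Suc j))"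
      using Prec.prems(1) computes_Prec_iff Cons by blast
    obtain t where t: "computes f ws (t 0)" "t m = z" "\<forall>j<m. computes g (j # t j # ws) (t (Suc j))"
      using Prec.prems(2) computes_Prec_iff Cons by blast
    have "j \<le> m \<Longrightarrow> s j = t j" for j
    proof (induction j)
      case 0
      then show ?case using s(1) t(1) Prec.IH(1) by blast
    next
      case (Suc j)
      then show ?case using s(3) t(3) Prec.IH(2) by (metis Suc_le_lessD less_imp_le_nat)
    qed
    then show ?thesis using s t by blast
  qed
next
  case (Mu f)
  have "\<not> y < z" if "computes (Mu f) xs y" "computes (Mu f) xs z" for y z
    using that Mu.IH unfolding computes_Mu_iff by (metis nat.distinct(1))
  then show ?case using Mu.prems by (metis linorder_neqE_nat)
qed (auto simp: computes_Zero_iff computes_Succ_iff computes_Proj_iff)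

lemma listable_cong_mono:
  assumes "listable V P" "V \<subseteq> W" "finite W" "\<And>e. Q e \<longleftrightarrow> P e"
  shows "listable W Q"
  using listable_mono[OF listable_cong[OF assms(1,4)] assms(2,3)] .

lemma less_Suc_Max: "finite A \<Longrightarrow> x \<in> A \<Longrightarrow> x < Suc (Max A)"
  by (simp add: less_Suc_eq_le)

lemma map_fresh: "x \<notin> set xs \<Longrightarrow> map (e(x := t)) xs = map e xs"
  by auto

text \<open>
  The graph of an algorithm is listable, with arbitrary variables, possibly repeated, for the
  arguments and the result. Composition introduces fresh variables for the intermediate results.
  Primitive recursion iterates the step function with the state \<open>u\<close> and the next state \<open>v\<close>, and
  minimization checks by an iteration over \<open>m < y\<close> that \<open>f\<close> has positive values; the iterated state
  serves as a witness for this value.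
\<close>

theorem listable_computes: "listable (insert y (set xs)) (\<lambda>e. computes f (map e xs) (e y))"
proof (induction f arbitrary: xs y)
  case Zero
  have "listable (insert y (set xs)) (\<lambda>e. int (e y) = 0)"
    by (rule listable_eq) (auto intro: polynomial_fun.intros)
  then show ?case by (rule listable_cong) (simp add: computes_Zero_iff)
next
  case Succ
  show ?case
  proof (cases xs)
    case Nil
    then show ?thesis using listable_cong[OF listable_False] by (simp add: computes_Succ_iff)
  next
    case (Cons x zs)
    have "listable (insert y (set xs)) (\<lambda>e. int (e y) = int (e x) + 1)"
      by (rule listable_eq) (use Cons in \<open>auto intro: polynomial_fun.intros\<close>)
    then show ?thesis by (rule listable_cong) (auto simp: computes_Succ_iff Cons)
  qed
next
  case (Proj i)
  show ?case
  proof (cases "i < length xs")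
    case False
    then show ?thesis using listable_cong[OF listable_False] by (simp add: computes_Proj_iff)
  next
    case True
    have "listable (insert y (set xs)) (\<lambda>e. int (e y) = int (e (xs ! i)))"
      by (rule listable_eq) (use True in \<open>auto intro!: polynomial_fun.var\<close>)
    then show ?thesis by (rule listable_cong) (use True in \<open>auto simp: computes_Proj_iff\<close>)
  qed
next
  case (Comp f gs)
  define N where "N = Suc (Max (insert y (set xs)))"
  have N: "x < N" if "x \<in> insert y (set xs)" for x
    using that unfolding N_def by (intro less_Suc_Max) auto
  define zs where "zs = [N..<N + length gs]"
  have zs: "length zs = length gs" "\<And>j. j < length gs \<Longrightarrow> zs ! j = N + j" "set zs = {N..<N + length gs}"
    by (auto simp: zs_def)
  let ?V = "insert y (set xs \<union> set zs)"
  have "listable ?V (\<lambda>e. \<forall>j\<in>{..<length gs}. computes (gs ! j) (map e xs) (e (zs ! j)))"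
  proof (rule listable_ball)
    fix j assume "j \<in> {..<length gs}"
    then show "listable ?V (\<lambda>e. computes (gs ! j) (map e xs) (e (zs ! j)))"
      using zs by (intro listable_mono[OF Comp.IH(2)]) auto
  qed auto
  moreover have "listable ?V (\<lambda>e. computes f (map e zs) (e y))"
    by (rule listable_mono[OF Comp.IH(1)]) auto
  ultimately have "listable (?V \<union> ?V) (\<lambda>e. (\<forall>j\<in>{..<length gs}. computes (gs ! j) (map e xs) (e (zs ! j)))
      \<and> computes f (map e zs) (e y))" by (rule listable_conj)
  note listable_exs[OF this, of zs]
  moreover have "?V \<union> ?V - set zs = insert y (set xs)" using N zs(3) by force
  ultimately have *: "listable (insert y (set xs)) (\<lambda>e. \<exists>e'. (\<forall>x. x \<notin> set zs \<longrightarrow> e' x = e x) \<and>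
      (\<forall>j\<in>{..<length gs}. computes (gs ! j) (map e' xs) (e' (zs ! j))) \<and> computes f (map e' zs) (e' y))"
    by simp
  show ?case
  proof (rule listable_cong[OF *])
    fix e
    show "computes (Comp f gs) (map e xs) (e y) \<longleftrightarrow> (\<exists>e'. (\<forall>x. x \<notin> set zs \<longrightarrow> e' x = e x) \<and>
      (\<forall>j\<in>{..<length gs}. computes (gs ! j) (map e' xs) (e' (zs ! j))) \<and> computes f (map e' zs) (e' y))"
    proof
      assume "computes (Comp f gs) (map e xs) (e y)"
      then obtain ys where ys: "length ys = length gs"
          "\<forall>j<length gs. computes (gs ! j) (map e xs) (ys ! j)" "computes f ys (e y)"
        using computes_Comp_iff by blast
      define e' where "e' x = (if x \<in> set zs then ys ! (x - N) else e x)" for x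
      have "map e' zs = ys" by (rule nth_equalityI) (use ys zs in \<open>auto simp: e'_def\<close>)
      moreover have "map e' xs = map e xs" "e' y = e y"
        using N zs(3) by (force simp: e'_def)+
      moreover have "e' (zs ! j) = ys ! j" if "j < length gs" for j
        using that zs by (simp add: e'_def)
      moreover have "\<forall>x. x \<notin> set zs \<longrightarrow> e' x = e x" by (simp add: e'_def)
      ultimately show "\<exists>e'. (\<forall>x. x \<notin> set zs \<longrightarrow> e' x = e x) \<and>
          (\<forall>j\<in>{..<length gs}. computes (gs ! j) (map e' xs) (e' (zs ! j))) \<and> computes f (map e' zs) (e' y)"
        using ys by (metis lessThan_iff)
    next
      assume "\<exists>e'. (\<forall>x. x \<notin> set zs \<longrightarrow> e' x = e x) \<and>
        (\<forall>j\<in>{..<length gs}. computes (gs ! j) (map e' xs) (e' (zs ! j))) \<and> computes f (map e' zs) (e' y)"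
      then obtain e' where e': "\<forall>x. x \<notin> set zs \<longrightarrow> e' x = e x"
        "\<forall>j<length gs. computes (gs ! j) (map e' xs) (e' (zs ! j))" "computes f (map e' zs) (e' y)" by auto
      have fresh: "x \<notin> set zs" if "x \<in> insert y (set xs)" for x using N[OF that] zs(3) by auto
      then have eq: "map e' xs = map e xs" "e' y = e y" using e'(1) by auto
      have "\<forall>j<length gs. computes (gs ! j) (map e xs) (map e' zs ! j)"
        using e'(2) zs(1) unfolding eq(1) by simp
      then show "computes (Comp f gs) (map e xs) (e y)"
        unfolding computes_Comp_iff using e'(3) zs(1) eq(2) by (intro exI[of _ "map e' zs"]) simp
    qed
  qed
next
  case (Prec f g)
  show ?case
  proof (cases xs)
    case Nil
    then show ?thesis using listable_cong[OF listable_False] by (simp add: computes_Prec_Nil)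
  next
    case (Cons x ps)
    define N where "N = Suc (Max (insert y (set xs)))"
    have N: "x < N" if "x \<in> insert y (set xs)" for x
      using that unfolding N_def by (intro less_Suc_Max) auto
    then have fresh: "k \<notin> set ps" "x \<noteq> k" "y \<noteq> k" if "N \<le> k" for k
      using that unfolding Cons by force+
    define a n b i u v where names: "a = N" "n = N + 1" "b = N + 2" "i = N + 3" "u = N + 4" "v = N + 5"
    have fr: "a \<notin> set ps" "n \<notin> set ps" "b \<notin> set ps" "i \<notin> set ps" "u \<notin> set ps" "v \<notin> set ps"
        "x \<noteq> a" "x \<noteq> n" "x \<noteq> b" "y \<noteq> a" "y \<noteq> n" "y \<noteq> b"
      using fresh by (simp_all add: names)
    have ds: "distinct [a, n, b, i, u, v]" "distinct [v, u, i, b, n, a]" by (simp_all add: names)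
    have eq: "map (e(i := j, u := k, v := t)) (i # u # ps) = j # k # map e ps"
        "(e(i := j, u := k, v := t)) v = t" for e :: "nat \<Rightarrow> nat" and j k t
      using fr ds by (simp_all add: map_fresh)
    have "listable ((insert v (set (i # u # ps)) - {i, u, v}) \<union> {a, n, b}) (\<lambda>e. \<exists>s. s 0 = e a \<and> s (e n) = e b \<and>
        (\<forall>j<e n. computes g (map (e(i := j, u := s j, v := s (Suc j))) (i # u # ps))
          ((e(i := j, u := s j, v := s (Suc j))) v)))"
      by (rule listable_iterate[OF Prec.IH(2)]) (use fr ds in simp_all)
    then have 1: "listable (insert x (insert y (set ps \<union> {a, n, b}))) (\<lambda>e. \<exists>s. s 0 = e a \<and> s (e n) = e b \<and>
        (\<forall>j<e n. computes g (j # s j # map e ps) (s (Suc j))))"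
      unfolding eq by (rule listable_mono) auto
    have 2: "listable (insert x (insert y (set ps \<union> {a, n, b}))) (\<lambda>e. computes f (map e ps) (e a))"
      by (rule listable_mono[OF Prec.IH(1)]) auto
    have 3: "listable (insert x (insert y (set ps \<union> {a, n, b}))) (\<lambda>e. int (e n) = int (e x))"
      by (rule listable_eq) (auto intro: polynomial_fun.intros)
    have 4: "listable (insert x (insert y (set ps \<union> {a, n, b}))) (\<lambda>e. int (e b) = int (e y))"
      by (rule listable_eq) (auto intro: polynomial_fun.intros)
    note listable_ex[OF listable_ex[OF listable_ex[OF listable_conj[OF listable_conj[OF 3 4]
        listable_conj[OF 1 2]]]], of a n b]
    then show ?thesis
    proof (rule listable_cong_mono)
      fix e
      show "computes (Prec f g) (map e xs) (e y) \<longleftrightarrow> (\<exists>t t' t''.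
          (int ((e(b := t, n := t', a := t'')) n) = int ((e(b := t, n := t', a := t'')) x) \<and>
           int ((e(b := t, n := t', a := t'')) b) = int ((e(b := t, n := t', a := t'')) y)) \<and>
          (\<exists>s. s 0 = (e(b := t, n := t', a := t'')) a \<and>
               s ((e(b := t, n := t', a := t'')) n) = (e(b := t, n := t', a := t'')) b \<and>
               (\<forall>j<(e(b := t, n := t', a := t'')) n.
                 computes g (j # s j # map (e(b := t, n := t', a := t'')) ps) (s (Suc j)))) \<and>
          computes f (map (e(b := t, n := t', a := t'')) ps) ((e(b := t, n := t', a := t'')) a))"
        using fr ds unfolding Cons by (simp add: map_fresh computes_Prec_iff) metis
    qed (use fr in \<open>auto simp: Cons\<close>)
  qed
next
  case (Mu f)
  define N where "N = Suc (Max (insert y (set xs)))"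
  have N: "x < N" if "x \<in> insert y (set xs)" for x
    using that unfolding N_def by (intro less_Suc_Max) auto
  then have fresh: "k \<notin> set xs" "y \<noteq> k" if "N \<le> k" for k
    using that by force+
  define a n b i u v z where names: "a = N" "n = N + 1" "b = N + 2" "i = N + 3" "u = N + 4" "v = N + 5" "z = N + 6"
  have fr: "a \<notin> set xs" "n \<notin> set xs" "b \<notin> set xs" "i \<notin> set xs" "u \<notin> set xs" "v \<notin> set xs" "z \<notin> set xs"
        "y \<noteq> a" "y \<noteq> n" "y \<noteq> b"
    using fresh by (simp_all add: names)
  have ds: "distinct [a, n, b, i, u, v, z]" "distinct [z, v, u, i, b, n, a]" by (simp_all add: names)
  \<comment> \<open>The state \<open>u\<close> at step \<open>i\<close> is the predecessor of the value at \<open>i\<close>; the next state \<open>v\<close> is unconstrained.\<close>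
  have "listable (insert z (set (i # xs))) (\<lambda>e. computes f (map e (i # xs)) (e z))" by (rule Mu.IH)
  then have a1: "listable (insert z (insert v (insert u (insert i (set xs))))) (\<lambda>e. computes f (map e (i # xs)) (e z))"
    by (rule listable_mono) auto
  have a2: "listable (insert z (insert v (insert u (insert i (set xs))))) (\<lambda>e. int (e z) = int (e u) + 1)"
    by (rule listable_eq) (auto intro: polynomial_fun.intros)
  from listable_ex[OF listable_conj[OF a1 a2], of z]
  have "listable (insert v (insert u (insert i (set xs)))) (\<lambda>e. computes f (e i # map e xs) (Suc (e u)))"
  proof (rule listable_cong_mono)
    fix e
    show "computes f (e i # map e xs) (Suc (e u)) \<longleftrightarrow> (\<exists>t. computes f (map (e(z := t)) (i # xs)) ((e(z := t)) z) \<and>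
        int ((e(z := t)) z) = int ((e(z := t)) u) + 1)"
    proof -
      have "int t = int (e u) + 1 \<longleftrightarrow> t = Suc (e u)" for t by auto
      then show ?thesis using fr ds by (simp add: map_fresh)
    qed
  qed auto
  then have "listable ((insert v (insert u (insert i (set xs))) - {i, u, v}) \<union> {a, n, b})
      (\<lambda>e. \<exists>s. s 0 = e a \<and> s (e n) = e b \<and>
        (\<forall>j<e n. computes f ((e(i := j, u := s j, v := s (Suc j))) i # map (e(i := j, u := s j, v := s (Suc j))) xs)
          (Suc ((e(i := j, u := s j, v := s (Suc j))) u))))"
    by (rule listable_iterate) (use fr ds in simp_all)
  then have 1: "listable (insert y (set xs \<union> {a, n, b})) (\<lambda>e. \<exists>s. s 0 = e a \<and> s (e n) = e b \<and>
        (\<forall>j<e n. computes f (j # map e xs) (Suc (s j))))"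
    by (rule listable_cong_mono) (use fr ds in \<open>simp_all add: map_fresh, blast\<close>)
  have b1: "listable (insert z (insert y (set xs))) (\<lambda>e. computes f (map e (y # xs)) (e z))"
    by (rule listable_mono[OF Mu.IH]) auto
  have b2: "listable (insert z (insert y (set xs))) (\<lambda>e. int (e z) = 0)"
    by (rule listable_eq) (auto intro: polynomial_fun.intros)
  from listable_ex[OF listable_conj[OF b1 b2], of z]
  have 2: "listable (insert y (set xs \<union> {a, n, b})) (\<lambda>e. computes f (e y # map e xs) 0)"
  proof (rule listable_cong_mono)
    fix e
    show "computes f (e y # map e xs) 0 \<longleftrightarrow> (\<exists>t. computes f (map (e(z := t)) (y # xs)) ((e(z := t)) z) \<and>
        int ((e(z := t)) z) = 0)"
      using fr ds fresh(2)[of z] by (auto simp: map_fresh names(7))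
  qed auto
  have 3: "listable (insert y (set xs \<union> {a, n, b})) (\<lambda>e. int (e n) = int (e y))"
    by (rule listable_eq) (auto intro: polynomial_fun.intros)
  note listable_ex[OF listable_ex[OF listable_ex[OF listable_conj[OF 3 listable_conj[OF 1 2]]]], of a n b]
  then show ?case
  proof (rule listable_cong_mono)
    fix e
    have "(\<forall>m<e y. \<exists>z. computes f (m # map e xs) (Suc z)) \<longleftrightarrow>
        (\<exists>s. \<forall>m<e y. computes f (m # map e xs) (Suc (s m)))" by metis
    then show "computes (Mu f) (map e xs) (e y) \<longleftrightarrow> (\<exists>t t' t''.
        int ((e(b := t, n := t', a := t'')) n) = int ((e(b := t, n := t', a := t'')) y) \<and>
        (\<exists>s. s 0 = (e(b := t, n := t', a := t'')) a \<and>
          s ((e(b := t, n := t', a := t'')) n) = (e(b := t, n := t', a := t'')) b \<and>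
          (\<forall>j<(e(b := t, n := t', a := t'')) n.
            computes f (j # map (e(b := t, n := t', a := t'')) xs) (Suc (s j)))) \<and>
        computes f ((e(b := t, n := t', a := t'')) y # map (e(b := t, n := t', a := t'')) xs) 0)"
      using fr ds by (simp add: map_fresh computes_Mu_iff) metis
  qed (use fr in auto)
qed

section \<open>Codes of instances and the diagonal relation\<close>

text \<open>
  Functions of the variables \<open>V\<close> with listable graph.
\<close>

definition listable_fun :: "nat set \<Rightarrow> ((nat \<Rightarrow> nat) \<Rightarrow> nat) \<Rightarrow> bool" where
  "listable_fun V F \<longleftrightarrow> finite V \<and> (\<forall>y. listable (insert y V) (\<lambda>e. e y = F e)) \<and>
     (\<forall>e x t. x \<notin> V \<longrightarrow> F (e(x := t)) = F e)"

lemma listable_fun_const: "finite V \<Longrightarrow> listable_fun V (\<lambda>_. c)"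
proof -
  assume fin: "finite V"
  have "listable (insert y V) (\<lambda>e. e y = c)" for y
  proof -
    have "listable (insert y V) (\<lambda>e. int (e y) = int c)"
      by (rule listable_eq) (use fin in \<open>auto intro: polynomial_fun.intros\<close>)
    then show ?thesis by simp
  qed
  then show ?thesis using fin by (simp add: listable_fun_def)
qed

lemma listable_fun_var: "finite V \<Longrightarrow> x \<in> V \<Longrightarrow> listable_fun V (\<lambda>e. e x)"
proof -
  assume fin: "finite V" and x: "x \<in> V"
  have "listable (insert y V) (\<lambda>e. e y = e x)" for y
  proof -
    have "listable (insert y V) (\<lambda>e. int (e y) = int (e x))"
      by (rule listable_eq) (use fin x in \<open>auto intro: polynomial_fun.intros\<close>)
    then show ?thesis by simp
  qed
  then show ?thesis using fin x by (auto simp: listable_fun_def)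
qed

text \<open>
  The operation \<open>op\<close> need not be a polynomial; its graph must be the zero set of a polynomial, as for
  the pairing function.
\<close>

lemma listable_fun_binop:
  assumes F: "listable_fun V F" and G: "listable_fun V G"
    and q: "\<And>y a b. polynomial_fun {y, a, b} (\<lambda>e. q (int (e y)) (int (e a)) (int (e b)))"
    and op: "\<And>y a b. y = op a b \<longleftrightarrow> q (int y) (int a) (int b) = 0"
  shows "listable_fun V (\<lambda>e. op (F e) (G e))"
proof -
  have fin: "finite V" using F by (simp add: listable_fun_def)
  have "listable (insert y V) (\<lambda>e. e y = op (F e) (G e))" for y
  proof -
    define a b where ab: "a = Suc (Max (insert y V))" "b = Suc a"
    have less: "x < a" if "x \<in> insert y V" for x
      unfolding ab by (rule less_Suc_Max) (use that fin in auto)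
    have "k \<notin> V" "k \<noteq> y" if "a \<le> k" for k
      using less[of k] that by auto
    then have fresh: "a \<notin> V" "b \<notin> V" "a \<noteq> y" "b \<noteq> y" "a \<noteq> b" "y \<noteq> a" "y \<noteq> b" "b \<noteq> a"
      using ab(2) by (metis le_Suc_eq n_not_Suc_n order_refl)+
    have 1: "listable (insert a (insert b (insert y V))) (\<lambda>e. e a = F e)"
      by (rule listable_mono[of "insert a V"]) (use F fin in \<open>auto simp: listable_fun_def\<close>)
    have 2: "listable (insert a (insert b (insert y V))) (\<lambda>e. e b = G e)"
      by (rule listable_mono[of "insert b V"]) (use G fin in \<open>auto simp: listable_fun_def\<close>)
    have 3: "listable (insert a (insert b (insert y V))) (\<lambda>e. q (int (e y)) (int (e a)) (int (e b)) = 0)"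
      by (rule listable_mono[OF listable_polynomial[OF _ q[of y a b]]]) (use fin in auto)
    note listable_ex[OF listable_ex[OF listable_conj[OF 1 listable_conj[OF 2 3]]], of a b]
    then show ?thesis
    proof (rule listable_cong_mono)
      have dep: "F (e(a := t)) = F e" "G (e(a := t)) = G e" "F (e(b := t)) = F e" "G (e(b := t)) = G e" for e t
        using F G fresh by (auto simp: listable_fun_def)
      show "e y = op (F e) (G e) \<longleftrightarrow> (\<exists>t t'. (e(b := t, a := t')) a = F (e(b := t, a := t')) \<and>
          (e(b := t, a := t')) b = G (e(b := t, a := t')) \<and>
          q (int ((e(b := t, a := t')) y)) (int ((e(b := t, a := t')) a)) (int ((e(b := t, a := t')) b)) = 0)" for e
        using fresh by (simp add: dep op)
    qed (use fin fresh in auto)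
  qed
  then show ?thesis using F G by (auto simp: listable_fun_def)
qed

lemma listable_fun_add: "listable_fun V F \<Longrightarrow> listable_fun V G \<Longrightarrow> listable_fun V (\<lambda>e. F e + G e)"
  by (rule listable_fun_binop[where q = "\<lambda>y a b. y - (a + b)"])
    (auto intro!: polynomial_fun_diff polynomial_fun.add polynomial_fun.var)

lemma listable_fun_mult:
  assumes "listable_fun V F" "listable_fun V G"
  shows "listable_fun V (\<lambda>e. F e * G e)"
proof (rule listable_fun_binop[OF assms, where q = "\<lambda>y a b. y - a * b"])
  show "y = a * b \<longleftrightarrow> int y - int a * int b = 0" for y a b
    by (metis eq_iff_diff_eq_0 of_nat_eq_iff of_nat_mult)
qed (auto intro!: polynomial_fun_diff polynomial_fun.mult polynomial_fun.var)

lemma prod_encode_polynomial: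
  "2 * int (prod_encode (a, b)) = (int a + int b) * (int a + int b + 1) + 2 * int a"
proof -
  have "2 * triangle m = m * Suc m" for m by (induction m) auto
  from arg_cong[OF this[of "a + b"], of int] show ?thesis
    by (simp add: prod_encode_def algebra_simps)
qed

lemma listable_fun_prod_encode:
  "listable_fun V F \<Longrightarrow> listable_fun V G \<Longrightarrow> listable_fun V (\<lambda>e. prod_encode (F e, G e))"
proof (rule listable_fun_binop[where q = "\<lambda>y a b. 2 * y - ((a + b) * (a + b + 1) + 2 * a)"
      and op = "\<lambda>a b. prod_encode (a, b)"])
  show "y = prod_encode (a, b) \<longleftrightarrow> 2 * int y - ((int a + int b) * (int a + int b + 1) + 2 * int a) = 0"
    for y a b
    using prod_encode_polynomial[of a b] by auto
qed (auto intro!: polynomial_fun_diff polynomial_fun.add polynomial_fun.mult polynomial_fun.var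
    polynomial_fun.const)

lemma listable_fun_list_encode_Cons:
  assumes "listable_fun V F" "listable_fun V (\<lambda>e. list_encode (L e))"
  shows "listable_fun V (\<lambda>e. list_encode (F e # L e))"
proof -
  have "finite V" using assms by (simp add: listable_fun_def)
  then show ?thesis
    using listable_fun_add[OF listable_fun_prod_encode[OF assms] listable_fun_const[of V 1]] by simp
qed

text \<open>
  Codes of the first eight entries of the row of the reset state under the separator:
  \<open>1/2, 0, 1/(2D), 0, n/(2D), 0, 0, n\<^sup>2/(2D)\<close> with \<open>D = 1 + n + n\<^sup>2\<close>. They are the only entries of the
  game that depend on \<open>n\<close>.
\<close>

definition row_codes :: "nat \<Rightarrow> nat list" where
  "row_codes n = (let D = 1 + n + n * n in
     [prod_encode (1, 2), prod_encode (0, 1), prod_encode (1, 2 * D), prod_encode (0, 1),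
      prod_encode (n, 2 * D), prod_encode (0, 1), prod_encode (0, 1), prod_encode (n * n, 2 * D)])"

text \<open>
  The code of a blind MDP with \<open>nk\<close> states and \<open>ni\<close> actions, together with a belief and a threshold:
  \<open>ps\<close> holds the codes of the transition table without its first eight entries, and \<open>rest\<close> those of
  the rewards, the belief and the threshold.
\<close>

definition instance_code :: "nat \<Rightarrow> nat \<Rightarrow> nat list \<Rightarrow> nat list \<Rightarrow> nat \<Rightarrow> nat" where
  "instance_code nk ni ps rest n = list_encode (nk # ni # 1 # list_encode (row_codes n @ ps) # rest)"

text \<open>
  A number for the parts of an instance that do not depend on \<open>n\<close>.
\<close>

definition table_code :: "nat \<Rightarrow> nat \<Rightarrow> nat list \<Rightarrow> nat list \<Rightarrow> nat" where
  "table_code nk ni ps rest = list_encode [nk, ni, list_encode ps, list_encode rest]"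

text \<open>
  The variables \<open>1\<close> to \<open>6\<close> hold the four parts of an instance, its code, and the answer of \<open>f\<close>.
\<close>

lemma listable_diagonal:
  "listable {0} (\<lambda>e. \<exists>nk ni ps rest. e 0 = table_code nk ni ps rest \<and>
     computes f [instance_code nk ni ps rest (e 0)] 0)"
proof -
  let ?V = "{0..6::nat}"
  let ?L = "\<lambda>e. [prod_encode (1, 2), prod_encode (0, 1), prod_encode (1, 2 * (1 + e 0 + e 0 * e 0)), prod_encode (0, 1),
      prod_encode (e 0, 2 * (1 + e 0 + e 0 * e 0)), prod_encode (0, 1), prod_encode (0, 1),
      prod_encode (e 0 * e 0, 2 * (1 + e 0 + e 0 * e 0))] @ list_decode (e 3)"
  let ?c = "\<lambda>e. list_encode (e 1 # e 2 # 1 # list_encode (?L e) # list_decode (e 4))"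
  have "listable_fun ?V ?c"
    unfolding append.simps
    by (intro listable_fun_list_encode_Cons listable_fun_prod_encode listable_fun_add listable_fun_mult
        listable_fun_var listable_fun_const) (auto intro!: listable_fun_var)
  then have "listable (insert 5 ?V) (\<lambda>e. e 5 = ?c e)" unfolding listable_fun_def by blast
  then have 1: "listable ?V (\<lambda>e. e 5 = ?c e)" by (simp add: insert_absorb)
  have "listable_fun ?V (\<lambda>e. list_encode [e 1, e 2, e 3, e 4])"
    by (intro listable_fun_list_encode_Cons listable_fun_var listable_fun_const) (auto intro!: listable_fun_const)
  then have "listable (insert 0 ?V) (\<lambda>e. e 0 = list_encode [e 1, e 2, e 3, e 4])"
    unfolding listable_fun_def by blast
  then have 2: "listable ?V (\<lambda>e. e 0 = list_encode [e 1, e 2, e 3, e 4])" by (simp add: insert_absorb)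
  have 3: "listable ?V (\<lambda>e. computes f (map e [5]) (e 6))"
    by (rule listable_mono[OF listable_computes]) auto
  have 4: "listable ?V (\<lambda>e. int (e 6) = 0)"
    by (rule listable_eq) (auto intro: polynomial_fun.intros)
  note listable_exs[OF listable_conj[OF listable_conj[OF 1 2] listable_conj[OF 3 4]], of "[1..<7]"]
  then show ?thesis
  proof (rule listable_cong_mono)
    fix e :: "nat \<Rightarrow> nat"
    show "(\<exists>nk ni ps rest. e 0 = table_code nk ni ps rest \<and>
       computes f [instance_code nk ni ps rest (e 0)] 0) \<longleftrightarrow>
     (\<exists>e'. (\<forall>x. x \<notin> set [1..<7] \<longrightarrow> e' x = e x) \<and>
       (e' 5 = ?c e' \<and> e' 0 = list_encode [e' 1, e' 2, e' 3, e' 4]) \<and>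
       computes f (map e' [5]) (e' 6) \<and> int (e' 6) = 0)"
    proof
      assume "\<exists>nk ni ps rest. e 0 = table_code nk ni ps rest \<and>
          computes f [instance_code nk ni ps rest (e 0)] 0"
      then obtain nk ni ps rest where 1: "e 0 = table_code nk ni ps rest"
        "computes f [instance_code nk ni ps rest (e 0)] 0" by blast
      define e' where "e' = e(1 := nk, 2 := ni, 3 := list_encode ps, 4 := list_encode rest,
        5 := instance_code nk ni ps rest (e 0), 6 := 0)"
      have e': "e' 0 = e 0" "e' 1 = nk" "e' 2 = ni" "e' 3 = list_encode ps" "e' 4 = list_encode rest"
        "e' 5 = instance_code nk ni ps rest (e 0)" "e' 6 = 0" "\<forall>x. x \<notin> set [1..<7] \<longrightarrow> e' x = e x"
        by (auto simp: e'_def)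
      show "\<exists>e'. (\<forall>x. x \<notin> set [1..<7] \<longrightarrow> e' x = e x) \<and>
         (e' 5 = ?c e' \<and> e' 0 = list_encode [e' 1, e' 2, e' 3, e' 4]) \<and>
         computes f (map e' [5]) (e' 6) \<and> int (e' 6) = 0"
        by (intro exI[of _ e'] conjI)
          (use 1 e'(8) in \<open>simp_all only: e' list_encode_inverse list.map table_code_def instance_code_def
            row_codes_def Let_def of_nat_0\<close>)
    next
      assume "\<exists>e'. (\<forall>x. x \<notin> set [1..<7] \<longrightarrow> e' x = e x) \<and>
       (e' 5 = ?c e' \<and> e' 0 = list_encode [e' 1, e' 2, e' 3, e' 4]) \<and>
       computes f (map e' [5]) (e' 6) \<and> int (e' 6) = 0"
      then obtain e' where *: "\<forall>x. x \<notin> set [1..<7] \<longrightarrow> e' x = e x"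
        "e' 5 = ?c e' \<and> e' 0 = list_encode [e' 1, e' 2, e' 3, e' 4]"
        "computes f (map e' [5]) (e' 6) \<and> int (e' 6) = 0" by blast
      note e' = *(1) conjunct1[OF *(2)] conjunct2[OF *(2)]
      have e'': "computes f [e' 5] 0" using *(3) by auto
      have "e' 0 = e 0" using e'(1) by simp
      moreover have "e' 5 = instance_code (e' 1) (e' 2) (list_decode (e' 3)) (list_decode (e' 4)) (e' 0)"
        unfolding instance_code_def row_codes_def Let_def by (rule e'(2))
      moreover have "e' 0 = table_code (e' 1) (e' 2) (list_decode (e' 3)) (list_decode (e' 4))"
        unfolding table_code_def list_decode_inverse by (rule e'(3))
      ultimately show "\<exists>nk ni ps rest. e 0 = table_code nk ni ps rest \<and>
          computes f [instance_code nk ni ps rest (e 0)] 0"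
        using e'' by metis
    qed
  qed auto
qed

lemma table_code_inject:
  "table_code nk ni ps rest = table_code nk' ni' ps' rest' \<longleftrightarrow>
    nk = nk' \<and> ni = ni' \<and> ps = ps' \<and> rest = rest'"
  by (simp add: table_code_def list_encode_eq del: list_encode.simps)

text \<open>
  A weighted automaton with states \<open>{..<d}\<close> over the alphabet \<open>{..<A}\<close>: \<open>M l\<close> is the matrix of the
  letter \<open>l\<close>, and \<open>G i w\<close> is the weight of \<open>w\<close> when started in \<open>i\<close>; the final weights are \<open>G i []\<close>.
\<close>

definition linear_family :: "nat \<Rightarrow> nat \<Rightarrow> (nat \<Rightarrow> nat \<Rightarrow> nat \<Rightarrow> int) \<Rightarrow> (nat \<Rightarrow> nat list \<Rightarrow> int) \<Rightarrow> bool" where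
  "linear_family A d M G \<longleftrightarrow>
     (\<forall>i<d. \<forall>l<A. \<forall>w. G i (l # w) = (\<Sum>j<d. M l i j * G j w))"

lemma lspan_index:
  fixes k d :: nat
  assumes f: "f \<in> lspan S" and fin: "finite S" and G: "bij_betw G {k..<d} S"
  shows "\<exists>c. \<forall>x. f x = (\<Sum>j<d. c j * G j x)"
proof -
  obtain c where c: "f = (\<lambda>x. \<Sum>s\<in>S. c s * s x)" using lspan_finite[OF f fin] by blast
  have "f x = (\<Sum>j<d. (if k \<le> j then c (G j) else 0) * G j x)" for x
  proof -
    have "f x = (\<Sum>j\<in>{k..<d}. c (G j) * G j x)"
      unfolding c by (rule sum.reindex_bij_betw[OF G, of "\<lambda>s. c s * s x", symmetric])
    also have "\<dots> = (\<Sum>j<d. (if k \<le> j then c (G j) else 0) * G j x)"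
      by (rule sum.mono_neutral_cong_left) auto
    finally show ?thesis .
  qed
  then show ?thesis by (intro exI[of _ "\<lambda>j. if k \<le> j then c (G j) else 0"]) blast
qed

text \<open>
  With \<open>G 0 = 1 - E - g\<^sup>2\<close>, \<open>G 1 = 2 g\<close> and \<open>G 2 = 1\<close>, the combination is \<open>1 - E - (g - n)\<^sup>2\<close>. It is
  integral, hence positive only if both \<open>E\<close> and \<open>g - n\<close> vanish.
\<close>

lemma ex_linear_family:
  fixes P :: "nat \<Rightarrow> bool"
  assumes "listable {0} (\<lambda>e. P (e 0))"
  obtains A d M G where "linear_family A d M G" "0 < A" "3 \<le> d"
    "\<And>n. P n \<longleftrightarrow> (\<exists>w\<in>lists {..<A}. 0 < G 0 w + int n * G 1 w - int n * int n * G 2 w)"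
proof -
  obtain E g where g: "finite {0::nat}" "recognizable E" "\<forall>w. 0 \<le> E w"
      "\<forall>i\<in>{0}. recognizable (g i)" "\<forall>i\<in>{0}. \<forall>w. 0 \<le> g i w"
      "\<forall>e. P (e 0) \<longleftrightarrow> (\<exists>w. E w = 0 \<and> (\<forall>i\<in>{0::nat}. g i w = int (e i)))"
    by (rule listableE[OF assms])
  have 1: "recognizable E" "\<forall>w. 0 \<le> E w" "recognizable (g 0)"
      "\<forall>e. P (e 0) \<longleftrightarrow> (\<exists>w. E w = 0 \<and> g 0 w = int (e (0::nat)))"
    using g by simp_all
  have P: "P n \<longleftrightarrow> (\<exists>w. E w = 0 \<and> g 0 w = int n)" for n
    using 1(4)[rule_format, of "\<lambda>_. n"] by simp
  define F where "F w = 1 - E w - (g 0 w)\<^sup>2" for w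
  define H where "H w = 2 * g 0 w" for w
  have "recognizable F" "recognizable H" unfolding F_def H_def
    by (intro recognizable_diff recognizable_const recognizable_power2 recognizable_scale 1)+
  then obtain A S where S: "stable A S" "F \<in> lspan S" "H \<in> lspan S" by (rule recognizable_common)
  obtain B T where T: "stable B T" "(\<lambda>_. 1) \<in> lspan T"
    using recognizable_const[of 1] unfolding recognizable_def by blast
  define C U where C_U: "C = Suc (max A B)" "U = S \<union> T"
  have "stable (max A B) U" unfolding C_U by (rule stable_Un[OF S(1) T(1)])
  then have "stable C U"
    unfolding stable_def C_U(1) by (meson Suc_leD)
  moreover have "F \<in> lspan U" "H \<in> lspan U" "(\<lambda>_. 1) \<in> lspan U"
    unfolding C_U using S T lspan_mono by blast+
  ultimately have U: "stable C U" "F \<in> lspan U" "H \<in> lspan U" "(\<lambda>_. 1) \<in> lspan U" .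
  have fin: "finite U" using U(1) by (simp add: stable_def)
  obtain h where h: "bij_betw h {..<card U} U"
    using ex_bij_betw_nat_finite[OF fin] by (auto simp: atLeast0LessThan)
  define d where "d = 3 + card U"
  define G where "G i = (if i = 0 then F else if i = 1 then H else if i = 2 then (\<lambda>_. 1) else h (i - 3))" for i
  have "bij_betw (h \<circ> (\<lambda>i. i - 3)) {3..<d} U"
  proof (rule bij_betw_trans[OF _ h])
    show "bij_betw (\<lambda>i. i - 3) {3..<d} {..<card U}"
      by (rule bij_betw_byWitness[where f' = "\<lambda>i. i + 3"]) (auto simp: d_def)
  qed
  moreover have "bij_betw (h \<circ> (\<lambda>i. i - 3)) {3..<d} U = bij_betw G {3..<d} U"
    by (rule bij_betw_cong) (simp add: G_def)
  ultimately have bij: "bij_betw G {3..<d} U" by simp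
  have GU: "G i \<in> lspan U" if "i < d" for i
  proof (cases "i < 3")
    case True
    then have "i = 0 \<or> i = 1 \<or> i = 2" by auto
    then show ?thesis using U(2-4) by (auto simp: G_def)
  next
    case False
    then have "G i \<in> U" using that bij_betwE[OF bij] by auto
    then show ?thesis by (rule lspan_base)
  qed
  have "\<forall>l i. \<exists>c. i < d \<longrightarrow> (\<forall>w. G i (l # w) = (\<Sum>j<d. c j * G j w))"
    using lspan_index[OF stable_shift[OF U(1) GU] fin bij] by blast
  then obtain M where M: "\<And>l i w. i < d \<Longrightarrow> G i (l # w) = (\<Sum>j<d. M l i j * G j w)" by metis
  define K where "K n w = G 0 w + int n * G 1 w - int n * int n * G 2 w" for n w
  have K: "K n w = 1 - E w - (g 0 w - int n)\<^sup>2" for n w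
    by (simp add: K_def G_def F_def H_def power2_eq_square algebra_simps)
  have K_pos: "0 < K n w \<longleftrightarrow> E w = 0 \<and> g 0 w = int n" for n w
  proof
    assume "0 < K n w"
    moreover have "0 \<le> (g 0 w - int n)\<^sup>2" by simp
    ultimately have "E w = 0" "(g 0 w - int n)\<^sup>2 = 0" using 1(2)[rule_format, of w] unfolding K by linarith+
    then show "E w = 0 \<and> g 0 w = int n" by simp
  qed (simp add: K)
  have ignore: "f (filter (\<lambda>l. l < C) w) = f w" if "f \<in> lspan U" for f w
    using that
  proof (induction w arbitrary: f)
    case (Cons l w)
    show ?case
    proof (cases "l < C")
      case True
      then show ?thesis using Cons.IH[OF stable_shift[OF U(1) Cons.prems, of l]] by simp
    next
      case False
      then show ?thesis using Cons.IH[OF Cons.prems] stable_ignore[OF U(1) Cons.prems, of l w] by simp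
    qed
  qed simp
  have G_ignore: "G i (filter (\<lambda>l. l < C) w) = G i w" if "i < d" for i w
    by (rule ignore[OF GU[OF that]])
  have K_ignore: "K n (filter (\<lambda>l. l < C) w) = K n w" for n w
    unfolding K_def by (subst G_ignore, simp add: d_def)+ rule
  show ?thesis
  proof (rule that[of C d M G])
    show "linear_family C d M G" using M by (simp add: linear_family_def)
    show "0 < C" by (simp add: C_U(1))
    show "3 \<le> d" by (simp add: d_def)
    fix n
    show "P n \<longleftrightarrow> (\<exists>w\<in>lists {..<C}. 0 < G 0 w + int n * G 1 w - int n * int n * G 2 w)"
      unfolding K_def[symmetric]
    proof
      assume "P n"
      then obtain w where "0 < K n w" using P K_pos by blast
      then show "\<exists>w\<in>lists {..<C}. 0 < K n w"
        using K_ignore[of n w] by (intro bexI[of _ "filter (\<lambda>l. l < C) w"]) auto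
    qed (use P K_pos in blast)
  qed
qed

section \<open>Markov blind MDPs are ergodic\<close>

text \<open>
  A stochastic matrix that has a column with entries at least \<open>c\<close> shrinks the oscillation of
  functions on the states by the factor \<open>1 - c\<close>.
\<close>

lemma stochastic_contraction:
  fixes P :: "'k \<Rightarrow> 'k \<Rightarrow> real"
  assumes "finite K" "z \<in> K" "k \<in> K" "l \<in> K"
    and nonneg: "\<And>k k'. k \<in> K \<Longrightarrow> k' \<in> K \<Longrightarrow> 0 \<le> P k k'"
    and stoch: "\<And>k. k \<in> K \<Longrightarrow> (\<Sum>k'\<in>K. P k k') = 1"
    and col: "\<And>k. k \<in> K \<Longrightarrow> c \<le> P k z" and "0 \<le> c"
    and osc: "\<And>x y. x \<in> K \<Longrightarrow> y \<in> K \<Longrightarrow> f x - f y \<le> s"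
  shows "(\<Sum>x\<in>K. P k x * f x) - (\<Sum>x\<in>K. P l x * f x) \<le> (1 - c) * s"
proof -
  define Q where "Q k x = P k x - (if x = z then c else 0)" for k x
  have Q: "0 \<le> Q k x" if "k \<in> K" "x \<in> K" for k x
    using nonneg[OF that] col[OF that(1)] by (simp add: Q_def)
  have Q_sum: "(\<Sum>x\<in>K. Q k x) = 1 - c" if "k \<in> K" for k
    using stoch[OF that] assms(1,2) by (simp add: Q_def sum_subtractf)
  have P: "(\<Sum>x\<in>K. P k x * f x) = c * f z + (\<Sum>x\<in>K. Q k x * f x)" for k
    using assms(1,2)
    by (simp add: Q_def left_diff_distrib sum_subtractf if_distrib[of "\<lambda>y. y * _"] cong: if_cong)
  define m where "m = Min (f ` K)"
  have "m \<in> f ` K" unfolding m_def using assms by (intro Min_in) auto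
  then obtain y where y: "y \<in> K" "f y = m" by auto
  have m: "m \<le> f x" "f x \<le> m + s" if "x \<in> K" for x
    using osc[OF that y(1)] y(2) that assms(1) by (auto simp: m_def)
  have "(\<Sum>x\<in>K. Q k x * f x) \<le> (\<Sum>x\<in>K. Q k x * (m + s))"
    by (intro sum_mono mult_left_mono m Q assms)
  also have "\<dots> = (1 - c) * (m + s)" using Q_sum[OF \<open>k \<in> K\<close>] by (simp flip: sum_distrib_right)
  finally have 1: "(\<Sum>x\<in>K. Q k x * f x) \<le> (1 - c) * (m + s)" .
  have "(\<Sum>x\<in>K. Q l x * m) \<le> (\<Sum>x\<in>K. Q l x * f x)"
    by (intro sum_mono mult_left_mono m Q assms)
  moreover have "(\<Sum>x\<in>K. Q l x * m) = (1 - c) * m"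
    using Q_sum[OF \<open>l \<in> K\<close>] by (simp flip: sum_distrib_right)
  ultimately show ?thesis using 1 unfolding P by (simp add: algebra_simps)
qed

lemma set_trans:
  assumes "blind_stochastic_game \<Gamma>" "k \<in> states \<Gamma>" "a \<in> acts1 \<Gamma> \<times> acts2 \<Gamma>"
  shows "set_pmf (trans \<Gamma> k (fst a) (snd a)) \<subseteq> states \<Gamma>"
proof -
  from assms(1) have "\<forall>k\<in>states \<Gamma>. \<forall>i\<in>acts1 \<Gamma>. \<forall>j\<in>acts2 \<Gamma>.
      trans \<Gamma> k i j \<in> distributions (states \<Gamma>) \<and> reward \<Gamma> k i j \<in> {0..1}"
    unfolding blind_stochastic_game_def by (elim conjE)
  from bspec[OF bspec[OF bspec[OF this assms(2)], of "fst a"], of "snd a"]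
  have "trans \<Gamma> k (fst a) (snd a) \<in> distributions (states \<Gamma>)"
    using assms(3) by (simp add: mem_Times_iff)
  then show ?thesis by (simp add: distributions_def)
qed

lemma transition_matrix_stochastic:
  assumes "blind_stochastic_game \<Gamma>" "a \<in> acts1 \<Gamma> \<times> acts2 \<Gamma>" "k \<in> states \<Gamma>"
  shows "(\<Sum>k'\<in>states \<Gamma>. transition_matrix \<Gamma> a k k') = 1"
proof -
  have "finite (states \<Gamma>)" using assms(1) by (simp add: blind_stochastic_game_def)
  from sum_pmf_eq_1[OF this set_trans[OF assms(1,3,2)]] show ?thesis
    by (simp add: transition_matrix_def case_prod_beta)
qed

lemma transition_matrix_nonneg: "0 \<le> transition_matrix \<Gamma> a k k'"
  by (cases a) (simp add: transition_matrix_def)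

lemma markov_blind_MDP_imp_ergodic:
  assumes "markov_blind_MDP \<Gamma>"
  shows "ergodic_game \<Gamma>"
proof -
  define K where "K = states \<Gamma>"
  define A where "A = acts1 \<Gamma> \<times> acts2 \<Gamma>"
  define P where "P = transition_matrix \<Gamma>"
  have game: "blind_stochastic_game \<Gamma>" and markov: "\<forall>a\<in>A. \<exists>z\<in>K. \<forall>k\<in>K. 0 < P a k z"
    using assms by (auto simp: markov_blind_MDP_def blind_MDP_def markov_matrix_def A_def K_def P_def)
  have fin: "finite K" "K \<noteq> {}" "finite A" "A \<noteq> {}"
    using game by (auto simp: blind_stochastic_game_def K_def A_def)
  obtain z where z: "\<And>a. a \<in> A \<Longrightarrow> z a \<in> K" "\<And>a k. a \<in> A \<Longrightarrow> k \<in> K \<Longrightarrow> 0 < P a k (z a)"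
    using markov by metis
  define c where "c = Min ((\<lambda>(a, k). P a k (z a)) ` (A \<times> K))"
  have "c \<in> (\<lambda>(a, k). P a k (z a)) ` (A \<times> K)"
    unfolding c_def using fin by (intro Min_in) auto
  then have c_pos: "0 < c" using z by auto
  have c: "c \<le> P a k (z a)" if "a \<in> A" "k \<in> K" for a k
    unfolding c_def using fin that by (intro Min_le) auto
  have nonneg: "0 \<le> P a k k'" for a k k' unfolding P_def by (rule transition_matrix_nonneg)
  have stoch: "(\<Sum>k'\<in>K. P a k k') = 1" if "a \<in> A" "k \<in> K" for a k
    unfolding P_def K_def by (rule transition_matrix_stochastic[OF game]) (use that in \<open>auto simp: A_def K_def\<close>)
  obtain a0 k0 where "a0 \<in> A" "k0 \<in> K" using fin by auto
  then have "c \<le> P a0 k0 (z a0)" by (rule c)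
  also have "\<dots> \<le> (\<Sum>x\<in>K. P a0 k0 x)"
    by (rule member_le_sum) (use z(1)[OF \<open>a0 \<in> A\<close>] nonneg fin in simp_all)
  also have "\<dots> = 1" by (rule stoch) fact+
  finally have "c \<le> 1" .
  define T where "T = transition_product \<Gamma>"
  have osc: "(\<Sum>x\<in>K. T as k x * f x) - (\<Sum>x\<in>K. T as l x * f x) \<le> 2 * (1 - c) ^ length as"
    if "as \<in> lists A" "k \<in> K" "l \<in> K" "\<And>x. x \<in> K \<Longrightarrow> \<bar>f x\<bar> \<le> 1" for as k l f
    using that(1-3)
  proof (induction as arbitrary: k l)
    case Nil
    have "(\<Sum>x\<in>K. T [] k x * f x) = f k" if "k \<in> K" for k
      using that fin by (simp add: T_def if_distrib[of "\<lambda>y. y * _"] cong: if_cong)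
    moreover have "\<bar>f k\<bar> \<le> 1" "\<bar>f l\<bar> \<le> 1" using Nil \<open>\<And>x. x \<in> K \<Longrightarrow> \<bar>f x\<bar> \<le> 1\<close> by auto
    ultimately show ?case using Nil by auto
  next
    case (Cons a as)
    have eq: "(\<Sum>x\<in>K. T (a # as) k x * f x) = (\<Sum>y\<in>K. P a k y * (\<Sum>x\<in>K. T as y x * f x))" for k
      by (simp add: T_def P_def K_def sum_distrib_left sum_distrib_right mult.assoc) (rule sum.swap)
    have "(\<Sum>y\<in>K. P a k y * (\<Sum>x\<in>K. T as y x * f x)) - (\<Sum>y\<in>K. P a l y * (\<Sum>x\<in>K. T as y x * f x))
        \<le> (1 - c) * (2 * (1 - c) ^ length as)"
      by (rule stochastic_contraction[of K "z a"]) (use Cons z c c_pos nonneg stoch fin in auto)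
    then show ?case unfolding eq by simp
  qed
  have tau: "tau1 K (T as) \<le> (1 - c) ^ length as" if "as \<in> lists A" for as
  proof -
    have "(\<Sum>x\<in>K. \<bar>T as k x - T as l x\<bar>) \<le> 2 * (1 - c) ^ length as" if "k \<in> K" "l \<in> K" for k l
    proof -
      have "(\<Sum>x\<in>K. \<bar>T as k x - T as l x\<bar>) =
          (\<Sum>x\<in>K. T as k x * sgn (T as k x - T as l x)) - (\<Sum>x\<in>K. T as l x * sgn (T as k x - T as l x))"
        \<comment> \<open>The total variation is attained by testing with the sign of the difference of the rows.\<close>
        by (simp add: sum_subtractf[symmetric] left_diff_distrib[symmetric] abs_sgn)
      also have "\<dots> \<le> 2 * (1 - c) ^ length as"
        by (rule osc) (use \<open>as \<in> lists A\<close> that in \<open>auto simp: sgn_if\<close>)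
      finally show ?thesis .
    qed
    then have "Max ((\<lambda>(k, l). \<Sum>k'\<in>K. \<bar>T as k k' - T as l k'\<bar>) ` (K \<times> K)) \<le> 2 * (1 - c) ^ length as"
      using fin by (subst Max_le_iff) auto
    then show ?thesis by (simp add: tau1_def)
  qed
  show ?thesis
    unfolding ergodic_game_def
  proof (intro conjI allI impI game)
    fix e :: real assume "0 < e"
    have "(\<lambda>n. (1 - c) ^ n) \<longlonglongrightarrow> 0" by (rule LIMSEQ_power_zero) (use c_pos \<open>c \<le> 1\<close> in auto)
    then obtain n0 where n0: "\<And>n. n \<ge> n0 \<Longrightarrow> (1 - c) ^ n < e"
      using \<open>0 < e\<close> order_tendstoD(2)[of _ 0 sequentially e] by (auto simp: eventually_sequentially)
    show "\<exists>n0. \<forall>n\<ge>n0. \<forall>as\<in>lists (acts1 \<Gamma> \<times> acts2 \<Gamma>). length as = n \<longrightarrow>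
        tau1 (states \<Gamma>) (transition_product \<Gamma> as) \<le> e"
      unfolding A_def[symmetric] K_def[symmetric] T_def[symmetric]
    proof (intro exI[of _ n0] allI impI ballI)
      fix n as assume "n0 \<le> n" "as \<in> lists A" "length as = n"
      then show "tau1 K (T as) \<le> e" using tau[of as] n0[of n] by simp
    qed
  qed
qed

section \<open>Payoffs along action sequences\<close>

text \<open>
  The players' belief about the state after observing an action pair.
\<close>

definition next_belief :: "('k, 'i, 'j) game \<Rightarrow> 'k pmf \<Rightarrow> 'i \<times> 'j \<Rightarrow> 'k pmf" where
  "next_belief \<Gamma> b a = bind_pmf b (\<lambda>k. trans \<Gamma> k (fst a) (snd a))"

text \<open>
  Expected stage reward under a belief.
\<close>

definition belief_reward :: "('k, 'i, 'j) game \<Rightarrow> 'k pmf \<Rightarrow> 'i \<times> 'j \<Rightarrow> real" where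
  "belief_reward \<Gamma> b a = measure_pmf.expectation b (\<lambda>k. reward \<Gamma> k (fst a) (snd a))"

text \<open>
  Expected sum of the stage rewards when the action pairs \<open>as\<close> are played.
\<close>

primrec total_reward :: "('k, 'i, 'j) game \<Rightarrow> 'k pmf \<Rightarrow> ('i \<times> 'j) list \<Rightarrow> real" where
  "total_reward \<Gamma> b [] = 0"
| "total_reward \<Gamma> b (a # as) = belief_reward \<Gamma> b a + total_reward \<Gamma> (next_belief \<Gamma> b a) as"

lemma total_reward_snoc:
  "total_reward \<Gamma> b (as @ [a]) = total_reward \<Gamma> b as + belief_reward \<Gamma> (foldl (next_belief \<Gamma>) b as) a"
  by (induction as arbitrary: b) auto

text \<open>
  The law of the observed history. As nothing about the states is observed, it depends on the
  strategies only.
\<close>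

primrec history_law :: "(('i, 'j) history \<Rightarrow> 'i pmf) \<Rightarrow> (('i, 'j) history \<Rightarrow> 'j pmf) \<Rightarrow> nat \<Rightarrow>
    ('i, 'j) history pmf" where
  "history_law \<sigma> \<pi> 0 = return_pmf []"
| "history_law \<sigma> \<pi> (Suc m) =
     bind_pmf (history_law \<sigma> \<pi> m) (\<lambda>h. map_pmf (\<lambda>a. h @ [a]) (pair_pmf (\<sigma> h) (\<pi> h)))"

lemma play_Suc_pair:
  "play \<Gamma> b \<sigma> \<pi> (Suc m) =
     bind_pmf (play \<Gamma> b \<sigma> \<pi> m) (\<lambda>x.
     bind_pmf (pair_pmf (\<sigma> (map snd (fst x))) (\<pi> (map snd (fst x)))) (\<lambda>a.
     map_pmf (\<lambda>k'. (fst x @ [(snd x, a)], k')) (trans \<Gamma> (snd x) (fst a) (snd a))))"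
  unfolding play.simps
  by (rule bind_pmf_cong[OF refl]) (simp add: pair_pmf_def bind_assoc_pmf bind_return_pmf case_prod_beta)

text \<open>
  Conditionally on the observed history, the current state is distributed according to the belief.
\<close>

lemma play_observed:
  "map_pmf (\<lambda>x. (map snd (fst x), snd x)) (play \<Gamma> b \<sigma> \<pi> m) =
     bind_pmf (history_law \<sigma> \<pi> m) (\<lambda>h. map_pmf (Pair h) (foldl (next_belief \<Gamma>) b h))"
proof (induction m)
  case 0
  show ?case by (simp add: map_pmf_comp bind_return_pmf)
next
  case (Suc m)
  have "map_pmf (\<lambda>x. (map snd (fst x), snd x)) (play \<Gamma> b \<sigma> \<pi> (Suc m)) =
    bind_pmf (map_pmf (\<lambda>x. (map snd (fst x), snd x)) (play \<Gamma> b \<sigma> \<pi> m)) (\<lambda>x.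
     bind_pmf (pair_pmf (\<sigma> (fst x)) (\<pi> (fst x))) (\<lambda>a.
     map_pmf (Pair (fst x @ [a])) (trans \<Gamma> (snd x) (fst a) (snd a))))"
    unfolding play_Suc_pair by (simp add: map_bind_pmf map_pmf_comp bind_map_pmf)
  also have "\<dots> = bind_pmf (history_law \<sigma> \<pi> m) (\<lambda>h. bind_pmf (foldl (next_belief \<Gamma>) b h) (\<lambda>k.
      bind_pmf (pair_pmf (\<sigma> h) (\<pi> h)) (\<lambda>a. map_pmf (Pair (h @ [a])) (trans \<Gamma> k (fst a) (snd a)))))"
    unfolding Suc.IH by (simp add: bind_assoc_pmf bind_map_pmf)
  also have "\<dots> = bind_pmf (history_law \<sigma> \<pi> m) (\<lambda>h. bind_pmf (pair_pmf (\<sigma> h) (\<pi> h)) (\<lambda>a.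
      bind_pmf (foldl (next_belief \<Gamma>) b h) (\<lambda>k. map_pmf (Pair (h @ [a])) (trans \<Gamma> k (fst a) (snd a)))))"
    by (subst bind_commute_pmf) (rule refl)
  also have "\<dots> = bind_pmf (history_law \<sigma> \<pi> (Suc m)) (\<lambda>h. map_pmf (Pair h) (foldl (next_belief \<Gamma>) b h))"
    by (simp add: bind_assoc_pmf bind_map_pmf next_belief_def map_bind_pmf)
  finally show ?case .
qed

lemma expectation_bind_finite:
  fixes h :: "'b \<Rightarrow> real"
  assumes "finite (set_pmf p)" "\<And>x. x \<in> set_pmf p \<Longrightarrow> finite (set_pmf (f x))"
  shows "measure_pmf.expectation (bind_pmf p f) h =
    measure_pmf.expectation p (\<lambda>x. measure_pmf.expectation (f x) h)"
  using assms by (subst pmf_expectation_bind[of "set_pmf p"]) (auto simp: integral_measure_pmf)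

lemma expectation_cong_set_pmf:
  fixes f g :: "'a \<Rightarrow> real"
  shows "(\<And>x. x \<in> set_pmf p \<Longrightarrow> f x = g x) \<Longrightarrow> measure_pmf.expectation p f = measure_pmf.expectation p g"
  by (intro integral_cong_AE) (auto simp: AE_measure_pmf_iff)

lemma expectation_add_finite:
  fixes f g :: "'a \<Rightarrow> real"
  assumes "finite (set_pmf p)"
  shows "measure_pmf.expectation p (\<lambda>x. f x + g x) =
    measure_pmf.expectation p f + measure_pmf.expectation p g"
  using assms by (intro Bochner_Integration.integral_add integrable_measure_pmf_finite)

lemma game_finite:
  assumes "blind_stochastic_game \<Gamma>"
  shows "finite (states \<Gamma>)" "finite (acts1 \<Gamma>)" "finite (acts2 \<Gamma>)"
  using assms by (simp_all add: blind_stochastic_game_def)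

lemma set_strategies:
  assumes "\<sigma> \<in> strategies1 \<Gamma>" "\<pi> \<in> strategies2 \<Gamma>" "h \<in> histories \<Gamma>"
  shows "set_pmf (pair_pmf (\<sigma> h) (\<pi> h)) \<subseteq> acts1 \<Gamma> \<times> acts2 \<Gamma>"
  using assms by (auto simp: strategies1_def strategies2_def distributions_def)

lemma finite_set_strategies:
  assumes "blind_stochastic_game \<Gamma>" "\<sigma> \<in> strategies1 \<Gamma>" "\<pi> \<in> strategies2 \<Gamma>" "h \<in> histories \<Gamma>"
  shows "finite (set_pmf (pair_pmf (\<sigma> h) (\<pi> h)))"
  by (rule finite_subset[OF set_strategies[OF assms(2-4)]]) (simp add: game_finite[OF assms(1)])

lemma set_history_law:
  assumes "\<sigma> \<in> strategies1 \<Gamma>" "\<pi> \<in> strategies2 \<Gamma>" "h \<in> set_pmf (history_law \<sigma> \<pi> m)"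
  shows "h \<in> histories \<Gamma> \<and> length h = m \<and> (\<forall>t<m. h ! t \<in> set_pmf (\<sigma> (take t h)) \<times> set_pmf (\<pi> (take t h)))"
  using assms(3)
proof (induction m arbitrary: h)
  case 0
  then show ?case by (simp add: histories_def)
next
  case (Suc m)
  then obtain g a where ga: "g \<in> set_pmf (history_law \<sigma> \<pi> m)" "a \<in> set_pmf (\<sigma> g) \<times> set_pmf (\<pi> g)" "h = g @ [a]"
    by auto
  note IH = Suc.IH[OF ga(1)]
  then have "a \<in> acts1 \<Gamma> \<times> acts2 \<Gamma>"
    using ga(2) assms(1,2) by (auto simp: strategies1_def strategies2_def distributions_def)
  then show ?case using IH ga by (auto simp: histories_def nth_append less_Suc_eq)
qed

lemma finite_set_history_law:
  assumes "blind_stochastic_game \<Gamma>" "\<sigma> \<in> strategies1 \<Gamma>" "\<pi> \<in> strategies2 \<Gamma>"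
  shows "finite (set_pmf (history_law \<sigma> \<pi> m))"
proof (rule finite_subset)
  show "set_pmf (history_law \<sigma> \<pi> m) \<subseteq> {h. set h \<subseteq> acts1 \<Gamma> \<times> acts2 \<Gamma> \<and> length h = m}"
  proof
    fix h assume "h \<in> set_pmf (history_law \<sigma> \<pi> m)"
    from set_history_law[OF assms(2,3) this]
    show "h \<in> {h. set h \<subseteq> acts1 \<Gamma> \<times> acts2 \<Gamma> \<and> length h = m}"
      unfolding histories_def lists_eq_set by simp
  qed
  show "finite {h. set h \<subseteq> acts1 \<Gamma> \<times> acts2 \<Gamma> \<and> length h = m}"
    using assms(1) by (intro finite_lists_length_eq) (simp add: blind_stochastic_game_def)
qed

lemma set_foldl_next_belief:
  assumes "blind_stochastic_game \<Gamma>" "b \<in> distributions (states \<Gamma>)" "h \<in> histories \<Gamma>"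
  shows "set_pmf (foldl (next_belief \<Gamma>) b h) \<subseteq> states \<Gamma>"
  using assms(2,3)
proof (induction h arbitrary: b)
  case (Cons a h)
  have "next_belief \<Gamma> b a \<in> distributions (states \<Gamma>)"
    using Cons.prems set_trans[OF assms(1), of _ a]
    by (auto simp: next_belief_def distributions_def histories_def)
  then show ?case using Cons by (simp add: histories_def)
qed (simp add: distributions_def)

lemma set_play:
  assumes "blind_stochastic_game \<Gamma>" "b \<in> distributions (states \<Gamma>)" "\<sigma> \<in> strategies1 \<Gamma>" "\<pi> \<in> strategies2 \<Gamma>"
    and "x \<in> set_pmf (play \<Gamma> b \<sigma> \<pi> m)"
  shows "map snd (fst x) \<in> histories \<Gamma> \<and> snd x \<in> states \<Gamma>"
proof -
  have "(map snd (fst x), snd x) \<in> set_pmf (bind_pmf (history_law \<sigma> \<pi> m)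
      (\<lambda>h. map_pmf (Pair h) (foldl (next_belief \<Gamma>) b h)))"
    unfolding play_observed[symmetric] using assms(5) by auto
  then have "map snd (fst x) \<in> set_pmf (history_law \<sigma> \<pi> m)"
    and 1: "snd x \<in> set_pmf (foldl (next_belief \<Gamma>) b (map snd (fst x)))" by auto
  then have h: "map snd (fst x) \<in> histories \<Gamma>" using set_history_law[OF assms(3,4)] by blast
  then show ?thesis using 1 set_foldl_next_belief[OF assms(1,2) h] by blast
qed

lemma finite_set_play:
  assumes "blind_stochastic_game \<Gamma>" "b \<in> distributions (states \<Gamma>)" "\<sigma> \<in> strategies1 \<Gamma>" "\<pi> \<in> strategies2 \<Gamma>"
  shows "finite (set_pmf (play \<Gamma> b \<sigma> \<pi> m))"
proof (induction m)
  case 0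
  have "finite (set_pmf b)"
    using assms(1,2) by (auto simp: blind_stochastic_game_def distributions_def intro: finite_subset)
  then show ?case by simp
next
  case (Suc m)
  have f1: "finite (set_pmf (pair_pmf (\<sigma> (map snd (fst x))) (\<pi> (map snd (fst x)))))"
    if "x \<in> set_pmf (play \<Gamma> b \<sigma> \<pi> m)" for x
    by (rule finite_set_strategies[OF assms(1,3,4)]) (use set_play[OF assms that] in simp)
  have f2: "finite (set_pmf (trans \<Gamma> (snd x) (fst a) (snd a)))"
    if x: "x \<in> set_pmf (play \<Gamma> b \<sigma> \<pi> m)"
      and a: "a \<in> set_pmf (pair_pmf (\<sigma> (map snd (fst x))) (\<pi> (map snd (fst x))))" for x a
    by (rule finite_subset[OF set_trans[OF assms(1)] game_finite(1)[OF assms(1)]])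
      (use set_play[OF assms x] set_strategies[OF assms(3,4), of "map snd (fst x)"] a in blast)+
  show ?case unfolding play_Suc_pair set_bind_pmf set_map_pmf
    by (intro finite_UN_I finite_imageI Suc.IH f1 f2)
qed

lemma expected_total_reward:
  assumes "blind_stochastic_game \<Gamma>" "b \<in> distributions (states \<Gamma>)" "\<sigma> \<in> strategies1 \<Gamma>" "\<pi> \<in> strategies2 \<Gamma>"
  shows "measure_pmf.expectation (play \<Gamma> b \<sigma> \<pi> m) (\<lambda>x. \<Sum>(k, i, j)\<leftarrow>fst x. reward \<Gamma> k i j) =
    measure_pmf.expectation (history_law \<sigma> \<pi> m) (total_reward \<Gamma> b)"
proof (induction m)
  case 0
  show ?case by simp
next
  case (Suc m)
  let ?S = "\<lambda>x. \<Sum>(k, i, j)\<leftarrow>fst x. reward \<Gamma> k i j"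
  let ?E = "\<lambda>p (f :: _ \<Rightarrow> real). measure_pmf.expectation p f"
  let ?p = "\<lambda>h. pair_pmf (\<sigma> h) (\<pi> h)"
  let ?r = "\<lambda>k a. reward \<Gamma> k (fst a) (snd a)"
  let ?P = "play \<Gamma> b \<sigma> \<pi> m" and ?H = "history_law \<sigma> \<pi> m"
  have finP: "finite (set_pmf (play \<Gamma> b \<sigma> \<pi> n))" for n by (rule finite_set_play[OF assms])
  have finH: "finite (set_pmf (history_law \<sigma> \<pi> n))" for n by (rule finite_set_history_law[OF assms(1,3,4)])
  have finp: "finite (set_pmf (?p h))" if "h \<in> histories \<Gamma>" for h
    by (rule finite_set_strategies[OF assms(1,3,4) that])
  have finB: "finite (set_pmf (foldl (next_belief \<Gamma>) b h))" if "h \<in> histories \<Gamma>" for h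
    by (rule finite_subset[OF set_foldl_next_belief[OF assms(1,2) that] game_finite(1)[OF assms(1)]])
  have Hh: "h \<in> histories \<Gamma>" if "h \<in> set_pmf (history_law \<sigma> \<pi> n)" for h n
    using set_history_law[OF assms(3,4) that] by simp
  have fin_tr: "finite (set_pmf (trans \<Gamma> (snd x) (fst a) (snd a)))"
    if x: "x \<in> set_pmf ?P" and a: "a \<in> set_pmf (?p (map snd (fst x)))" for x a
    by (rule finite_subset[OF set_trans[OF assms(1)] game_finite(1)[OF assms(1)]])
      (use set_play[OF assms x] set_strategies[OF assms(3,4), of "map snd (fst x)"] a in blast)+
  have Ph: "map snd (fst x) \<in> histories \<Gamma>" if "x \<in> set_pmf ?P" for x
    using set_play[OF assms that] by simp
  have "?E (play \<Gamma> b \<sigma> \<pi> (Suc m)) ?S = ?E ?P (\<lambda>x. ?E (?p (map snd (fst x))) (\<lambda>a. ?S x + ?r (snd x) a))"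
    unfolding play_Suc_pair
  proof (subst expectation_bind_finite[OF finP])
    fix x assume x: "x \<in> set_pmf ?P"
    let ?g = "\<lambda>a. map_pmf (\<lambda>k'. (fst x @ [(snd x, a)], k')) (trans \<Gamma> (snd x) (fst a) (snd a))"
    show fin: "finite (set_pmf (?p (map snd (fst x)) \<bind> ?g))"
      unfolding set_bind_pmf set_map_pmf by (intro finite_UN_I finite_imageI finp[OF Ph[OF x]] fin_tr[OF x])
  next
    show "?E ?P (\<lambda>x. ?E (?p (map snd (fst x)) \<bind>
        (\<lambda>a. map_pmf (\<lambda>k'. (fst x @ [(snd x, a)], k')) (trans \<Gamma> (snd x) (fst a) (snd a)))) ?S) =
      ?E ?P (\<lambda>x. ?E (?p (map snd (fst x))) (\<lambda>a. ?S x + ?r (snd x) a))"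
    proof (rule expectation_cong_set_pmf)
      fix x assume x: "x \<in> set_pmf ?P"
      show "?E (?p (map snd (fst x)) \<bind>
          (\<lambda>a. map_pmf (\<lambda>k'. (fst x @ [(snd x, a)], k')) (trans \<Gamma> (snd x) (fst a) (snd a)))) ?S =
        ?E (?p (map snd (fst x))) (\<lambda>a. ?S x + ?r (snd x) a)"
        using finp[OF Ph[OF x]] fin_tr[OF x]
        by (subst expectation_bind_finite) (simp_all add: case_prod_beta del: set_pair_pmf)
    qed
  qed
  also have "\<dots> = ?E ?P (\<lambda>x. ?S x + ?E (?p (map snd (fst x))) (?r (snd x)))"
    by (rule expectation_cong_set_pmf, subst expectation_add_finite[OF finp[OF Ph]]) simp_all
  also have "\<dots> = ?E ?P ?S + ?E ?P (\<lambda>x. ?E (?p (map snd (fst x))) (?r (snd x)))"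
    by (rule expectation_add_finite[OF finP])
  also have "?E ?P (\<lambda>x. ?E (?p (map snd (fst x))) (?r (snd x))) =
      ?E (map_pmf (\<lambda>x. (map snd (fst x), snd x)) ?P) (\<lambda>y. ?E (?p (fst y)) (?r (snd y)))"
    by simp
  also have "\<dots> = ?E ?H (\<lambda>h. ?E (foldl (next_belief \<Gamma>) b h) (\<lambda>k. ?E (?p h) (?r k)))"
    unfolding play_observed by (subst expectation_bind_finite[OF finH]) (use finB[OF Hh] in simp_all)
  also have "\<dots> = ?E ?H (\<lambda>h. ?E (?p h) (belief_reward \<Gamma> (foldl (next_belief \<Gamma>) b h)))"
  proof (intro expectation_cong_set_pmf)
    fix h assume "h \<in> set_pmf ?H"
    then have fin: "finite (set_pmf (?p h))" "finite (set_pmf (foldl (next_belief \<Gamma>) b h))"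
      using Hh finp finB by blast+
    let ?q = "foldl (next_belief \<Gamma>) b h"
    have "?E ?q (\<lambda>k. ?E (?p h) (?r k)) =
        (\<Sum>k\<in>set_pmf ?q. \<Sum>a\<in>set_pmf (?p h). pmf ?q k * (pmf (?p h) a * ?r k a))"
      using fin by (simp add: integral_measure_pmf[of "set_pmf ?q"] integral_measure_pmf[of "set_pmf (?p h)"]
          sum_distrib_left del: set_pair_pmf)
    also have "\<dots> = (\<Sum>a\<in>set_pmf (?p h). \<Sum>k\<in>set_pmf ?q. pmf (?p h) a * (pmf ?q k * ?r k a))"
      by (subst sum.swap) (simp add: mult.left_commute)
    also have "\<dots> = ?E (?p h) (belief_reward \<Gamma> ?q)"
      using fin by (simp add: belief_reward_def integral_measure_pmf[of "set_pmf ?q"]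
          integral_measure_pmf[of "set_pmf (?p h)"] sum_distrib_left del: set_pair_pmf)
    finally show "?E ?q (\<lambda>k. ?E (?p h) (?r k)) = ?E (?p h) (belief_reward \<Gamma> ?q)" .
  qed
  also have "?E ?P ?S + \<dots> = ?E ?H (\<lambda>h. total_reward \<Gamma> b h + ?E (?p h) (belief_reward \<Gamma> (foldl (next_belief \<Gamma>) b h)))"
    unfolding Suc.IH by (rule expectation_add_finite[OF finH, symmetric])
  also have "\<dots> = ?E ?H (\<lambda>h. ?E (?p h) (\<lambda>a. total_reward \<Gamma> b (h @ [a])))"
    unfolding total_reward_snoc
    by (rule expectation_cong_set_pmf, subst expectation_add_finite[OF finp[OF Hh]]) simp_all
  also have "\<dots> = ?E (history_law \<sigma> \<pi> (Suc m)) (total_reward \<Gamma> b)"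
    unfolding history_law.simps
    by (subst expectation_bind_finite[OF finH]) (use finp[OF Hh] in \<open>simp_all del: set_pair_pmf\<close>)
  finally show ?case .
qed

text \<open>
  Bounds for the mean payoff thus reduce to bounds along deterministic action sequences.
\<close>

lemma mean_payoff_bounds:
  assumes "blind_stochastic_game \<Gamma>" "b \<in> distributions (states \<Gamma>)" "\<sigma> \<in> strategies1 \<Gamma>" "\<pi> \<in> strategies2 \<Gamma>"
    and "0 < N"
    and bounds: "\<And>h. h \<in> set_pmf (history_law \<sigma> \<pi> N) \<Longrightarrow> lo \<le> total_reward \<Gamma> b h \<and> total_reward \<Gamma> b h \<le> hi"
  shows "lo / N \<le> mean_payoff \<Gamma> b \<sigma> \<pi> N" "mean_payoff \<Gamma> b \<sigma> \<pi> N \<le> hi / N"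
proof -
  have eq: "mean_payoff \<Gamma> b \<sigma> \<pi> N =
      1 / N * measure_pmf.expectation (history_law \<sigma> \<pi> N) (total_reward \<Gamma> b)"
    unfolding mean_payoff_def expected_total_reward[OF assms(1-4), symmetric]
    unfolding integral_mult_right_zero[symmetric]
    by (rule expectation_cong_set_pmf) (simp only: case_prod_beta)
  let ?E = "measure_pmf.expectation (history_law \<sigma> \<pi> N) (total_reward \<Gamma> b)"
  have int: "integrable (measure_pmf (history_law \<sigma> \<pi> N)) f" for f :: "_ \<Rightarrow> real"
    by (rule integrable_measure_pmf_finite[OF finite_set_history_law[OF assms(1,3,4)]])
  have "lo \<le> ?E" "?E \<le> hi"
    using bounds by (auto intro!: measure_pmf.integral_ge_const measure_pmf.integral_le_const int
        simp: AE_measure_pmf_iff)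
  then show "lo / N \<le> mean_payoff \<Gamma> b \<sigma> \<pi> N" "mean_payoff \<Gamma> b \<sigma> \<pi> N \<le> hi / N"
    unfolding eq using \<open>0 < N\<close> by (simp_all add: divide_right_mono)
qed

section \<open>The blind MDP of a linear family\<close>

text \<open>
  Scaling constants: \<open>entry_bound\<close> exceeds every absolute row sum of the letter matrices, and
  \<open>final_bound\<close> every absolute final weight.
\<close>

definition entry_bound :: "nat \<Rightarrow> nat \<Rightarrow> (nat \<Rightarrow> nat \<Rightarrow> nat \<Rightarrow> int) \<Rightarrow> real" where
  "entry_bound A d M = 1 + (\<Sum>l<A. \<Sum>i<d. \<Sum>j<d. real_of_int \<bar>M l i j\<bar>)"

definition final_bound :: "nat \<Rightarrow> (nat \<Rightarrow> nat list \<Rightarrow> int) \<Rightarrow> real" where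
  "final_bound d G = 1 + (\<Sum>i<d. real_of_int \<bar>G i []\<bar>)"

text \<open>
  State \<open>0\<close> is the reset state, state \<open>1\<close> the sink; \<open>2 + 2 i\<close> and \<open>3 + 2 i\<close> are the positive and the
  negative copy of the automaton state \<open>i\<close>. So \<open>2\<close>, \<open>4\<close>, \<open>7\<close> are the positive copies of \<open>0\<close> and \<open>1\<close> and the
  negative copy of \<open>2\<close>. The weights add up to \<open>1/2\<close>, the probability of not being reset.
\<close>

definition start_weight :: "nat \<Rightarrow> nat \<Rightarrow> real" where
  "start_weight n k = (if k = 2 then 1 else if k = 4 then real n else if k = 7 then real (n * n) else 0)
     / (2 * real (1 + n + n * n))"

text \<open>
  Transition probabilities without the reset; every row has the sum \<open>1/2\<close>. Action \<open>0\<close> is the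
  separator, action \<open>Suc l\<close> the letter \<open>l\<close>. A negative matrix entry exchanges the two signs, and the
  sink takes the remaining probability.
\<close>

definition kernel :: "nat \<Rightarrow> nat \<Rightarrow> (nat \<Rightarrow> nat \<Rightarrow> nat \<Rightarrow> int) \<Rightarrow> nat \<Rightarrow> nat \<Rightarrow> nat \<Rightarrow> nat \<Rightarrow> real" where
  "kernel A d M n k a k' =
     (if k = 0 \<and> a = 0 then start_weight n k'
      else if k < 2 \<or> a = 0 then (if k' = 1 then 1 / 2 else 0)
      else let m = (\<lambda>j. real_of_int (M (a - 1) (k div 2 - 1) j)); c = 2 * entry_bound A d M in
        if k' = 0 then 0
        else if k' = 1 then 1 / 2 - (\<Sum>j<d. \<bar>m j\<bar>) / c
        else (if even k = even k' then max 0 (m (k' div 2 - 1)) else max 0 (- m (k' div 2 - 1))) / c)"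

text \<open>
  Reward of a copy at a separator, normalized to \<open>[-1, 1]\<close>; zero otherwise.
\<close>

definition gain :: "nat \<Rightarrow> (nat \<Rightarrow> nat list \<Rightarrow> int) \<Rightarrow> nat \<Rightarrow> nat \<Rightarrow> real" where
  "gain d G k a =
     (if a = 0 \<and> 2 \<le> k then (if even k then 1 else -1) * real_of_int (G (k div 2 - 1) []) / final_bound d G
      else 0)"

text \<open>
  Every transition leads to the reset state with probability \<open>1/2\<close> in addition to the kernel.
\<close>

definition transition_prob ::
    "nat \<Rightarrow> nat \<Rightarrow> (nat \<Rightarrow> nat \<Rightarrow> nat \<Rightarrow> int) \<Rightarrow> nat \<Rightarrow> nat \<Rightarrow> nat \<Rightarrow> nat \<Rightarrow> real" where
  "transition_prob A d M n k a k' =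
     (if k' < 2 + 2 * d then kernel A d M n k a k' + (if k' = 0 then 1 / 2 else 0) else 0)"

text \<open>
  The blind MDP of a weighted automaton with the parameter \<open>n\<close>. The second player has a single
  action. The probabilities add up to \<open>1\<close> only for the states and actions of the game; elsewhere the
  values of \<open>embed_pmf\<close> do not matter.
\<close>

definition family_game :: "nat \<Rightarrow> nat \<Rightarrow> (nat \<Rightarrow> nat \<Rightarrow> nat \<Rightarrow> int) \<Rightarrow> (nat \<Rightarrow> nat list \<Rightarrow> int) \<Rightarrow> nat \<Rightarrow>
    (nat, nat, nat) game" where
  "family_game A d M G n = \<lparr>states = {..<2 + 2 * d}, acts1 = {..<Suc A}, acts2 = {..<1},
     trans = (\<lambda>k a _. embed_pmf (transition_prob A d M n k a)),
     reward = (\<lambda>k a _. (1 + gain d G k a) / 2)\<rparr>"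

text \<open>
  Expected sum of the gains from state \<open>k\<close> until the next reset, when the actions \<open>as\<close> are played.
\<close>

primrec copy_payoff :: "nat \<Rightarrow> nat \<Rightarrow> (nat \<Rightarrow> nat \<Rightarrow> nat \<Rightarrow> int) \<Rightarrow> (nat \<Rightarrow> nat list \<Rightarrow> int) \<Rightarrow> nat \<Rightarrow>
    nat list \<Rightarrow> nat \<Rightarrow> real" where
  "copy_payoff A d M G n [] k = 0"
| "copy_payoff A d M G n (a # as) k =
     gain d G k a + (\<Sum>k'<2 + 2 * d. kernel A d M n k a k' * copy_payoff A d M G n as k')"

lemma sum_states:
  fixes f :: "nat \<Rightarrow> real"
  shows "(\<Sum>k<2 + 2 * d. f k) = f 0 + f 1 + (\<Sum>j<d. f (2 + 2 * j) + f (3 + 2 * j))"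
  by (induction d) (simp_all add: numeral_2_eq_2 numeral_3_eq_3)

locale family_mdp =
  fixes A d :: nat and M :: "nat \<Rightarrow> nat \<Rightarrow> nat \<Rightarrow> int" and G :: "nat \<Rightarrow> nat list \<Rightarrow> int" and n :: nat
  assumes family: "linear_family A d M G" and A_pos: "0 < A" and d_ge: "3 \<le> d"
begin

\<comment> \<open>The number of states is a successor; sums over the states are split by \<open>sum_states\<close> instead.\<close>
declare sum.lessThan_Suc [simp del]

abbreviation "\<Gamma> \<equiv> family_game A d M G n"
abbreviation "S \<equiv> {..<2 + 2 * d}"
abbreviation "B \<equiv> entry_bound A d M"
abbreviation "K \<equiv> final_bound d G"
abbreviation "q \<equiv> kernel A d M n"
abbreviation "X as k \<equiv> copy_payoff A d M G n as k"

lemma B_ge: "1 \<le> B"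
  unfolding entry_bound_def by (simp add: sum_nonneg)

lemma K_ge: "1 \<le> K"
  unfolding final_bound_def by (simp add: sum_nonneg)

lemma row_le_B:
  assumes "l < A" "i < d"
  shows "(\<Sum>j<d. \<bar>real_of_int (M l i j)\<bar>) \<le> B"
proof -
  have "(\<Sum>j<d. real_of_int \<bar>M l i j\<bar>) \<le> (\<Sum>i<d. \<Sum>j<d. real_of_int \<bar>M l i j\<bar>)"
    by (rule member_le_sum[of i]) (use assms in \<open>auto intro: sum_nonneg\<close>)
  also have "\<dots> \<le> (\<Sum>l<A. \<Sum>i<d. \<Sum>j<d. real_of_int \<bar>M l i j\<bar>)"
    by (rule member_le_sum[of l]) (use assms in \<open>auto intro!: sum_nonneg\<close>)
  finally show ?thesis unfolding entry_bound_def by simp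
qed

lemma gain_bound:
  assumes "k \<in> S"
  shows "\<bar>gain d G k a\<bar> \<le> 1"
proof (cases "a = 0 \<and> 2 \<le> k")
  case True
  then have "k div 2 - 1 < d" using assms by auto
  then have "real_of_int \<bar>G (k div 2 - 1) []\<bar> \<le> (\<Sum>i<d. real_of_int \<bar>G i []\<bar>)"
    by (intro member_le_sum) auto
  then have "\<bar>real_of_int (G (k div 2 - 1) [])\<bar> \<le> K" by (simp add: final_bound_def)
  then show ?thesis using True K_ge by (auto simp: gain_def abs_mult)
qed (auto simp: gain_def)

lemma kernel_nonneg:
  assumes "k \<in> S" "a \<le> A"
  shows "0 \<le> q k a k'"
proof -
  have "(\<Sum>j<d. \<bar>real_of_int (M (a - 1) (k div 2 - 1) j)\<bar>) / (2 * B) \<le> 1 / 2"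
    if "2 \<le> k" "a \<noteq> 0"
    using row_le_B[of "a - 1" "k div 2 - 1"] assms that B_ge by (simp add: field_simps)
  then show ?thesis using B_ge
    by (auto simp: kernel_def start_weight_def Let_def divide_nonneg_nonneg)
qed

lemma kernel_sum:
  assumes "k \<in> S" "a \<le> A"
  shows "(\<Sum>k'\<in>S. q k a k') = 1 / 2"
proof -
  consider "k = 0 \<and> a = 0" | "(k < 2 \<or> a = 0) \<and> \<not> (k = 0 \<and> a = 0)" | "2 \<le> k" "a \<noteq> 0" by linarith
  then show ?thesis
  proof cases
    case 1
    then have "(\<Sum>k'\<in>S. q k a k') = (\<Sum>k'\<in>S. start_weight n k')" by (simp add: kernel_def)
    also have "\<dots> = (\<Sum>k'\<in>{2, 4, 7}. start_weight n k')"
      using d_ge by (intro sum.mono_neutral_right) (auto simp: start_weight_def)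
    also have "\<dots> = (1 + real n + real (n * n)) / (2 * real (1 + n + n * n))"
      by (simp add: start_weight_def add_divide_distrib)
    also have "1 + real n + real (n * n) = real (1 + n + n * n)" by simp
    also have "\<dots> / (2 * real (1 + n + n * n)) = 1 / 2"
    proof -
      have "real (1 + n + n * n) \<noteq> 0" by (subst of_nat_eq_0_iff) simp
      moreover have "x / (2 * x) = 1 / 2" if "x \<noteq> 0" for x :: real using that by simp
      ultimately show ?thesis by blast
    qed
    finally show ?thesis .
  next
    case 2
    then have "(\<Sum>k'\<in>S. q k a k') = (\<Sum>k'\<in>S. if k' = 1 then 1 / 2 else 0)"
      by (intro sum.cong) (auto simp: kernel_def)
    then show ?thesis by simp
  next
    case 3
    let ?m = "\<lambda>j. real_of_int (M (a - 1) (k div 2 - 1) j)"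
    have "max 0 x + max 0 (- x) = \<bar>x\<bar>" "max 0 (- x) + max 0 x = \<bar>x\<bar>" for x :: real by auto
    then have "q k a (2 + 2 * j) + q k a (3 + 2 * j) = \<bar>?m j\<bar> / (2 * B)" for j
      using 3 by (auto simp: kernel_def Let_def add_divide_distrib[symmetric])
    moreover have "q k a 0 = 0" "q k a 1 = 1 / 2 - (\<Sum>j<d. \<bar>?m j\<bar>) / (2 * B)"
      using 3 by (auto simp: kernel_def Let_def)
    ultimately show ?thesis unfolding sum_states by (simp add: sum_divide_distrib)
  qed
qed

lemma pmf_trans:
  assumes "k \<in> S" "a \<le> A"
  shows "pmf (trans \<Gamma> k a j) k' = transition_prob A d M n k a k'"
proof -
  let ?f = "transition_prob A d M n k a"
  have nonneg: "0 \<le> ?f x" for x using kernel_nonneg[OF assms] by (simp add: transition_prob_def)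
  have "(\<integral>\<^sup>+ x. ennreal (?f x) \<partial>count_space UNIV) = (\<Sum>x\<in>S. ennreal (?f x))"
    by (rule nn_integral_count_space') (auto simp: transition_prob_def)
  also have "\<dots> = ennreal (\<Sum>x\<in>S. ?f x)" using nonneg by simp
  also have "(\<Sum>x\<in>S. ?f x) = (\<Sum>x\<in>S. q k a x) + (\<Sum>x\<in>S. if x = 0 then 1 / 2 else 0)"
    unfolding sum.distrib[symmetric] by (rule sum.cong) (auto simp: transition_prob_def)
  also have "\<dots> = 1" using kernel_sum[OF assms] by simp
  finally show ?thesis unfolding family_game_def by (simp add: pmf_embed_pmf nonneg)
qed

lemma set_trans_subset:
  assumes "k \<in> S" "a \<le> A"
  shows "set_pmf (trans \<Gamma> k a j) \<subseteq> S"
  unfolding set_pmf_eq pmf_trans[OF assms] by (auto simp: transition_prob_def)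

lemma blind_stochastic_game_family: "blind_stochastic_game \<Gamma>"
  unfolding blind_stochastic_game_def
proof (intro conjI ballI)
  fix k a j assume "k \<in> states \<Gamma>" "a \<in> acts1 \<Gamma>"
  then have k: "k \<in> S" "a \<le> A" by (auto simp: family_game_def)
  show "trans \<Gamma> k a j \<in> distributions (states \<Gamma>)"
    using set_trans_subset[OF k] by (simp add: distributions_def family_game_def)
  show "reward \<Gamma> k a j \<in> {0..1}"
    using gain_bound[OF k(1), of a] by (auto simp: family_game_def)
qed (auto simp: family_game_def lessThan_empty_iff)

lemma markov_blind_MDP_family: "markov_blind_MDP \<Gamma>"
proof -
  have "0 < transition_prob A d M n k a 0" if "k \<in> S" "a \<le> A" for k a
    using kernel_nonneg[OF that, of 0] by (simp add: transition_prob_def)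
  then have "markov_matrix (states \<Gamma>) (transition_matrix \<Gamma> a)" if "a \<in> acts1 \<Gamma> \<times> acts2 \<Gamma>" for a
    using that pmf_trans
    by (auto simp: markov_matrix_def transition_matrix_def family_game_def intro!: bexI[of _ 0])
  moreover have "is_singleton (acts2 \<Gamma>)"
    by (auto simp: family_game_def is_singleton_def)
  ultimately show ?thesis
    using blind_stochastic_game_family by (simp add: markov_blind_MDP_def blind_MDP_def)
qed

lemma X_sink: "X as 1 = 0"
proof (induction as)
  case (Cons a as)
  have "(\<Sum>k'\<in>S. q 1 a k' * X as k') = 0"
    by (rule sum.neutral) (use Cons in \<open>auto simp: kernel_def\<close>)
  then show ?case by (simp add: gain_def)
qed simp

lemma X_to_sink:
  assumes "\<And>k'. q k a k' = (if k' = 1 then 1 / 2 else 0)"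
  shows "X (a # as) k = gain d G k a"
proof -
  have "(\<Sum>k'\<in>S. q k a k' * X as k') = 0"
    unfolding assms by (rule sum.neutral) (use X_sink in auto)
  then show ?thesis by simp
qed

lemma X_letter_0: "X (Suc l # as) 0 = 0"
  by (subst X_to_sink) (simp_all add: kernel_def gain_def)

lemma X_letters: "X (map Suc w) k = 0"
  by (induction w arbitrary: k) (simp_all add: gain_def)

lemma X_incomplete: "X (0 # map Suc w) 0 = 0"
  by (simp add: gain_def X_letters)

text \<open>
  A copy of \<open>i\<close> that reads \<open>w\<close> up to the next separator earns the weight of \<open>w\<close>, up to sign and scale.
\<close>

lemma X_word:
  assumes "w \<in> lists {..<A}" "i < d"
  shows "X (map Suc w @ 0 # as) (2 + 2 * i) = G i w / (K * (2 * B) ^ length w) \<and>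
         X (map Suc w @ 0 # as) (3 + 2 * i) = - G i w / (K * (2 * B) ^ length w)"
  using assms
proof (induction w arbitrary: i rule: list.induct)
  case Nil
  have "X (0 # as) (2 + 2 * i) = gain d G (2 + 2 * i) 0" "X (0 # as) (3 + 2 * i) = gain d G (3 + 2 * i) 0"
    by (rule X_to_sink; simp add: kernel_def)+
  then show ?case by (simp add: gain_def)
next
  case (Cons l w)
  then have l: "l < A" and w: "w \<in> lists {..<A}" by auto
  let ?as = "map Suc w @ 0 # as" and ?c = "K * (2 * B) ^ length w"
  define m where "m j = real_of_int (M l i j)" for j
  have G: "real_of_int (G i (l # w)) = (\<Sum>j<d. m j * G j w)"
    using family l Cons.prems(2) by (simp add: linear_family_def m_def)
  have eq: "max 0 (m j) / (2 * B) * (g / ?c) + max 0 (- m j) / (2 * B) * (- g / ?c) =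
      m j * g / (K * (2 * B) ^ length (l # w))" for j g
    using B_ge K_ge by (cases "0 \<le> m j") (simp_all add: max_def field_simps)
  have "(\<Sum>k'\<in>S. q (2 + 2 * i) (Suc l) k' * X ?as k') =
      (\<Sum>j<d. max 0 (m j) / (2 * B) * (G j w / ?c) + max 0 (- m j) / (2 * B) * (- G j w / ?c))"
    unfolding sum_states using Cons.IH[OF w]
    by (simp add: X_sink[unfolded One_nat_def] kernel_def m_def Let_def)
  also have "\<dots> = G i (l # w) / (K * (2 * B) ^ length (l # w))"
    unfolding of_int_minus eq by (simp only: G sum_divide_distrib)
  finally have 1: "(\<Sum>k'\<in>S. q (2 + 2 * i) (Suc l) k' * X ?as k') = G i (l # w) / (K * (2 * B) ^ length (l # w))" .
  have "(\<Sum>k'\<in>S. q (3 + 2 * i) (Suc l) k' * X ?as k') =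
      (\<Sum>j<d. - (max 0 (m j) / (2 * B) * (G j w / ?c) + max 0 (- m j) / (2 * B) * (- G j w / ?c)))"
    unfolding sum_states using Cons.IH[OF w]
    by (simp add: X_sink[unfolded One_nat_def] kernel_def m_def Let_def)
  also have "\<dots> = - G i (l # w) / (K * (2 * B) ^ length (l # w))"
    unfolding of_int_minus eq sum_negf by (simp only: G sum_divide_distrib[symmetric])
  finally have 2: "(\<Sum>k'\<in>S. q (3 + 2 * i) (Suc l) k' * X ?as k') = - G i (l # w) / (K * (2 * B) ^ length (l # w))" .
  show ?case using 1 2 by (simp add: gain_def del: power_Suc)
qed

text \<open>
  What a copy born in the reset state earns from the block \<open># w #\<close>.
\<close>

definition word_payoff :: "nat list \<Rightarrow> real" where
  "word_payoff w = real_of_int (G 0 w + int n * G 1 w - int n * int n * G 2 w) /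
     (2 * real (1 + n + n * n) * (K * (2 * B) ^ length w))"

lemma word_payoff_pos_iff: "0 < word_payoff w \<longleftrightarrow> 0 < G 0 w + int n * G 1 w - int n * int n * G 2 w"
proof -
  have "0 < 2 * real (1 + n + n * n) * (K * (2 * B) ^ length w)"
    using B_ge K_ge by (intro mult_pos_pos zero_less_power) (simp_all del: of_nat_add of_nat_mult)
  then show ?thesis
    unfolding word_payoff_def by (simp only: pos_less_divide_eq mult_zero_left of_int_0_less_iff)
qed

lemma X_complete:
  assumes "w \<in> lists {..<A}"
  shows "X (0 # map Suc w @ 0 # as) 0 = word_payoff w"
proof -
  let ?as = "map Suc w @ 0 # as" and ?D = "2 * real (1 + n + n * n)" and ?c = "K * (2 * B) ^ length w"
  have "X (0 # ?as) 0 = (\<Sum>k'\<in>S. start_weight n k' * X ?as k')"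
    by (simp add: gain_def kernel_def)
  also have "\<dots> = (\<Sum>k'\<in>{2, 4, 7}. start_weight n k' * X ?as k')"
    using d_ge by (intro sum.mono_neutral_right) (auto simp: start_weight_def)
  also have "\<dots> = 1 / ?D * X ?as 2 + n / ?D * X ?as 4 + (n * n) / ?D * X ?as 7"
    by (simp add: start_weight_def)
  also have "X ?as 2 = G 0 w / ?c" using X_word[OF assms, of 0] d_ge by simp
  also have "X ?as 4 = G 1 w / ?c" using X_word[OF assms, of 1] d_ge by simp
  also have "X ?as 7 = - G 2 w / ?c" using X_word[OF assms, of 2] d_ge by simp
  finally show ?thesis
    unfolding word_payoff_def by (simp add: add_divide_distrib diff_divide_distrib)
qed

lemma X_bound:
  assumes "as \<in> lists {..A}" "k \<in> S"
  shows "\<bar>X as k\<bar> \<le> 2"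
  using assms
proof (induction as arbitrary: k rule: list.induct)
  case (Cons a as)
  then have a: "a \<le> A" by auto
  have "\<bar>\<Sum>k'\<in>S. q k a k' * X as k'\<bar> \<le> (\<Sum>k'\<in>S. q k a k' * 2)"
  proof (rule order_trans[OF sum_abs sum_mono])
    fix k' assume "k' \<in> S"
    then have "\<bar>X as k'\<bar> \<le> 2" using Cons by simp
    then show "\<bar>q k a k' * X as k'\<bar> \<le> q k a k' * 2"
      using kernel_nonneg[OF Cons.prems(2) a, of k'] by (simp add: abs_mult mult_left_mono)
  qed
  also have "\<dots> = 1" using kernel_sum[of k a] Cons.prems by (simp flip: sum_distrib_right)
  finally show ?case using gain_bound[OF Cons.prems(2), of a] by simp
qed simp

text \<open>
  The sum over all suffixes of what a copy in the reset state earns from them.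
\<close>

primrec birth_payoff :: "nat list \<Rightarrow> real" where
  "birth_payoff [] = 0"
| "birth_payoff (a # as) = X (a # as) 0 + birth_payoff as"

text \<open>
  Split the play at the resets. At each stage after the first, a copy is in the reset state with
  probability exactly \<open>1/2\<close>, and it earns until its next reset. The copy present initially is
  distributed as \<open>b\<close>.
\<close>

lemma total_reward_copies:
  assumes "set_pmf b \<subseteq> S" "as \<in> lists {..A}"
  shows "total_reward \<Gamma> b (map (\<lambda>a. (a, 0)) as) =
    (length as + (\<Sum>k\<in>S. pmf b k * X as k) + (birth_payoff as - X as 0) / 2) / 2"
  using assms
proof (induction as arbitrary: b rule: list.induct)
  case Nil
  show ?case by simp
next
  case (Cons a as)
  then have a: "a \<le> A" and as: "as \<in> lists {..A}" by auto
  let ?b = "next_belief \<Gamma> b (a, 0)"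
  have b1: "(\<Sum>k\<in>S. pmf b k) = 1" by (rule sum_pmf_eq_1) (use Cons.prems in auto)
  have b_sub: "set_pmf ?b \<subseteq> S"
    using Cons.prems(1) set_trans_subset[OF _ a] by (auto simp: next_belief_def)
  have "belief_reward \<Gamma> b (a, 0) = (\<Sum>k\<in>S. pmf b k * ((1 + gain d G k a) / 2))"
    unfolding belief_reward_def
    by (subst integral_measure_pmf[of S]) (use Cons.prems in \<open>auto simp: family_game_def\<close>)
  also have "\<dots> = ((\<Sum>k\<in>S. pmf b k) + (\<Sum>k\<in>S. pmf b k * gain d G k a)) / 2"
    by (simp add: sum.distrib[symmetric] sum_divide_distrib algebra_simps)
  finally have r: "belief_reward \<Gamma> b (a, 0) = (1 + (\<Sum>k\<in>S. pmf b k * gain d G k a)) / 2" unfolding b1 .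
  have pb: "pmf ?b k' = (\<Sum>k\<in>S. pmf b k * q k a k') + (if k' = 0 then 1 / 2 else 0)" if "k' \<in> S" for k'
  proof -
    have "pmf ?b k' = (\<Sum>k\<in>S. pmf b k * pmf (trans \<Gamma> k a 0) k')"
      unfolding next_belief_def pmf_bind
      by (subst integral_measure_pmf[of S]) (use Cons.prems in auto)
    also have "\<dots> = (\<Sum>k\<in>S. pmf b k * (q k a k' + (if k' = 0 then 1 / 2 else 0)))"
      by (rule sum.cong) (use pmf_trans[OF _ a] that in \<open>auto simp: transition_prob_def\<close>)
    also have "\<dots> = (\<Sum>k\<in>S. pmf b k * q k a k') + (\<Sum>k\<in>S. pmf b k) * (if k' = 0 then 1 / 2 else 0)"
      by (simp only: distrib_left sum.distrib sum_distrib_right)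
    finally show ?thesis unfolding b1 by simp
  qed
  have "(\<Sum>k'\<in>S. pmf ?b k' * X as k') =
      (\<Sum>k'\<in>S. (\<Sum>k\<in>S. pmf b k * q k a k') * X as k') + (\<Sum>k'\<in>S. if k' = 0 then X as 0 / 2 else 0)"
    unfolding sum.distrib[symmetric] by (rule sum.cong) (auto simp: pb distrib_right)
  also have "(\<Sum>k'\<in>S. (\<Sum>k\<in>S. pmf b k * q k a k') * X as k') =
      (\<Sum>k\<in>S. pmf b k * (\<Sum>k'\<in>S. q k a k' * X as k'))"
    by (simp only: sum_distrib_left sum_distrib_right mult.assoc) (rule sum.swap)
  finally have s: "(\<Sum>k'\<in>S. pmf ?b k' * X as k') =
      (\<Sum>k\<in>S. pmf b k * (\<Sum>k'\<in>S. q k a k' * X as k')) + X as 0 / 2" by simp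
  have x: "(\<Sum>k\<in>S. pmf b k * X (a # as) k) =
      (\<Sum>k\<in>S. pmf b k * gain d G k a) + (\<Sum>k\<in>S. pmf b k * (\<Sum>k'\<in>S. q k a k' * X as k'))"
    by (simp add: distrib_left sum.distrib)
  have "total_reward \<Gamma> b (map (\<lambda>a. (a, 0)) (a # as)) = belief_reward \<Gamma> b (a, 0) +
      (length as + (\<Sum>k\<in>S. pmf ?b k * X as k) + (birth_payoff as - X as 0) / 2) / 2"
    using Cons.IH[OF b_sub as] by simp
  then show ?case unfolding r s x by (simp add: field_simps)
qed

lemma total_reward_approx:
  assumes "set_pmf b \<subseteq> S" "as \<in> lists {..A}"
  shows "\<bar>total_reward \<Gamma> b (map (\<lambda>a. (a, 0)) as) - (length as + birth_payoff as / 2) / 2\<bar> \<le> 3 / 2"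
proof -
  have "(\<Sum>k\<in>S. pmf b k) = 1" by (rule sum_pmf_eq_1) (use assms in auto)
  have "\<bar>\<Sum>k\<in>S. pmf b k * X as k\<bar> \<le> (\<Sum>k\<in>S. pmf b k * 2)"
    by (rule order_trans[OF sum_abs sum_mono]) (use X_bound[OF assms(2)] in \<open>auto simp: abs_mult mult_left_mono\<close>)
  also have "\<dots> = 2" using \<open>(\<Sum>k\<in>S. pmf b k) = 1\<close> by (simp flip: sum_distrib_right)
  finally show ?thesis
    unfolding total_reward_copies[OF assms] using X_bound[OF assms(2), of 0] by (simp add: field_simps abs_le_iff)
qed

end

section \<open>The uniform value\<close>

context family_mdp
begin

lemma total_reward_bounds:
  assumes "set_pmf b \<subseteq> S" "as \<in> lists {..A}"
  shows "(length as + birth_payoff as / 2) / 2 - 3 / 2 \<le> total_reward \<Gamma> b (map (\<lambda>a. (a, 0)) as)"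
    "total_reward \<Gamma> b (map (\<lambda>a. (a, 0)) as) \<le> (length as + birth_payoff as / 2) / 2 + 3 / 2"
  using total_reward_approx[OF assms] unfolding abs_le_iff by linarith+

text \<open>
  An action sequence either contains no separator, or it is a word followed by a separator.
\<close>

lemma block_decomposition:
  assumes "as \<in> lists {..A}"
  obtains w where "w \<in> lists {..<A}" "as = map Suc w"
  | w bs where "w \<in> lists {..<A}" "bs \<in> lists {..A}" "as = map Suc w @ 0 # bs"
proof -
  have *: "\<exists>w\<in>lists {..<A}. us = map Suc w" if "us \<in> lists {..A}" "0 \<notin> set us" for us
  proof (rule bexI[of _ "map (\<lambda>a. a - 1) us"])
    show "us = map Suc (map (\<lambda>a. a - 1) us)" using that(2) by (induction us) auto
    show "map (\<lambda>a. a - 1) us \<in> lists {..<A}"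
      using that by (induction us rule: list.induct) auto
  qed
  show ?thesis
  proof (cases "0 \<in> set as")
    case False
    then show ?thesis using *[OF assms] that(1) by blast
  next
    case True
    then obtain us bs where "as = us @ 0 # bs" "0 \<notin> set us" using split_list_first by metis
    then show ?thesis using assms *[of us] that(2) by auto
  qed
qed

lemma birth_payoff_letters: "birth_payoff (map Suc w @ as) = birth_payoff as"
  by (induction w) (simp_all only: list.map append.simps birth_payoff.simps X_letter_0 add_0)

lemma birth_payoff_incomplete: "birth_payoff (0 # map Suc w) = 0"
  using birth_payoff_letters[of w "[]"] X_incomplete[of w] by simp

text \<open>
  Blocks contribute additively, since only suffixes that start with a separator earn anything, and
  they earn nothing after the next separator.
\<close>

lemma birth_payoff_block:
  assumes "w \<in> lists {..<A}"
  shows "birth_payoff (0 # map Suc w @ 0 # as) = word_payoff w + birth_payoff (0 # as)"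
  by (simp only: birth_payoff.simps(2)[of 0 "map Suc w @ 0 # as"] X_complete[OF assms] birth_payoff_letters)

lemma birth_payoff_upper:
  fixes V :: real
  assumes as: "as \<in> lists {..A}" and "0 \<le> V"
    and V: "\<And>w. w \<in> lists {..<A} \<Longrightarrow> word_payoff w \<le> V * (length w + 1)"
  shows "birth_payoff as \<le> V * length as"
  using as
proof (induction "length as" arbitrary: as rule: less_induct)
  case less
  show ?case
  proof (cases as)
    case Nil
    then show ?thesis by simp
  next
    case (Cons a bs)
    show ?thesis
    proof (cases a)
      case (Suc l)
      then have "birth_payoff as = birth_payoff bs" by (simp only: Cons birth_payoff.simps X_letter_0 add_0)
      also have "\<dots> \<le> V * length bs" by (rule less.hyps) (use less.prems Cons in auto)
      also have "\<dots> \<le> V * length as" using \<open>0 \<le> V\<close> Cons by (simp add: mult_left_mono)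
      finally show ?thesis .
    next
      case 0
      have "bs \<in> lists {..A}" using less.prems Cons by simp
      then show ?thesis
      proof (cases rule: block_decomposition)
        case (1 w)
        then show ?thesis using birth_payoff_incomplete[of w] \<open>0 \<le> V\<close> Cons 0 by simp
      next
        case (2 w cs)
        have "birth_payoff (0 # cs) \<le> V * length (0 # cs)"
          by (rule less.hyps) (use 2 Cons in auto)
        moreover have "birth_payoff as = word_payoff w + birth_payoff (0 # cs)"
          using birth_payoff_block[OF 2(1)] 2(3) Cons 0 by simp
        ultimately show ?thesis using V[OF 2(1)] 2(3) Cons by (simp add: algebra_simps)
      qed
    qed
  qed
qed

text \<open>
  Earnings per stage when a block \<open># w\<close> is repeated forever; \<open>0\<close> is the rate of playing no
  separator.
\<close>

definition word_rates :: "real set" where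
  "word_rates = insert 0 ((\<lambda>w. word_payoff w / (length w + 1)) ` lists {..<A})"

definition best_rate :: real where
  "best_rate = Sup word_rates"

lemma word_payoff_le_2:
  assumes "w \<in> lists {..<A}"
  shows "word_payoff w \<le> 2"
proof -
  have "0 # map Suc w @ [0] \<in> lists {..A}" using assms by (auto simp: Suc_le_eq)
  then have "\<bar>X (0 # map Suc w @ [0]) 0\<bar> \<le> 2" by (rule X_bound) simp
  then show ?thesis unfolding X_complete[OF assms] by simp
qed

lemma word_rates_le_2: "r \<in> word_rates \<Longrightarrow> r \<le> 2"
proof -
  have "word_payoff w / (length w + 1) \<le> 2" if "w \<in> lists {..<A}" for w
    using word_payoff_le_2[OF that] by (simp add: pos_divide_le_eq)
  then show "r \<in> word_rates \<Longrightarrow> r \<le> 2" by (auto simp: word_rates_def)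
qed

lemma bdd_above_word_rates: "bdd_above word_rates"
  by (rule bdd_aboveI[of _ 2]) (rule word_rates_le_2)

lemma word_rates_nonempty: "word_rates \<noteq> {}"
  by (simp add: word_rates_def)

lemma best_rate_bounds: "0 \<le> best_rate" "best_rate \<le> 2"
proof -
  show "0 \<le> best_rate" unfolding best_rate_def
    by (rule cSup_upper[OF _ bdd_above_word_rates]) (simp add: word_rates_def)
  show "best_rate \<le> 2" unfolding best_rate_def
    by (rule cSup_least) (use word_rates_le_2 in \<open>auto simp: word_rates_def\<close>)
qed

lemma word_payoff_le_best:
  assumes "w \<in> lists {..<A}"
  shows "word_payoff w \<le> best_rate * (length w + 1)"
proof -
  have "word_payoff w / (length w + 1) \<le> best_rate" unfolding best_rate_def
    by (rule cSup_upper[OF _ bdd_above_word_rates]) (use assms in \<open>simp add: word_rates_def\<close>)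
  then show ?thesis by (simp add: pos_divide_le_eq)
qed

lemma best_rate_pos_iff: "0 < best_rate \<longleftrightarrow> (\<exists>w\<in>lists {..<A}. 0 < word_payoff w)"
proof
  assume "0 < best_rate"
  then obtain r where "r \<in> word_rates" "0 < r"
    unfolding best_rate_def using less_cSup_iff[OF _ bdd_above_word_rates, of 0] by (auto simp: word_rates_def)
  then obtain w where "w \<in> lists {..<A}" "0 < word_payoff w / (length w + 1)" by (auto simp: word_rates_def)
  then show "\<exists>w\<in>lists {..<A}. 0 < word_payoff w" by (auto simp: zero_less_divide_iff)
next
  assume "\<exists>w\<in>lists {..<A}. 0 < word_payoff w"
  then obtain w where "w \<in> lists {..<A}" "0 < word_payoff w" by blast
  then have "0 < best_rate * (length w + 1)" using word_payoff_le_best by fastforce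
  then show "0 < best_rate" using best_rate_bounds(1) by (auto simp: zero_less_mult_iff)
qed

text \<open>
  The action at stage \<open>t\<close>, counted from \<open>0\<close>, when the action sequence \<open>u\<close> is repeated forever.
\<close>

definition cycle_action :: "nat list \<Rightarrow> nat \<Rightarrow> nat" where
  "cycle_action u t = u ! (t mod length u)"

lemma map_cycle_action:
  assumes "u \<noteq> []"
  shows "map (cycle_action u) [0..<length u + N] = u @ map (cycle_action u) [0..<N]"
  by (rule nth_equalityI) (use assms in \<open>auto simp: cycle_action_def nth_append mod_if[of _ "length u"] le_mod_geq\<close>)

lemma birth_payoff_cycle:
  assumes w: "w \<in> lists {..<A}" "0 \<le> word_payoff w"
  shows "word_payoff w * (N / (length w + 1) - 2) \<le> birth_payoff (map (cycle_action (0 # map Suc w)) [0..<N])"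
proof (induction N rule: less_induct)
  case (less N)
  let ?u = "0 # map Suc w" and ?L = "length w + 1"
  have len: "length ?u = ?L" by simp
  show ?case
  proof (cases "N \<le> ?L")
    case True
    have "map (cycle_action ?u) [0..<N] = take N ?u"
      by (rule nth_equalityI) (use True in \<open>auto simp: cycle_action_def nth_Cons' split: if_splits\<close>)
    then have "birth_payoff (map (cycle_action ?u) [0..<N]) = 0"
      using birth_payoff_incomplete[of "take (N - 1) w"] by (cases N) (simp_all add: take_map)
    moreover have "word_payoff w * (N / (length w + 1) - 2) \<le> 0"
      by (rule mult_nonneg_nonpos[OF w(2)]) (use True in \<open>simp add: pos_divide_le_eq\<close>)
    ultimately show ?thesis by simp
  next
    case False
    define m where "m = N - ?L"
    have m: "N = length ?u + m" "0 < m" "m < N" using False by (auto simp: m_def)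
    have "map (cycle_action ?u) [0..<m] = 0 # tl (map (cycle_action ?u) [0..<m])"
      using m(2) by (simp add: upt_conv_Cons cycle_action_def)
    then obtain bs where bs: "map (cycle_action ?u) [0..<m] = 0 # bs" by (rule that)
    have "birth_payoff (map (cycle_action ?u) [0..<N]) = birth_payoff (?u @ 0 # bs)"
      unfolding m(1) by (subst map_cycle_action) (simp_all only: bs, simp)
    also have "\<dots> = word_payoff w + birth_payoff (0 # bs)"
      using birth_payoff_block[OF w(1)] by simp
    finally have eq: "birth_payoff (map (cycle_action ?u) [0..<N]) =
        word_payoff w + birth_payoff (map (cycle_action ?u) [0..<m])" unfolding bs .
    have "N / ?L = m / ?L + 1" unfolding m(1) len by (simp add: field_simps)
    then show ?thesis unfolding eq using less.IH[OF m(3)] by (simp add: algebra_simps)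
  qed
qed

lemma ex_good_cycle:
  assumes "0 < \<epsilon>"
  obtains u where "u \<noteq> []" "u \<in> lists {..A}"
    "\<And>N. birth_payoff (map (cycle_action u) [0..<N]) \<ge> (best_rate - \<epsilon>) * N - 4"
proof (cases "best_rate - \<epsilon> \<le> 0")
  case True
  show ?thesis
  proof (rule that[of "[1]"])
    fix N :: nat
    have "map (cycle_action [1]) [0..<N] = map Suc (replicate N 0)"
      by (rule nth_equalityI) (auto simp: cycle_action_def)
    then have "birth_payoff (map (cycle_action [1]) [0..<N]) = 0"
      using birth_payoff_letters[of "replicate N 0" "[]"] by simp
    then show "birth_payoff (map (cycle_action [1]) [0..<N]) \<ge> (best_rate - \<epsilon>) * N - 4"
      using mult_nonpos_nonneg[OF True, of "real N"] by simp
  qed (use A_pos in auto)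
next
  case False
  have "best_rate - \<epsilon> < Sup word_rates" using assms by (simp add: best_rate_def)
  then obtain r where r: "r \<in> word_rates" "best_rate - \<epsilon> < r"
    unfolding less_cSup_iff[OF word_rates_nonempty bdd_above_word_rates] by blast
  then obtain w where w: "w \<in> lists {..<A}" "r = word_payoff w / (length w + 1)"
    using False by (auto simp: word_rates_def)
  have "0 < r" using r(2) False by linarith
  then have "0 < word_payoff w" unfolding w(2) zero_less_divide_iff by auto
  show ?thesis
  proof (rule that[of "0 # map Suc w"])
    fix N :: nat
    have "(best_rate - \<epsilon>) * N \<le> r * N" using r(2) by (simp add: mult_right_mono)
    moreover have "r * N - 4 \<le> word_payoff w * (N / (length w + 1) - 2)"
      using word_payoff_le_2[OF w(1)] by (simp add: w(2) algebra_simps)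
    ultimately show "birth_payoff (map (cycle_action (0 # map Suc w)) [0..<N]) \<ge> (best_rate - \<epsilon>) * N - 4"
      using birth_payoff_cycle[OF w(1), of N] \<open>0 < word_payoff w\<close> by linarith
  qed (use w(1) in \<open>auto simp: Suc_le_eq\<close>)
qed

text \<open>
  The earnings are halved twice: a stage reward is \<open>(1 + gain)/2\<close>, and a copy is born with
  probability \<open>1/2\<close>.
\<close>

definition game_value :: real where
  "game_value = 1 / 2 + best_rate / 4"

lemma histories_family:
  assumes "h \<in> histories \<Gamma>"
  obtains as where "as \<in> lists {..A}" "h = map (\<lambda>a. (a, 0)) as"
proof (rule that[of "map fst h"])
  show "map fst h \<in> lists {..A}"
    using assms by (induction h) (auto simp: histories_def family_game_def)
  show "h = map (\<lambda>a. (a, 0)) (map fst h)"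
    using assms by (induction h) (auto simp: histories_def family_game_def)
qed

lemma has_uniform_value_family: "has_uniform_value \<Gamma> (\<lambda>_. game_value)"
  unfolding has_uniform_value_def
proof (intro ballI conjI allI impI)
  show "game_value \<in> {0..1}" using best_rate_bounds by (simp add: game_value_def)
next
  fix b \<epsilon> assume b: "b \<in> distributions (states \<Gamma>)" and "(0::real) < \<epsilon>"
  have bS: "set_pmf b \<subseteq> S" using b by (simp add: distributions_def family_game_def)
  note game = blind_stochastic_game_family
  obtain u where u: "u \<noteq> []" "u \<in> lists {..A}"
    "\<And>N. birth_payoff (map (cycle_action u) [0..<N]) \<ge> (best_rate - \<epsilon>) * N - 4"
    by (rule ex_good_cycle[OF \<open>0 < \<epsilon>\<close>]) blast
  define \<sigma>' where "\<sigma>' h = return_pmf (cycle_action u (length h))" for h :: "(nat \<times> nat) list"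
  define \<pi>' where "\<pi>' h = return_pmf (0::nat)" for h :: "(nat \<times> nat) list"
  have act: "cycle_action u t \<le> A" for t
  proof -
    have "u ! (t mod length u) \<in> set u" using u(1) by (intro nth_mem) simp
    then show ?thesis using u(2) by (auto simp: cycle_action_def)
  qed
  have \<sigma>': "\<sigma>' \<in> strategies1 \<Gamma>"
    using act by (auto simp: strategies1_def \<sigma>'_def distributions_def family_game_def less_Suc_eq_le)
  have \<pi>': "\<pi>' \<in> strategies2 \<Gamma>"
    by (auto simp: strategies2_def \<pi>'_def distributions_def family_game_def)
  \<comment> \<open>The total rewards are determined up to an additive constant below \<open>10\<close>.\<close>
  obtain n0 :: nat where n0: "10 / \<epsilon> < n0" using reals_Archimedean2 by blast
  show "\<exists>\<sigma>'\<in>strategies1 \<Gamma>. \<exists>\<pi>'\<in>strategies2 \<Gamma>. \<exists>n\<ge>1. \<forall>N\<ge>n. \<forall>\<sigma>\<in>strategies1 \<Gamma>. \<forall>\<pi>\<in>strategies2 \<Gamma>.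
      mean_payoff \<Gamma> b \<sigma>' \<pi> N \<ge> game_value - \<epsilon> \<and> mean_payoff \<Gamma> b \<sigma> \<pi>' N \<le> game_value + \<epsilon>"
  proof (intro bexI[OF _ \<sigma>'] bexI[OF _ \<pi>'] exI[of _ "Suc n0"] conjI allI impI ballI)
    fix N \<sigma> \<pi> assume N: "Suc n0 \<le> N" and \<sigma>: "\<sigma> \<in> strategies1 \<Gamma>" and \<pi>: "\<pi> \<in> strategies2 \<Gamma>"
    have Npos: "0 < N" using N by simp
    have small: "10 \<le> \<epsilon> * N"
    proof -
      have "10 / \<epsilon> \<le> N" using n0 N by linarith
      then show ?thesis using \<open>0 < \<epsilon>\<close> by (simp add: pos_divide_le_eq mult.commute)
    qed
    show "game_value - \<epsilon> \<le> mean_payoff \<Gamma> b \<sigma>' \<pi> N"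
    proof -
      have lower: "(game_value - \<epsilon>) * N \<le> total_reward \<Gamma> b h \<and> total_reward \<Gamma> b h \<le> total_reward \<Gamma> b h"
        if h: "h \<in> set_pmf (history_law \<sigma>' \<pi> N)" for h
      proof -
        note hl = set_history_law[OF \<sigma>' \<pi> h]
        obtain as where as: "as \<in> lists {..A}" "h = map (\<lambda>a. (a, 0)) as" using hl histories_family by metis
        have len: "length as = N" using hl as(2) by simp
        have "as ! t = cycle_action u t" if "t < N" for t
        proof -
          have "h ! t \<in> set_pmf (\<sigma>' (take t h)) \<times> set_pmf (\<pi> (take t h))" using hl that by blast
          then show ?thesis using that len by (simp add: as(2) \<sigma>'_def mem_Times_iff)
        qed
        then have "as = map (cycle_action u) [0..<N]" using len by (intro nth_equalityI) auto
        then have "birth_payoff as \<ge> (best_rate - \<epsilon>) * N - 4" using u(3) by simp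
        then have "(N + ((best_rate - \<epsilon>) * N - 4) / 2) / 2 - 3 / 2 \<le> (N + birth_payoff as / 2) / 2 - 3 / 2"
          by (intro diff_right_mono divide_right_mono add_left_mono) simp_all
        then have "total_reward \<Gamma> b h \<ge> (N + ((best_rate - \<epsilon>) * N - 4) / 2) / 2 - 3 / 2"
          using total_reward_bounds(1)[OF bS as(1)] unfolding as(2)[symmetric] len by (rule order_trans)
        moreover have "(N + ((best_rate - \<epsilon>) * N - 4) / 2) / 2 - 3 / 2 = game_value * N - \<epsilon> * N / 4 - 5 / 2"
          by (simp add: game_value_def field_simps)
        ultimately show ?thesis using small by (simp add: left_diff_distrib)
      qed
      then have "(game_value - \<epsilon>) * N / N \<le> mean_payoff \<Gamma> b \<sigma>' \<pi> N"
        using mean_payoff_bounds(1)[OF game b \<sigma>' \<pi> Npos, of "(game_value - \<epsilon>) * N"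
            "Max (total_reward \<Gamma> b ` set_pmf (history_law \<sigma>' \<pi> N))"]
          finite_set_history_law[OF game \<sigma>' \<pi>, of N] by (meson Max_ge finite_imageI imageI)
      then show ?thesis using Npos by simp
    qed
    show "mean_payoff \<Gamma> b \<sigma> \<pi>' N \<le> game_value + \<epsilon>"
    proof -
      have upper: "total_reward \<Gamma> b h \<le> (game_value + \<epsilon>) * N"
        if h: "h \<in> set_pmf (history_law \<sigma> \<pi>' N)" for h
      proof -
        note hl = set_history_law[OF \<sigma> \<pi>' h]
        obtain as where as: "as \<in> lists {..A}" "h = map (\<lambda>a. (a, 0)) as" using hl histories_family by metis
        have len: "length as = N" using hl as(2) by simp
        have "birth_payoff as \<le> best_rate * N"
          using birth_payoff_upper[OF as(1) best_rate_bounds(1) word_payoff_le_best] len by simp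
        then have "(N + birth_payoff as / 2) / 2 + 3 / 2 \<le> (N + best_rate * N / 2) / 2 + 3 / 2"
          by (intro add_right_mono divide_right_mono add_left_mono) simp_all
        with total_reward_bounds(2)[OF bS as(1)]
        have "total_reward \<Gamma> b h \<le> (N + best_rate * N / 2) / 2 + 3 / 2"
          unfolding as(2)[symmetric] len by (rule order_trans)
        moreover have "(N + best_rate * N / 2) / 2 = game_value * N" by (simp add: game_value_def field_simps)
        ultimately show ?thesis using small by (simp add: distrib_right)
      qed
      then have "mean_payoff \<Gamma> b \<sigma> \<pi>' N \<le> (game_value + \<epsilon>) * N / N"
        using mean_payoff_bounds(2)[OF game b \<sigma> \<pi>' Npos, of
            "Min (total_reward \<Gamma> b ` set_pmf (history_law \<sigma> \<pi>' N))" "(game_value + \<epsilon>) * N"]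
          finite_set_history_law[OF game \<sigma> \<pi>', of N] by (meson Min_le finite_imageI imageI)
      then show ?thesis using Npos by simp
    qed
  qed simp
qed

lemma game_value_gt_iff:
  "1 / 2 < game_value \<longleftrightarrow> (\<exists>w\<in>lists {..<A}. 0 < G 0 w + int n * G 1 w - int n * int n * G 2 w)"
  unfolding game_value_def word_payoff_pos_iff[symmetric] best_rate_pos_iff[symmetric] by simp

end

section \<open>Encoding the game and diagonalization\<close>

text \<open>
  Some code of a nonnegative rational number.
\<close>

definition fraction_code :: "real \<Rightarrow> nat" where
  "fraction_code r = (SOME c. frac_code r c)"

lemma frac_code_fraction_code:
  assumes "r \<in> \<rat>" "0 \<le> r"
  shows "frac_code r (fraction_code r)"
proof -
  obtain p q :: nat where "q \<noteq> 0" "\<bar>r\<bar> = real p / real q"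
    using Rats_abs_nat_div_natE[OF assms(1)] by metis
  then have "frac_code r (prod_encode (p, q))"
    using assms(2) unfolding frac_code_def by (intro exI[of _ p] exI[of _ q]) auto
  then show ?thesis unfolding fraction_code_def by (rule someI)
qed

lemma list_all2_fraction_code:
  assumes "\<And>r. r \<in> set rs \<Longrightarrow> r \<in> \<rat> \<and> 0 \<le> r"
  shows "list_all2 frac_code rs (map fraction_code rs)"
  using assms by (induction rs) (auto intro: frac_code_fraction_code)

lemma frac_codeI: "0 < q \<Longrightarrow> r = real p / real q \<Longrightarrow> frac_code r (prod_encode (p, q))"
  unfolding frac_code_def by blast

definition transition_table :: "(nat, nat, nat) game \<Rightarrow> nat \<Rightarrow> nat \<Rightarrow> nat \<Rightarrow> real list" where
  "transition_table \<Gamma> nk ni nj =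
     [pmf (trans \<Gamma> k i j) k'. k \<leftarrow> [0..<nk], i \<leftarrow> [0..<ni], j \<leftarrow> [0..<nj], k' \<leftarrow> [0..<nk]]"

text \<open>
  The transition table without its first eight entries, when the second player has one action.
\<close>

definition table_tail :: "(nat, nat, nat) game \<Rightarrow> nat \<Rightarrow> nat \<Rightarrow> real list" where
  "table_tail \<Gamma> nk ni =
     [pmf (trans \<Gamma> 0 0 0) k'. k' \<leftarrow> [8..<nk]] @
     [pmf (trans \<Gamma> 0 i 0) k'. i \<leftarrow> [1..<ni], k' \<leftarrow> [0..<nk]] @
     [pmf (trans \<Gamma> k i 0) k'. k \<leftarrow> [1..<nk], i \<leftarrow> [0..<ni], k' \<leftarrow> [0..<nk]]"

lemma concat_map_upt_0: "0 < m \<Longrightarrow> concat (map F [0..<m]) = F 0 @ concat (map F [1..<m])"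
  by (simp add: upt_conv_Cons)

lemma transition_table_split:
  assumes "8 \<le> nk" "0 < ni"
  shows "transition_table \<Gamma> nk ni 1 = map (pmf (trans \<Gamma> 0 0 0)) [0..<8] @ table_tail \<Gamma> nk ni"
proof -
  have 1: "[0..<nk] = [0..<8] @ [8..<nk]" using assms(1) by (metis le0 le_add_diff_inverse upt_add_eq_append)
  let ?F = "\<lambda>k i. map (pmf (trans \<Gamma> k i 0)) [0..<nk]"
  have "transition_table \<Gamma> nk ni 1 = concat (map (\<lambda>k. concat (map (?F k) [0..<ni])) [0..<nk])"
    by (simp add: transition_table_def)
  also have "\<dots> = concat (map (?F 0) [0..<ni]) @ concat (map (\<lambda>k. concat (map (?F k) [0..<ni])) [1..<nk])"
    by (rule concat_map_upt_0) (use assms(1) in simp)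
  also have "concat (map (?F 0) [0..<ni]) = ?F 0 0 @ concat (map (?F 0) [1..<ni])"
    by (rule concat_map_upt_0[OF assms(2)])
  also have "?F 0 0 = map (pmf (trans \<Gamma> 0 0 0)) [0..<8] @ map (pmf (trans \<Gamma> 0 0 0)) [8..<nk]"
    unfolding 1 by (rule map_append)
  finally show ?thesis by (simp only: table_tail_def append_assoc)
qed

context family_mdp
begin

lemma Rats_entry_bound: "entry_bound A d M \<in> \<rat>"
  unfolding entry_bound_def by (intro Rats_add Rats_sum Rats_1 Rats_of_int)

lemma Rats_final_bound: "final_bound d G \<in> \<rat>"
  unfolding final_bound_def by (intro Rats_add Rats_sum Rats_1 Rats_of_int)

lemma Rats_start_weight: "start_weight n k \<in> \<rat>"
  unfolding start_weight_def by (intro Rats_divide Rats_mult) auto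

lemma Rats_max: "x \<in> \<rat> \<Longrightarrow> y \<in> \<rat> \<Longrightarrow> max x (y::real) \<in> \<rat>"
  by (simp add: max_def)

lemma Rats_kernel: "q k a k' \<in> \<rat>"
proof -
  have "(\<Sum>j<d. \<bar>real_of_int (M (a - 1) (k div 2 - 1) j)\<bar>) \<in> \<rat>"
    unfolding of_int_abs[symmetric] by (intro Rats_sum Rats_of_int)
  moreover have "max 0 (real_of_int m) \<in> \<rat>" "max 0 (- real_of_int m) \<in> \<rat>" for m
    by (auto intro!: Rats_max)
  ultimately show ?thesis unfolding kernel_def Let_def
    using Rats_entry_bound Rats_start_weight by (auto intro!: Rats_divide Rats_diff Rats_mult)
qed

lemma Rats_transition_prob: "transition_prob A d M n k a k' \<in> \<rat>"
  unfolding transition_prob_def using Rats_kernel by (auto intro!: Rats_add Rats_divide)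

lemma Rats_reward: "(1 + gain d G k a) / 2 \<in> \<rat>"
  unfolding gain_def using Rats_final_bound by (auto intro!: Rats_divide Rats_add Rats_diff Rats_mult)

lemma start_row_codes:
  "list_all2 frac_code (map (pmf (trans \<Gamma> 0 0 0)) [0..<8]) (row_codes n)"
proof -
  let ?D = "2 * (1 + n + n * n)"
  have upt: "[0..<8] = [0, 1, 2, 3, 4, 5, 6, 7::nat]" by (simp add: upt_rec)
  have row: "map (pmf (trans \<Gamma> 0 0 0)) [0..<8] =
      [real 1 / real 2, real 0 / real 1, real 1 / real ?D, real 0 / real 1, real n / real ?D, real 0 / real 1,
       real 0 / real 1, real (n * n) / real ?D]"
    unfolding upt using d_ge by (simp add: pmf_trans transition_prob_def kernel_def start_weight_def)
  show ?thesis
    unfolding row row_codes_def Let_def list_all2_Cons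
    by (intro conjI frac_codeI[OF _ refl] list_all2_Nil[THEN iffD2] refl) simp_all
qed

text \<open>
  Codes of the parts of the input that do not depend on \<open>n\<close>.
\<close>

definition transition_codes :: "nat list" where
  "transition_codes = map fraction_code (table_tail \<Gamma> (2 + 2 * d) (Suc A))"

definition other_codes :: "nat list" where
  "other_codes =
     [list_encode (map fraction_code
        [reward \<Gamma> k i j. k \<leftarrow> [0..<2 + 2 * d], i \<leftarrow> [0..<Suc A], j \<leftarrow> [0..<1::nat]]),
      list_encode (map fraction_code [pmf (return_pmf (0::nat)) k. k \<leftarrow> [0..<2 + 2 * d]]),
      prod_encode (1, 2)]"

lemma input_code_family:
  "input_code \<Gamma> (return_pmf 0) (1 / 2)
     (instance_code (2 + 2 * d) (Suc A) transition_codes other_codes n)"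
  unfolding input_code_def
proof (intro exI conjI)
  let ?ps = "row_codes n @ transition_codes"
  show "states \<Gamma> = {..<2 + 2 * d}" "acts1 \<Gamma> = {..<Suc A}" "acts2 \<Gamma> = {..<1}"
    by (simp_all add: family_game_def)
  have rat: "pmf (trans \<Gamma> k i j) k' \<in> \<rat>" if "k < 2 + 2 * d" "i \<le> A" for k i j k'
    using that by (simp add: pmf_trans Rats_transition_prob)
  have "list_all2 frac_code (table_tail \<Gamma> (2 + 2 * d) (Suc A)) transition_codes"
    unfolding transition_codes_def
    by (rule list_all2_fraction_code) (auto simp: table_tail_def rat)
  then have "list_all2 frac_code (transition_table \<Gamma> (2 + 2 * d) (Suc A) 1) ?ps"
    using start_row_codes d_ge by (subst transition_table_split) (auto intro: list_all2_appendI)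
  then show "list_all2 frac_code [pmf (trans \<Gamma> k i j) k'. k \<leftarrow> [0..<2 + 2 * d], i \<leftarrow> [0..<Suc A],
      j \<leftarrow> [0..<1], k' \<leftarrow> [0..<2 + 2 * d]] ?ps"
    unfolding transition_table_def .
  show "list_all2 frac_code [reward \<Gamma> k i j. k \<leftarrow> [0..<2 + 2 * d], i \<leftarrow> [0..<Suc A], j \<leftarrow> [0..<1]]
      (map fraction_code [reward \<Gamma> k i j. k \<leftarrow> [0..<2 + 2 * d], i \<leftarrow> [0..<Suc A], j \<leftarrow> [0..<1]])"
  proof (rule list_all2_fraction_code)
    fix r assume "r \<in> set [reward \<Gamma> k i j. k \<leftarrow> [0..<2 + 2 * d], i \<leftarrow> [0..<Suc A], j \<leftarrow> [0..<1]]"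
    then obtain k i where k: "k \<in> S" "r = (1 + gain d G k i) / 2"
      by (auto simp: family_game_def simp del: upt_Suc)
    have "0 \<le> (1 + gain d G k i) / 2" using gain_bound[OF k(1), of i] by simp
    then show "r \<in> \<rat> \<and> 0 \<le> r" unfolding k(2) using Rats_reward by blast
  qed
  show "list_all2 frac_code [pmf (return_pmf 0) k. k \<leftarrow> [0..<2 + 2 * d]]
      (map fraction_code [pmf (return_pmf (0::nat)) k. k \<leftarrow> [0..<2 + 2 * d]])"
    by (rule list_all2_fraction_code) (auto simp: indicator_def)
  show "frac_code (1 / 2) (prod_encode (1, 2))" by (rule frac_codeI) auto
  show "instance_code (2 + 2 * d) (Suc A) transition_codes other_codes n =
     list_encode [2 + 2 * d, Suc A, 1, list_encode ?ps,
      list_encode (map fraction_code [reward \<Gamma> k i j. k \<leftarrow> [0..<2 + 2 * d], i \<leftarrow> [0..<Suc A], j \<leftarrow> [0..<1]]),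
      list_encode (map fraction_code [pmf (return_pmf (0::nat)) k. k \<leftarrow> [0..<2 + 2 * d]]),
      prod_encode (1, 2)]"
    by (simp only: instance_code_def other_codes_def)
qed

end

text \<open>
  Only the first eight transition probabilities depend on \<open>n\<close>.
\<close>

lemma codes_independent:
  assumes "linear_family A d M G" "0 < A" "3 \<le> d"
  shows "family_mdp.transition_codes A d M G n = family_mdp.transition_codes A d M G 0"
    "family_mdp.other_codes A d M G n = family_mdp.other_codes A d M G 0"
proof -
  interpret n: family_mdp A d M G n by unfold_locales (fact assms)+
  interpret z: family_mdp A d M G 0 by unfold_locales (fact assms)+
  have eq: "pmf (trans (family_game A d M G n) k i j) k' = pmf (trans (family_game A d M G 0) k i j) k'"
    if "k < 2 + 2 * d" "i \<le> A" "k \<noteq> 0 \<or> i \<noteq> 0 \<or> 8 \<le> k'" for k i j k'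
    using that by (auto simp: n.pmf_trans z.pmf_trans transition_prob_def kernel_def start_weight_def)
  show "family_mdp.transition_codes A d M G n = family_mdp.transition_codes A d M G 0"
    unfolding n.transition_codes_def z.transition_codes_def table_tail_def
    by (intro arg_cong[of _ _ "map fraction_code"] arg_cong2[of _ _ _ _ append] arg_cong[of _ _ concat]
        map_cong refl eq) auto
  show "family_mdp.other_codes A d M G n = family_mdp.other_codes A d M G 0"
    unfolding n.other_codes_def z.other_codes_def by (simp add: family_game_def)
qed

text \<open>
  The contradiction comes from the parameter \<open>n\<close> that encodes the parts of the very game built from
  the set \<open>P\<close>.
\<close>

lemma undecidable_class:
  assumes markov: "\<And>\<Gamma>. markov_blind_MDP \<Gamma> \<Longrightarrow> C \<Gamma>"
  shows "\<not> uniform_value_decidable C"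
proof
  assume "uniform_value_decidable C"
  then obtain f where f: "decides_uniform_value C f" unfolding uniform_value_decidable_def by blast
  define P where "P n \<longleftrightarrow> (\<exists>nk ni ps rest. n = table_code nk ni ps rest \<and>
     computes f [instance_code nk ni ps rest n] 0)" for n
  have "listable {0} (\<lambda>e. P (e 0))" unfolding P_def by (rule listable_diagonal)
  then obtain A d M G where fam: "linear_family A d M G" "0 < A" "3 \<le> d"
    and P: "\<And>n. P n \<longleftrightarrow> (\<exists>w\<in>lists {..<A}. 0 < G 0 w + int n * G 1 w - int n * int n * G 2 w)"
    by (rule ex_linear_family) blast
  define ps rest where "ps = family_mdp.transition_codes A d M G 0" "rest = family_mdp.other_codes A d M G 0"
  define n where "n = table_code (2 + 2 * d) (Suc A) ps rest"
  define c where "c = instance_code (2 + 2 * d) (Suc A) ps rest n"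
  interpret family_mdp A d M G n by unfold_locales (fact fam)+
  have code: "input_code \<Gamma> (return_pmf 0) (1 / 2) c"
    using input_code_family codes_independent[OF fam, of n] by (simp add: c_def ps_rest_def)
  have "return_pmf 0 \<in> distributions (states \<Gamma>)" by (simp add: distributions_def family_game_def)
  moreover have "C \<Gamma>" by (rule markov[OF markov_blind_MDP_family])
  moreover note f[unfolded decides_uniform_value_def, THEN spec, of \<Gamma>, THEN spec, of "\<lambda>_. game_value",
      THEN spec, of "return_pmf 0", THEN spec, of "1 / 2", THEN spec, of c]
  ultimately have dec: "1 / 2 < game_value \<longrightarrow> computes f [c] 1" "game_value \<le> 1 / 2 \<longrightarrow> computes f [c] 0"
    using has_uniform_value_family code by simp_all
  have "P n \<longleftrightarrow> computes f [c] 0"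
    unfolding P_def c_def by (auto simp: n_def table_code_inject)
  moreover have "P n \<longleftrightarrow> 1 / 2 < game_value" unfolding P game_value_gt_iff ..
  ultimately have gt: "1 / 2 < game_value \<longleftrightarrow> computes f [c] 0" by blast
  show False
  proof (cases "1 / 2 < game_value")
    case True
    then have "computes f [c] 1" "computes f [c] 0" using dec(1) gt by blast+
    then show False using computes_unique[of f "[c]" 0 1] by simp
  next
    case False
    then show False using dec(2) gt by linarith
  qed
qed

theorem theorem3p6:
  shows "\<not> uniform_value_decidable markov_blind_MDP \<and> \<not> uniform_value_decidable ergodic_game"
  using undecidable_class markov_blind_MDP_imp_ergodic by blast

end
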